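(* Let $n\ge1$ be an integer and $l\in\mathbb{N}$. (i) Let $\sigma_0\in(0,1)$. Then, for any $v\in W^{l+\sigma_0,2}(\mathbb{R}^n)$, $$\lim_{\sigma\to0^{+}}\sigma\,|v|_{l+\sigma,2,\mathbb{R}^n}^2=\frac{2\pi^{n/2}}{\Gamma(n/2)}\,|v|_{l,2,\mathbb{R}^n}^2.$$ (ii) For any $v\in W^{l+1,2}(\mathbb{R}^n)$, $$\lim_{\sigma\to1^{-}}(1-\sigma)\,|v|_{l+\sigma,2,\mathbb{R}^n}^2=\frac{\pi^{n/2}}{n\,\Gamma(n/2)}\,|\nabla v|_{l,2,\mathbb{R}^n}^2.$$ Here $\Gamma$ is the Euler Gamma function.
   Context: $\mathbb{N}$ contains $0$. $|\cdot|$ is the Euclidean norm on $\mathbb{R}^n$. For a multi-index $\alpha\in\mathbb{N}^n$, $|\alpha|=\alpha_1+\cdots+\alpha_n$ and $\partial^\alpha$ is the corresponding distributional derivative. For $r\in\mathbb{N}$, $W^{r,2}(\mathbb{R}^n)$ is the usual Sobolev space of $v\in L^2(\mathbb{R}^n)$ with $\partial^\alpha v\in L^2(\mathbb{R}^n)$ for all $|\alpha|\le r$, and for $l\in\{0,\dots,r\}$ $$|v|_{l,2,\mathbb{R}^n}=\Bigl(\sum_{|\alpha|=l}\int_{\mathbb{R}^n}|\partial^\alpha v(x)|^2\,dx\Bigr)^{1/2}.$$ For $l\in\mathbb{N}$ and $\sigma\in(0,1)$, the intrinsic (Gagliardo) semi-norm of order $l+\sigma$ is defined by $$|v|_{l+\sigma,2,\mathbb{R}^n}^2=\sum_{|\alpha|=l}\int_{\mathbb{R}^n\times\mathbb{R}^n}\frac{|\partial^\alpha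 v(x)-\partial^\alpha v(y)|^2}{|x-y|^{n+2\sigma}}\,dx\,dy,$$ and $W^{l+\sigma,2}(\mathbb{R}^n)$ is the space of (equivalence classes of) functions $v\in W^{l,2}(\mathbb{R}^n)$ with $|v|_{l+\sigma,2,\mathbb{R}^n}<\infty$. For $v\in W^{l+1,2}(\mathbb{R}^n)$, $$|\nabla v|_{0,2,\mathbb{R}^n}=\Bigl(\int_{\mathbb{R}^n}|\nabla v(x)|^2\,dx\Bigr)^{1/2},\qquad |\nabla v|_{l,2,\mathbb{R}^n}=\Bigl(\sum_{|\alpha|=l}|\nabla(\partial^\alpha v)|_{0,2,\mathbb{R}^n}^2\Bigr)^{1/2}.$$ *)

theory Defs
  imports "HOL-Analysis.Analysis" "HOL-Library.Multiset"
begin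


text \<open>\<open>\<real>\<^sup>n\<close> is \<open>real ^ 'n\<close> with \<open>n = CARD('n)\<close>, and a multi-index is an element of \<open>nat ^ 'n\<close>.\<close>

definition partial_deriv :: "'n::finite \<Rightarrow> (real ^ 'n \<Rightarrow> real) \<Rightarrow> real ^ 'n \<Rightarrow> real" where
  "partial_deriv i f x = frechet_derivative f (at x) (axis i 1)"

primrec C_k :: "nat \<Rightarrow> (real ^ 'n::finite \<Rightarrow> real) \<Rightarrow> bool" where
  "C_k 0 f \<longleftrightarrow> continuous_on UNIV f"
| "C_k (Suc k) f \<longleftrightarrow> (\<forall>x. f differentiable (at x)) \<and> (\<forall>i. C_k k (partial_deriv i f))"

definition smooth :: "(real ^ 'n::finite \<Rightarrow> real) \<Rightarrow> bool" where
  "smooth f \<longleftrightarrow> (\<forall>k. C_k k f)"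

definition test_function :: "(real ^ 'n::finite \<Rightarrow> real) \<Rightarrow> bool" where
  "test_function \<phi> \<longleftrightarrow> smooth \<phi> \<and> compact (closure {x. \<phi> x \<noteq> 0})"

definition mi_abs :: "nat ^ 'n::finite \<Rightarrow> nat" where
  "mi_abs \<alpha> = (\<Sum>i\<in>UNIV. \<alpha> $ i)"

text \<open>The index type \<open>'n\<close> carries no order, so the order in which the partial derivatives are taken
  is left unspecified; for smooth functions it is irrelevant, see \<open>multi_partial_eq\<close> below.\<close>

definition multi_partial :: "nat ^ 'n::finite \<Rightarrow> (real ^ 'n \<Rightarrow> real) \<Rightarrow> real ^ 'n \<Rightarrow> real" where
  "multi_partial \<alpha> f = foldr partial_deriv (SOME js. \<forall>i. count (mset js) i = \<alpha> $ i) f"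

lemma finite_mi_abs_eq: "finite {\<alpha> :: nat ^ 'n::finite. mi_abs \<alpha> = l}"
proof -
  have le: "\<alpha> $ i \<le> mi_abs \<alpha>" for \<alpha> :: "nat ^ 'n" and i
    unfolding mi_abs_def by (rule member_le_sum) auto
  have "{\<alpha> :: nat ^ 'n. mi_abs \<alpha> = l} \<subseteq> vec_lambda ` (UNIV \<rightarrow>\<^sub>E {..l})"
  proof
    fix \<alpha> :: "nat ^ 'n" assume "\<alpha> \<in> {\<alpha>. mi_abs \<alpha> = l}"
    hence "vec_nth \<alpha> \<in> UNIV \<rightarrow>\<^sub>E {..l}" using le[of \<alpha>] by auto
    thus "\<alpha> \<in> vec_lambda ` (UNIV \<rightarrow>\<^sub>E {..l})"
      by (intro image_eqI[where x = "vec_nth \<alpha>"]) auto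
  qed
  thus ?thesis by (rule finite_subset) (intro finite_imageI finite_PiE, auto)
qed

lemma smooth_partial_deriv: "smooth f \<Longrightarrow> smooth (partial_deriv i f)"
  unfolding smooth_def using C_k.simps(2) by blast

lemma smooth_foldr: "smooth f \<Longrightarrow> smooth (foldr partial_deriv js f)"
  by (induction js) (auto intro: smooth_partial_deriv)

lemma smooth_differentiable: "smooth f \<Longrightarrow> f differentiable (at x)"
  unfolding smooth_def using C_k.simps(2) by blast

lemma smooth_continuous: "smooth f \<Longrightarrow> continuous_on UNIV f"
  unfolding smooth_def using C_k.simps(1) by blast

lemma partial_deriv_line:
  fixes f :: "real ^ 'n::finite \<Rightarrow> real"
  assumes "f differentiable (at (y + s *\<^sub>R axis i 1))"
  shows "((\<lambda>s. f (y + s *\<^sub>R axis i 1)) has_real_derivative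
           partial_deriv i f (y + s *\<^sub>R axis i 1)) (at s)"
proof -
  let ?p = "y + s *\<^sub>R axis i 1" and ?D = "frechet_derivative f (at (y + s *\<^sub>R axis i 1))"
  have f: "(f has_derivative ?D) (at ?p)"
    using assms frechet_derivative_works by blast
  have g: "((\<lambda>s. y + s *\<^sub>R axis i 1) has_derivative (\<lambda>t. t *\<^sub>R axis i 1)) (at s)"
    by (auto intro!: derivative_eq_intros)
  have "((\<lambda>s. f (y + s *\<^sub>R axis i 1)) has_derivative (\<lambda>t. ?D (t *\<^sub>R axis i 1))) (at s)"
    by (rule has_derivative_compose[OF g f])
  moreover have "(\<lambda>t. ?D (t *\<^sub>R axis i 1)) = (*) (partial_deriv i f ?p)"
    using linear_frechet_derivative[OF assms]
    by (auto simp: partial_deriv_def linear_cmul fun_eq_iff)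
  ultimately show ?thesis by (simp add: has_field_derivative_def)
qed

lemma second_difference:
  fixes f :: "real ^ 'n::finite \<Rightarrow> real"
  assumes f: "smooth f" and h: "0 < h"
  shows "\<exists>z. norm (z - x) \<le> 2 * h \<and>
    f (x + h *\<^sub>R axis i 1 + h *\<^sub>R axis j 1) - f (x + h *\<^sub>R axis i 1)
      - f (x + h *\<^sub>R axis j 1) + f x = h * h * partial_deriv j (partial_deriv i f) z"
proof -
  let ?a = "axis i (1::real)" and ?b = "axis j (1::real)"
  have "((\<lambda>s. f ((x + h *\<^sub>R ?b) + s *\<^sub>R ?a) - f (x + s *\<^sub>R ?a)) has_real_derivative
     partial_deriv i f ((x + h *\<^sub>R ?b) + s *\<^sub>R ?a) - partial_deriv i f (x + s *\<^sub>R ?a)) (at s)" for s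
    by (intro DERIV_diff partial_deriv_line smooth_differentiable f)
  from MVT2[OF h, of "\<lambda>s. f ((x + h *\<^sub>R ?b) + s *\<^sub>R ?a) - f (x + s *\<^sub>R ?a)", OF this]
  obtain s where s: "0 < s" "s < h" and 1:
    "(f ((x + h *\<^sub>R ?b) + h *\<^sub>R ?a) - f (x + h *\<^sub>R ?a)) - (f (x + h *\<^sub>R ?b) - f x)
      = h * (partial_deriv i f ((x + h *\<^sub>R ?b) + s *\<^sub>R ?a) - partial_deriv i f (x + s *\<^sub>R ?a))"
    by auto
  have "((\<lambda>t. partial_deriv i f ((x + s *\<^sub>R ?a) + t *\<^sub>R ?b)) has_real_derivative
     partial_deriv j (partial_deriv i f) ((x + s *\<^sub>R ?a) + t *\<^sub>R ?b)) (at t)" for t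
    by (intro partial_deriv_line smooth_differentiable smooth_partial_deriv f)
  from MVT2[OF h, of "\<lambda>t. partial_deriv i f ((x + s *\<^sub>R ?a) + t *\<^sub>R ?b)", OF this]
  obtain t where t: "0 < t" "t < h" and 2:
    "partial_deriv i f ((x + s *\<^sub>R ?a) + h *\<^sub>R ?b) - partial_deriv i f (x + s *\<^sub>R ?a)
      = h * partial_deriv j (partial_deriv i f) ((x + s *\<^sub>R ?a) + t *\<^sub>R ?b)"
    by auto
  have 3: "(x + s *\<^sub>R ?a) + h *\<^sub>R ?b = (x + h *\<^sub>R ?b) + s *\<^sub>R ?a"
    "x + h *\<^sub>R ?a + h *\<^sub>R ?b = (x + h *\<^sub>R ?b) + h *\<^sub>R ?a" by simp_all
  have "norm ((x + s *\<^sub>R ?a) + t *\<^sub>R ?b - x) \<le> norm (s *\<^sub>R ?a) + norm (t *\<^sub>R ?b)"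
    using norm_triangle_ineq[of "s *\<^sub>R ?a" "t *\<^sub>R ?b"] by (simp add: algebra_simps)
  also have "\<dots> \<le> 2 * h" using s t by simp
  finally show ?thesis
    using 1 2 unfolding 3 by (intro exI[where x = "(x + s *\<^sub>R ?a) + t *\<^sub>R ?b"]) (simp add: 3)
qed

lemma partial_deriv_commute:
  fixes f :: "real ^ 'n::finite \<Rightarrow> real"
  assumes f: "smooth f"
  shows "partial_deriv i (partial_deriv j f) = partial_deriv j (partial_deriv i f)"
proof
  fix x
  let ?F = "partial_deriv j (partial_deriv i f)" and ?G = "partial_deriv i (partial_deriv j f)"
  have "\<exists>z w. norm (z - x) \<le> 2 * inverse (real (Suc n)) \<and> norm (w - x) \<le> 2 * inverse (real (Suc n))
     \<and> ?F z = ?G w" for n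
  proof -
    let ?h = "inverse (real (Suc n))"
    have h: "0 < ?h" by simp
    obtain z where z: "norm (z - x) \<le> 2 * ?h"
      "f (x + ?h *\<^sub>R axis i 1 + ?h *\<^sub>R axis j 1) - f (x + ?h *\<^sub>R axis i 1)
        - f (x + ?h *\<^sub>R axis j 1) + f x = ?h * ?h * ?F z"
      using second_difference[OF f h, of x i j] by blast
    obtain w where w: "norm (w - x) \<le> 2 * ?h"
      "f (x + ?h *\<^sub>R axis j 1 + ?h *\<^sub>R axis i 1) - f (x + ?h *\<^sub>R axis j 1)
        - f (x + ?h *\<^sub>R axis i 1) + f x = ?h * ?h * ?G w"
      using second_difference[OF f h, of x j i] by blast
    have "x + ?h *\<^sub>R axis j 1 + ?h *\<^sub>R axis i 1 = x + ?h *\<^sub>R axis i 1 + ?h *\<^sub>R axis j 1"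
      by simp
    hence "?h * ?h * ?F z = ?h * ?h * ?G w"
      unfolding z(2)[symmetric] w(2)[symmetric] by (simp add: add.commute add.left_commute)
    hence "?F z = ?G w" by simp
    with z(1) w(1) show ?thesis by blast
  qed
  then obtain z w where z: "\<And>n. norm (z n - x) \<le> 2 * inverse (real (Suc n))"
    and w: "\<And>n. norm (w n - x) \<le> 2 * inverse (real (Suc n))" and eq: "\<And>n. ?F (z n) = ?G (w n)"
    by metis
  have lim0: "(\<lambda>n. 2 * inverse (real (Suc n))) \<longlonglongrightarrow> 0"
    using tendsto_mult_right_zero[OF LIMSEQ_inverse_real_of_nat] by blast
  have "z \<longlonglongrightarrow> x"
    by (rule Lim_transform[OF tendsto_const[of x]], rule Lim_null_comparison[OF _ lim0])
       (use z in \<open>auto simp: norm_minus_commute\<close>)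
  moreover have "w \<longlonglongrightarrow> x"
    by (rule Lim_transform[OF tendsto_const[of x]], rule Lim_null_comparison[OF _ lim0])
       (use w in \<open>auto simp: norm_minus_commute\<close>)
  moreover have "isCont ?F x" "isCont ?G x"
    using smooth_continuous smooth_partial_deriv f by (metis continuous_on_eq_continuous_at open_UNIV UNIV_I)+
  ultimately have "(\<lambda>n. ?F (z n)) \<longlonglongrightarrow> ?F x" "(\<lambda>n. ?G (w n)) \<longlonglongrightarrow> ?G x"
    by (auto intro: isCont_tendsto_compose)
  thus "?G x = ?F x" using eq LIMSEQ_unique by auto
qed

lemma foldr_partial_deriv_move:
  "smooth f \<Longrightarrow> foldr partial_deriv (us @ a # vs) f = foldr partial_deriv (a # us @ vs) f"
proof (induction us)
  case (Cons u us)
  thus ?case using partial_deriv_commute[OF smooth_foldr[OF Cons.prems, of "us @ vs"], of u a] by simp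
qed simp

lemma foldr_partial_deriv_perm:
  "smooth f \<Longrightarrow> mset js = mset ks \<Longrightarrow> foldr partial_deriv js f = foldr partial_deriv ks f"
proof (induction js arbitrary: ks)
  case (Cons a js)
  then have "a \<in> set ks" by (metis list.set_intros(1) set_mset_mset)
  then obtain us vs where ks: "ks = us @ a # vs" by (meson split_list)
  with Cons.prems have "mset js = mset (us @ vs)" by simp
  hence "foldr partial_deriv js f = foldr partial_deriv (us @ vs) f"
    using Cons.IH Cons.prems(1) by blast
  hence "foldr partial_deriv (a # js) f = foldr partial_deriv (a # us @ vs) f" by simp
  thus ?case unfolding ks foldr_partial_deriv_move[OF Cons.prems(1)] .
qed simp

lemma multi_partial_eq:
  fixes f :: "real ^ 'n::finite \<Rightarrow> real"
  assumes "smooth f" and "\<And>i. count (mset js) i = \<alpha> $ i"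
  shows "multi_partial \<alpha> f = foldr partial_deriv js f"
proof -
  have "\<forall>i. count (mset (SOME js. \<forall>i. count (mset js) i = \<alpha> $ i)) i = \<alpha> $ i"
    by (rule someI_ex) (use assms(2) in blast)
  thus ?thesis unfolding multi_partial_def
    by (intro foldr_partial_deriv_perm assms multiset_eqI) (simp add: assms(2))
qed

lemma multi_index_list_exists:
  fixes \<alpha> :: "nat ^ 'n::finite"
  shows "\<exists>js. \<forall>i. count (mset js) i = \<alpha> $ i"
proof -
  have "finite {i. 0 < \<alpha> $ i}" by simp
  hence "count (Abs_multiset (vec_nth \<alpha>)) = vec_nth \<alpha>" by (rule count_Abs_multiset)
  thus ?thesis by (metis ex_mset)
qed



text \<open>Elements of \<open>L\<^sup>2\<close> are handled through representatives: functions, not classes modulo null sets.\<close>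

definition L2_fun :: "(real ^ 'n::finite \<Rightarrow> real) \<Rightarrow> bool" where
  "L2_fun v \<longleftrightarrow> v \<in> borel_measurable lebesgue \<and> integrable lebesgue (\<lambda>x. (v x)\<^sup>2)"

text \<open>\<open>w \<in> L\<^sup>2\<close> is the distributional derivative \<open>\<partial>\<^sup>\<alpha> v\<close> of \<open>v \<in> L\<^sup>2\<close>.\<close>

definition has_weak_deriv ::
    "nat ^ 'n::finite \<Rightarrow> (real ^ 'n \<Rightarrow> real) \<Rightarrow> (real ^ 'n \<Rightarrow> real) \<Rightarrow> bool" where
  "has_weak_deriv \<alpha> v w \<longleftrightarrow> L2_fun v \<and> L2_fun w \<and>
     (\<forall>\<phi>. test_function \<phi> \<longrightarrow>
        integral\<^sup>L lebesgue (\<lambda>x. v x * multi_partial \<alpha> \<phi> x)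
          = (-1) ^ mi_abs \<alpha> * integral\<^sup>L lebesgue (\<lambda>x. w x * \<phi> x))"

text \<open>A representative of \<open>\<partial>\<^sup>\<alpha> v\<close>, determined up to a null set. It is meaningful only if
  \<open>\<partial>\<^sup>\<alpha> v\<close> exists as an element of \<open>L\<^sup>2\<close>.\<close>

definition weak_deriv :: "nat ^ 'n::finite \<Rightarrow> (real ^ 'n \<Rightarrow> real) \<Rightarrow> real ^ 'n \<Rightarrow> real" where
  "weak_deriv \<alpha> v = (SOME w. has_weak_deriv \<alpha> v w)"

definition sobolev :: "nat \<Rightarrow> (real ^ 'n::finite \<Rightarrow> real) set" where
  "sobolev r = {v. L2_fun v \<and> (\<forall>\<alpha>. mi_abs \<alpha> \<le> r \<longrightarrow> (\<exists>w. has_weak_deriv \<alpha> v w))}"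

definition seminorm :: "nat \<Rightarrow> (real ^ 'n::finite \<Rightarrow> real) \<Rightarrow> real" where
  "seminorm l v =
     sqrt (\<Sum>\<alpha> | mi_abs \<alpha> = l. integral\<^sup>L lebesgue (\<lambda>x. \<bar>weak_deriv \<alpha> v x\<bar>\<^sup>2))"

text \<open>The square of the intrinsic semi-norm of order \<open>l + \<sigma>\<close>, as an element of \<open>[0, \<infinity>]\<close>.
  The integrand is \<open>0\<close> on the diagonal, a null set, because \<open>0 / 0 = 0\<close>.\<close>

definition frac_seminorm_sq :: "nat \<Rightarrow> real \<Rightarrow> (real ^ 'n::finite \<Rightarrow> real) \<Rightarrow> ennreal" where
  "frac_seminorm_sq l \<sigma> v =
     (\<Sum>\<alpha> | mi_abs \<alpha> = l. \<integral>\<^sup>+ (x, y). ennreal (\<bar>weak_deriv \<alpha> v x - weak_deriv \<alpha> v y\<bar>\<^sup>2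
        / norm (x - y) powr (real CARD('n) + 2 * \<sigma>)) \<partial>(lebesgue :: ((real ^ 'n) \<times> (real ^ 'n)) measure))"

definition sobolev_frac :: "nat \<Rightarrow> real \<Rightarrow> (real ^ 'n::finite \<Rightarrow> real) set" where
  "sobolev_frac l \<sigma> = {v \<in> sobolev l. frac_seminorm_sq l \<sigma> v < \<infinity>}"

definition weak_grad :: "(real ^ 'n::finite \<Rightarrow> real) \<Rightarrow> real ^ 'n \<Rightarrow> real ^ 'n" where
  "weak_grad u x = (\<chi> i. weak_deriv (axis i 1) u x)"

definition grad_norm :: "(real ^ 'n::finite \<Rightarrow> real) \<Rightarrow> real" where
  "grad_norm u = sqrt (integral\<^sup>L lebesgue (\<lambda>x. (norm (weak_grad u x))\<^sup>2))"

definition grad_seminorm :: "nat \<Rightarrow> (real ^ 'n::finite \<Rightarrow> real) \<Rightarrow> real" where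
  "grad_seminorm l v = sqrt (\<Sum>\<alpha> | mi_abs \<alpha> = l. (grad_norm (weak_deriv \<alpha> v))\<^sup>2)"

end

theory Submission
  imports Defs
begin

text \<open>For each multi-index the double integral concerns a single square integrable function \<open>u\<close>. The
substitution \<open>y = x + h\<close> and Tonelli's theorem turn it into
\<open>\<integral> \<omega>(h) \<bar>h\<bar>\<^bsup>-n-2\<sigma>\<^esup> dh\<close> with \<open>\<omega>(h) = \<parallel>u(\<cdot> + h) - u\<parallel>\<^sup>2\<close>. In polar coordinates the kernel alone has the
integrals \<open>S R\<^bsup>-2\<sigma>\<^esup> / 2\<sigma>\<close> over \<open>\<bar>h\<bar> \<ge> R\<close> and, with the extra factor \<open>\<bar>h\<bar>\<^sup>2\<close>,
\<open>S R\<^bsup>2-2\<sigma>\<^esup> / (2 - 2\<sigma>)\<close> over \<open>\<bar>h\<bar> \<le> R\<close>, where \<open>S\<close> is the area of the unit sphere. Multiplying by \<open>\<sigma>\<close>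
therefore makes all the mass escape to infinity as \<open>\<sigma> \<rightarrow> 0\<close>, and multiplying by \<open>1 - \<sigma>\<close> makes it
concentrate at the origin as \<open>\<sigma> \<rightarrow> 1\<close>. Only the behaviour of \<open>\<omega>\<close> at infinity, respectively at the
origin, survives in the limit; these two principles are \<open>kernel_energy_tendsto_at_0\<close> and
\<open>kernel_energy_tendsto_at_1\<close>.

At infinity, \<open>u(\<cdot> + h)\<close> and \<open>u\<close> become orthogonal, because most of the mass of each lies in a ball
and the two balls separate. Hence \<open>\<omega>(h) \<rightarrow> 2\<parallel>u\<parallel>\<^sup>2\<close> (\<open>translation_sqdiff_at_infinity\<close>) and the first limit is
\<open>S \<parallel>u\<parallel>\<^sup>2\<close>; finiteness of the energy at one \<open>\<sigma>\<^sub>0\<close> controls the part near the origin.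

At the origin, \<open>\<omega>(h) = \<parallel>h \<bullet> \<nabla>u\<parallel>\<^sup>2 + o(\<bar>h\<bar>\<^sup>2)\<close> (\<open>translation_sqdiff_second_order\<close>). To see this, pair the
remainder \<open>u(\<cdot> + h) - u - h \<bullet> \<nabla>u\<close> with a test function \<open>\<phi>\<close>. The function \<open>t \<mapsto> \<integral> u(x) \<phi>(x - t h) dx\<close> has
derivative \<open>\<integral> (h \<bullet> \<nabla>u(x)) \<phi>(x - t h) dx\<close> by the definition of a weak derivative, so the mean value
theorem writes the pairing as \<open>\<integral> h \<bullet> (\<nabla>u(x + \<theta>h) - \<nabla>u(x)) \<phi>(x) dx\<close> for some \<open>\<theta>\<close> in \<open>(0, 1)\<close>. Since
test functions are dense (\<open>test_functions_dense\<close>), the norm of the remainder is at most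
\<open>\<bar>h\<bar>\<close> times the modulus of continuity of \<open>k \<mapsto> \<nabla>u(\<cdot> + k)\<close> in the mean, which tends to \<open>0\<close>. By the symmetry
of the kernel under reflections and permutations of the coordinates, \<open>(h \<bullet> a)\<^sup>2\<close> averages to \<open>\<bar>a\<bar>\<^sup>2 \<bar>h\<bar>\<^sup>2 / n\<close>
(\<open>radial_second_moments\<close>), and the second limit is \<open>S / 2n\<close> times \<open>\<parallel>\<nabla>u\<parallel>\<^sup>2\<close>.

Integrals are computed with Borel representatives and the Borel-Lebesgue measure, where Tonelli's
theorem applies directly; changing \<open>u\<close> on a null set \<open>N\<close> changes the double integrand only on the
null set \<open>N \<times> \<real>\<^sup>n \<union> \<real>\<^sup>n \<times> N\<close>.\<close>

section \<open>Calculus of smooth functions\<close>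

lemma partial_deriv_eqI:
  fixes f :: "real ^ 'n::finite \<Rightarrow> real"
  assumes "(f has_derivative f') (at x)"
  shows "partial_deriv i f x = f' (axis i 1)"
  unfolding partial_deriv_def using frechet_derivative_at[OF assms] by simp

lemma has_derivative_of_partials:
  fixes f :: "real ^ 'n::finite \<Rightarrow> real"
  assumes "f differentiable (at x)"
  shows "(f has_derivative (\<lambda>h. \<Sum>i\<in>UNIV. h $ i * partial_deriv i f x)) (at x)"
proof -
  let ?D = "frechet_derivative f (at x)"
  have D: "(f has_derivative ?D) (at x)"
    using assms frechet_derivative_works by blast
  have lin: "linear ?D" by (rule linear_frechet_derivative[OF assms])
  have "?D h = (\<Sum>i\<in>UNIV. h $ i * partial_deriv i f x)" for h
  proof -
    have "?D h = ?D (\<Sum>i\<in>UNIV. (h $ i) *\<^sub>R axis i 1)"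
      using basis_expansion[of h] by (simp add: scalar_mult_eq_scaleR)
    also have "\<dots> = (\<Sum>i\<in>UNIV. h $ i * partial_deriv i f x)"
      by (simp add: linear_sum[OF lin] linear_cmul[OF lin] partial_deriv_def)
    finally show ?thesis .
  qed
  then have "?D = (\<lambda>h. \<Sum>i\<in>UNIV. h $ i * partial_deriv i f x)" by (rule ext)
  then show ?thesis using D by simp
qed

lemma C_k_Suc_imp: "C_k (Suc k) f \<Longrightarrow> C_k k f"
proof (induction k arbitrary: f)
  case 0
  then show ?case
    by (auto intro!: differentiable_imp_continuous_on simp: differentiable_on_def
          intro: differentiable_at_withinI)
next
  case (Suc k)
  then show ?case unfolding C_k.simps(2)[of "Suc k"] C_k.simps(2)[of k] by blast
qed

lemma C_k_const: "C_k k (\<lambda>x :: real ^ 'n::finite. c)"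
proof (induction k arbitrary: c)
  case (Suc k)
  have "partial_deriv i (\<lambda>x. c) = (\<lambda>x. 0)" for i :: 'n
    by (rule ext, subst partial_deriv_eqI[OF has_derivative_const]) simp
  then show ?case using Suc by simp
qed simp

lemma C_k_bounded_linear:
  assumes "bounded_linear f"
  shows "C_k k f"
proof (cases k)
  case 0
  then show ?thesis using assms by (simp add: linear_continuous_on)
next
  case (Suc m)
  have d: "(f has_derivative f) (at x)" for x
    by (rule bounded_linear_imp_has_derivative[OF assms])
  have "partial_deriv i f = (\<lambda>x. f (axis i 1))" for i
    by (rule ext) (rule partial_deriv_eqI[OF d])
  then show ?thesis using d Suc by (auto simp: C_k_const differentiable_def)
qed

lemma C_k_add:
  assumes "C_k k f" "C_k k g"
  shows "C_k k (\<lambda>x. f x + g x)"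
  using assms
proof (induction k arbitrary: f g)
  case (Suc k)
  have "partial_deriv i (\<lambda>x. f x + g x) = (\<lambda>x. partial_deriv i f x + partial_deriv i g x)" for i
    using Suc.prems
    by (intro ext, subst partial_deriv_eqI[OF has_derivative_add
          [OF has_derivative_of_partials has_derivative_of_partials]])
       (auto simp: axis_def if_distrib[of "\<lambda>t. t * _"] cong: if_cong)
  then show ?case using Suc by (auto intro: differentiable_add)
qed (auto intro: continuous_intros)

lemma C_k_mult:
  assumes "C_k k f" "C_k k g"
  shows "C_k k (\<lambda>x. f x * g x)"
  using assms
proof (induction k arbitrary: f g)
  case (Suc k)
  have "partial_deriv i (\<lambda>x. f x * g x) = (\<lambda>x. f x * partial_deriv i g x + partial_deriv i f x * g x)"
    for i
    using Suc.prems
    by (intro ext, subst partial_deriv_eqI[OF has_derivative_mult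
          [OF has_derivative_of_partials has_derivative_of_partials]])
       (auto simp: axis_def if_distrib[of "\<lambda>t. t * _"] cong: if_cong)
  moreover have "C_k k f" "C_k k g" using Suc.prems C_k_Suc_imp by blast+
  ultimately show ?case using Suc by (auto intro!: differentiable_mult C_k_add)
qed (auto intro: continuous_intros)

lemma smooth_const: "smooth (\<lambda>x. c)"
  by (simp add: smooth_def C_k_const)

lemma smooth_mult: "smooth f \<Longrightarrow> smooth g \<Longrightarrow> smooth (\<lambda>x. f x * g x)"
  by (simp add: smooth_def C_k_mult)

lemma smooth_prod: "(\<And>i. i \<in> I \<Longrightarrow> smooth (f i)) \<Longrightarrow> smooth (\<lambda>x. \<Prod>i\<in>I. f i x)"
  by (induction I rule: infinite_finite_induct) (auto intro: smooth_const smooth_mult)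

lemma smooth_real_polynomial_function:
  "real_polynomial_function p \<Longrightarrow> smooth p"
  by (induction p rule: real_polynomial_function.induct)
     (auto simp: smooth_def C_k_bounded_linear C_k_const C_k_add C_k_mult)

lemma has_derivative_translate:
  fixes f :: "real ^ 'n::finite \<Rightarrow> real"
  assumes "f differentiable (at (x + c))"
  shows "((\<lambda>x. f (x + c)) has_derivative frechet_derivative f (at (x + c))) (at x)"
proof -
  have "(f has_derivative frechet_derivative f (at (x + c))) (at (x + c))"
    using assms frechet_derivative_works by blast
  moreover have "((\<lambda>x. x + c) has_derivative (\<lambda>h. h)) (at x)"
    by (auto intro!: derivative_eq_intros)
  ultimately show ?thesis by (rule has_derivative_compose[rotated])
qed

lemma partial_deriv_translate:
  fixes f :: "real ^ 'n::finite \<Rightarrow> real"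
  assumes "f differentiable (at (x + c))"
  shows "partial_deriv i (\<lambda>x. f (x + c)) x = partial_deriv i f (x + c)"
  using partial_deriv_eqI[OF has_derivative_translate[OF assms]] by (simp add: partial_deriv_def)

lemma C_k_translate: "C_k k f \<Longrightarrow> C_k k (\<lambda>x. f (x + c))"
proof (induction k arbitrary: f)
  case 0
  then show ?case
    by (auto intro!: continuous_intros continuous_on_compose2[of UNIV f])
next
  case (Suc k)
  have d: "f differentiable (at x)" for x using Suc.prems by simp
  have "partial_deriv i (\<lambda>x. f (x + c)) = (\<lambda>x. partial_deriv i f (x + c))" for i
    by (rule ext) (rule partial_deriv_translate[OF d])
  moreover have "(\<lambda>x. f (x + c)) differentiable (at x)" for x
    using has_derivative_translate[OF d] differentiable_def by blast
  ultimately show ?case using Suc by simp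
qed

lemma smooth_translate: "smooth f \<Longrightarrow> smooth (\<lambda>x. f (x + c))"
  by (simp add: smooth_def C_k_translate)

text \<open>The standard source of bump functions. All orders \<open>m\<close> are treated at once because differentiation
maps the family into its own linear span, so that smoothness is a single induction.\<close>

definition flat :: "nat \<Rightarrow> real \<Rightarrow> real" where
  "flat m t = (if t > 0 then exp (- (1 / t)) / t ^ m else 0)"

lemma flat_tendsto_0: "(flat m \<longlongrightarrow> 0) (at 0)"
proof -
  have "((\<lambda>t. inverse t ^ m / exp (inverse t)) \<longlongrightarrow> (0::real)) (at_right 0)"
    by (rule filterlim_compose[OF tendsto_power_div_exp_0 filterlim_inverse_at_top_right])
  then have r: "(flat m \<longlongrightarrow> 0) (at_right 0)"
    by (rule Lim_transform_eventually)
       (auto simp: flat_def eventually_at_filter exp_minus field_simps)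
  have l: "(flat m \<longlongrightarrow> 0) (at_left 0)"
    by (rule tendsto_eventually) (auto simp: flat_def eventually_at_filter)
  show ?thesis using l r by (simp add: filterlim_split_at)
qed

lemma flat_deriv:
  "(flat m has_real_derivative (flat (m + 2) t - real m * flat (m + 1) t)) (at t)"
proof (cases t "0 :: real" rule: linorder_cases)
  case less
  have "((\<lambda>t. 0) has_real_derivative 0) (at t)" by simp
  then have "(flat m has_real_derivative 0) (at t)"
    by (rule has_field_derivative_transform_within_open[of _ _ _ "{..<0}"])
       (use less in \<open>auto simp: flat_def\<close>)
  then show ?thesis using less by (simp add: flat_def)
next
  case equal
  have "(\<lambda>h. (flat m (0 + h) - flat m 0) / h) = flat (m + 1)"
    by (auto simp: flat_def fun_eq_iff)
  then have "(flat m has_real_derivative 0) (at 0)"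
    unfolding DERIV_def using flat_tendsto_0 by simp
  then show ?thesis using equal by (simp add: flat_def)
next
  case greater
  have "((\<lambda>t. exp (- (1 / t)) / t ^ m) has_real_derivative
      (flat (m + 2) t - real m * flat (m + 1) t)) (at t)"
    using greater
    by (auto intro!: derivative_eq_intros simp: flat_def divide_simps power2_eq_square)
       (cases m; simp add: algebra_simps)+
  then show ?thesis
    by (rule has_field_derivative_transform_within_open[of _ _ _ "{0<..}"])
       (use greater in \<open>auto simp: flat_def\<close>)
qed

lemma C_k_flat: "C_k k (\<lambda>x :: real ^ 'n::finite. flat m (c * x $ i + d))"
proof (induction k arbitrary: m)
  case 0
  have "continuous_on UNIV (flat m)"
    using flat_deriv by (meson DERIV_continuous continuous_at_imp_continuous_on)
  then show ?case
    by (auto intro!: continuous_on_compose2[of UNIV "flat m"] continuous_intros)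
next
  case (Suc k)
  let ?f = "\<lambda>x :: real ^ 'n. flat m (c * x $ i + d)"
  let ?D = "\<lambda>x :: real ^ 'n. flat (m + 2) (c * x $ i + d) + (- real m) * flat (m + 1) (c * x $ i + d)"
  have d: "(?f has_derivative (\<lambda>h. ?D x * (c * h $ i))) (at x)" for x
  proof -
    have "((\<lambda>x :: real ^ 'n. c * x $ i + d) has_derivative (\<lambda>h. c * h $ i)) (at x)"
      by (auto intro!: derivative_eq_intros bounded_linear_imp_has_derivative
            bounded_linear_vec_nth)
    from has_derivative_compose[OF this flat_deriv[of m, unfolded has_field_derivative_def]]
    show ?thesis by simp
  qed
  have "partial_deriv j ?f = (\<lambda>x. ?D x * (c * axis j 1 $ i))" for j
    by (rule ext) (rule partial_deriv_eqI[OF d])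
  moreover have "C_k k ?D" by (intro C_k_mult C_k_add C_k_const Suc)
  ultimately show ?case
    using d unfolding C_k.simps by (auto simp only: differentiable_def intro!: C_k_mult C_k_const)
qed

section \<open>Test functions are dense in the square integrable functions\<close>

text \<open>As \<open>k\<close> grows these smooth functions converge pointwise and boundedly to the indicator of the open box,
since \<open>exp (-1 / (k t)) \<rightarrow> 1\<close> for \<open>t > 0\<close>. The arguments of \<open>flat\<close> are
written in the form \<open>c * x $ i + d\<close> to match \<open>C_k_flat\<close>.\<close>

definition box_cutoff :: "nat \<Rightarrow> real ^ 'n::finite \<Rightarrow> real ^ 'n \<Rightarrow> real ^ 'n \<Rightarrow> real" where
  "box_cutoff k a b x =
     (\<Prod>i\<in>UNIV. flat 0 (real k * x $ i + - real k * a $ i) * flat 0 (- real k * x $ i + real k * b $ i))"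

lemma flat_0_bounds: "0 \<le> flat 0 t" "flat 0 t \<le> 1"
  by (auto simp: flat_def)

lemma box_cutoff_bounds: "0 \<le> box_cutoff k a b x" "box_cutoff k a b x \<le> 1"
  unfolding box_cutoff_def
  by (auto intro!: prod_nonneg prod_le_1 mult_nonneg_nonneg mult_le_one flat_0_bounds
      simp del: mult_minus_left)

lemma box_cutoff_eq_0:
  assumes "x \<notin> box a b"
  shows "box_cutoff k a b x = 0"
proof -
  obtain i where "x $ i \<le> a $ i \<or> b $ i \<le> x $ i"
    using assms by (auto simp: mem_box_cart not_less)
  then have "real k * x $ i + - real k * a $ i \<le> 0 \<or> - real k * x $ i + real k * b $ i \<le> 0"
    by (auto intro: mult_left_mono)
  then show ?thesis unfolding box_cutoff_def
    by (intro prod_zero bexI[of _ i]) (auto simp: flat_def)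
qed

lemma flat_scaled_tendsto_1:
  assumes "t > 0"
  shows "(\<lambda>k. flat 0 (real k * t)) \<longlonglongrightarrow> 1"
proof -
  have "(\<lambda>k. exp (- (inverse (real k) * (1 / t)))) \<longlonglongrightarrow> exp (- (0 * (1 / t)))"
    by (intro tendsto_intros lim_inverse_n)
  moreover have "eventually (\<lambda>k. exp (- (inverse (real k) * (1 / t))) = flat 0 (real k * t)) sequentially"
    using eventually_gt_at_top[of 0] by eventually_elim (use assms in \<open>auto simp: flat_def field_simps\<close>)
  ultimately show ?thesis using Lim_transform_eventually by fastforce
qed

lemma box_cutoff_tendsto: "(\<lambda>k. box_cutoff k a b x) \<longlonglongrightarrow> indicator (box a b) x"
proof (cases "x \<in> box a b")
  case True
  have "(\<lambda>k. \<Prod>i\<in>UNIV. flat 0 (real k * (x $ i - a $ i)) * flat 0 (real k * (b $ i - x $ i)))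
      \<longlonglongrightarrow> (\<Prod>i\<in>(UNIV::'a set). 1 * 1)"
    using True by (intro tendsto_prod tendsto_mult flat_scaled_tendsto_1) (auto simp: mem_box_cart)
  then show ?thesis using True by (simp add: box_cutoff_def algebra_simps)
qed (simp add: box_cutoff_eq_0)

lemma smooth_box_cutoff: "smooth (box_cutoff k a b)"
proof -
  have "smooth (\<lambda>x. flat 0 (c * x $ i + d))" for c d and i :: 'a
    unfolding smooth_def using C_k_flat by blast
  then have "smooth (\<lambda>x. \<Prod>i\<in>UNIV. flat 0 (real k * x $ i + - real k * a $ i)
      * flat 0 (- real k * x $ i + real k * b $ i))"
    by (intro smooth_prod smooth_mult)
  then show ?thesis unfolding box_cutoff_def[abs_def] .
qed

lemma test_function_smooth: "test_function \<phi> \<Longrightarrow> smooth \<phi>"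
  by (simp add: test_function_def)

lemma test_functionI:
  assumes "smooth \<phi>" "bounded S" "\<And>x. x \<notin> S \<Longrightarrow> \<phi> x = 0"
  shows "test_function \<phi>"
  unfolding test_function_def
proof
  have "{x. \<phi> x \<noteq> 0} \<subseteq> S" using assms(3) by auto
  then show "compact (closure {x. \<phi> x \<noteq> 0})"
    using bounded_subset[OF assms(2)] by simp
qed (rule assms(1))

lemma test_function_support:
  assumes "test_function \<phi>"
  obtains K where "K > 0" "\<And>x. norm x > K \<Longrightarrow> \<phi> x = 0"
proof -
  have "bounded (closure {x. \<phi> x \<noteq> 0})"
    using assms compact_imp_bounded by (auto simp: test_function_def)
  then have "bounded {x. \<phi> x \<noteq> 0}" using bounded_subset closure_subset by blast
  then obtain K where "K > 0" "\<forall>x\<in>{x. \<phi> x \<noteq> 0}. norm x \<le> K" by (auto simp: bounded_pos)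
  then show ?thesis by (intro that[of K]) force+
qed

lemma test_function_bounded:
  assumes "test_function \<phi>"
  obtains M where "M > 0" "\<And>x. \<bar>\<phi> x\<bar> \<le> M"
proof -
  obtain K where K: "K > 0" "\<And>x. norm x > K \<Longrightarrow> \<phi> x = 0"
    using test_function_support[OF assms] by blast
  have "compact (\<phi> ` cball 0 K)"
    using smooth_continuous[OF test_function_smooth[OF assms]]
    by (intro compact_continuous_image compact_cball) (auto intro: continuous_on_subset)
  then obtain M where M: "M > 0" "\<forall>y\<in>\<phi> ` cball 0 K. norm y \<le> M"
    using compact_imp_bounded bounded_pos by metis
  have "\<bar>\<phi> x\<bar> \<le> M" for x using M K(2)[of x] by (cases "norm x > K") auto
  then show ?thesis using M that by blast
qed

lemma test_function_partial_deriv: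
  assumes "test_function \<phi>"
  shows "test_function (partial_deriv i \<phi>)"
proof -
  obtain K where K: "K > 0" "\<And>x. norm x > K \<Longrightarrow> \<phi> x = 0"
    using test_function_support[OF assms] by blast
  show ?thesis
  proof (rule test_functionI[of _ "cball 0 K"])
    show "smooth (partial_deriv i \<phi>)"
      using assms smooth_partial_deriv test_function_smooth by blast
    fix x assume "x \<notin> cball (0 :: real ^ 'a) K"
    then have x: "norm x > K" by simp
    have "((\<lambda>x. 0) has_derivative (\<lambda>h. 0)) (at x)" by simp
    then have "(\<phi> has_derivative (\<lambda>h. 0)) (at x)"
      by (rule has_derivative_transform_within_open[of _ _ _ _ "- cball 0 K"])
         (use x K in auto)
    from partial_deriv_eqI[OF this] show "partial_deriv i \<phi> x = 0" by simp
  qed simp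
qed

lemma test_function_translate:
  assumes "test_function \<phi>"
  shows "test_function (\<lambda>x. \<phi> (x + c))"
proof -
  obtain K where K: "K > 0" "\<And>x. norm x > K \<Longrightarrow> \<phi> x = 0"
    using test_function_support[OF assms] by blast
  show ?thesis
  proof (rule test_functionI[of _ "cball 0 (K + norm c)"])
    fix x :: "real ^ 'a" assume "x \<notin> cball 0 (K + norm c)"
    then have "norm (x + c) > K" using norm_diff_ineq[of x c] by simp
    then show "\<phi> (x + c) = 0" by (rule K)
  qed (use assms in \<open>auto intro: smooth_translate test_function_smooth\<close>)
qed

definition square_integrable :: "('a::euclidean_space \<Rightarrow> real) \<Rightarrow> bool" where
  "square_integrable f \<longleftrightarrow> f \<in> borel_measurable borel \<and> integrable lborel (\<lambda>x. (f x)\<^sup>2)"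

definition sqnorm :: "('a::euclidean_space \<Rightarrow> real) \<Rightarrow> real" where
  "sqnorm f = (\<integral>x. (f x)\<^sup>2 \<partial>lborel)"

lemma square_integrable_measurable [measurable_dest]:
  "square_integrable f \<Longrightarrow> f \<in> borel_measurable borel"
  by (simp add: square_integrable_def)

lemma square_integrable_integrable:
  "square_integrable f \<Longrightarrow> integrable lborel (\<lambda>x. (f x)\<^sup>2)"
  by (simp add: square_integrable_def)

lemma sqnorm_nonneg: "0 \<le> sqnorm f"
  by (simp add: sqnorm_def)

lemma square_integrable_dominated:
  assumes "square_integrable g" "f \<in> borel_measurable borel" "\<And>x. \<bar>f x\<bar> \<le> \<bar>g x\<bar>"
  shows "square_integrable f"
  unfolding square_integrable_def
proof
  show "integrable lborel (\<lambda>x. (f x)\<^sup>2)"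
    by (rule Bochner_Integration.integrable_bound[OF square_integrable_integrable[OF assms(1)]])
       (use assms in \<open>auto simp: abs_le_square_iff\<close>)
qed (rule assms(2))

lemma square_integrable_add:
  assumes "square_integrable f" "square_integrable g"
  shows "square_integrable (\<lambda>x. f x + g x)"
  unfolding square_integrable_def
proof
  have m: "f \<in> borel_measurable borel" "g \<in> borel_measurable borel"
    using assms by (auto dest: square_integrable_measurable)
  then show "(\<lambda>x. f x + g x) \<in> borel_measurable borel" by simp
  have "integrable lborel (\<lambda>x. 2 * (f x)\<^sup>2 + 2 * (g x)\<^sup>2)"
    using assms by (simp add: square_integrable_integrable)
  then show "integrable lborel (\<lambda>x. (f x + g x)\<^sup>2)"
  proof (rule Bochner_Integration.integrable_bound)
    have "(f x + g x)\<^sup>2 \<le> 2 * (f x)\<^sup>2 + 2 * (g x)\<^sup>2" for x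
      using sum_squares_bound[of "f x" "g x"] by (simp add: power2_sum)
    then show "AE x in lborel. norm ((f x + g x)\<^sup>2) \<le> norm (2 * (f x)\<^sup>2 + 2 * (g x)\<^sup>2)" by simp
  qed (use m in simp)
qed

lemma square_integrable_cmult:
  "square_integrable f \<Longrightarrow> square_integrable (\<lambda>x. c * f x)"
  by (auto simp: square_integrable_def power_mult_distrib)

lemma square_integrable_diff:
  "square_integrable f \<Longrightarrow> square_integrable g \<Longrightarrow> square_integrable (\<lambda>x. f x - g x)"
  using square_integrable_add[of f "\<lambda>x. -1 * g x"] square_integrable_cmult[of g "-1"] by simp

lemma square_integrable_sum:
  "(\<And>i. i \<in> I \<Longrightarrow> square_integrable (f i)) \<Longrightarrow> square_integrable (\<lambda>x. \<Sum>i\<in>I. f i x)"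
proof (induction I rule: infinite_finite_induct)
  case (insert i I)
  then show ?case by (simp add: square_integrable_add)
qed (auto simp: square_integrable_def)

lemma integrable_mult_square_integrable:
  assumes "square_integrable f" "square_integrable g"
  shows "integrable lborel (\<lambda>x. f x * g x)"
proof -
  have "integrable lborel (\<lambda>x. ((f x + g x)\<^sup>2 - (f x)\<^sup>2 - (g x)\<^sup>2) / 2)"
    using assms square_integrable_add[OF assms] by (simp add: square_integrable_integrable)
  then show ?thesis by (simp add: power2_sum)
qed

lemma sqnorm_add_le:
  assumes "square_integrable f" "square_integrable g"
  shows "sqnorm (\<lambda>x. f x + g x) \<le> 2 * sqnorm f + 2 * sqnorm g"
proof -
  have "sqnorm (\<lambda>x. f x + g x) \<le> (\<integral>x. 2 * (f x)\<^sup>2 + 2 * (g x)\<^sup>2 \<partial>lborel)"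
    unfolding sqnorm_def
  proof (rule integral_mono)
    show "(f x + g x)\<^sup>2 \<le> 2 * (f x)\<^sup>2 + 2 * (g x)\<^sup>2" for x
      using sum_squares_bound[of "f x" "g x"] by (simp add: power2_sum)
  qed (use assms square_integrable_add[OF assms] in \<open>auto simp: square_integrable_integrable\<close>)
  also have "\<dots> = 2 * sqnorm f + 2 * sqnorm g"
    using assms by (simp add: sqnorm_def square_integrable_integrable)
  finally show ?thesis .
qed

lemma sqnorm_triangle:
  assumes "square_integrable f" "square_integrable g" "square_integrable h"
  shows "sqnorm (\<lambda>x. f x - h x) \<le> 2 * sqnorm (\<lambda>x. f x - g x) + 2 * sqnorm (\<lambda>x. g x - h x)"
  using sqnorm_add_le[of "\<lambda>x. f x - g x" "\<lambda>x. g x - h x"] assms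
  by (simp add: square_integrable_diff)

lemma square_integrable_bounded_support:
  assumes "f \<in> borel_measurable borel" "\<And>x. \<bar>f x\<bar> \<le> M" "\<And>x. x \<notin> cball 0 K \<Longrightarrow> f x = 0"
  shows "square_integrable f"
proof (rule square_integrable_dominated[of "\<lambda>x. M * indicator (cball 0 K) x"])
  have "emeasure lborel (cball (0::'a) K) < \<infinity>"
    using emeasure_lborel_cball_finite by blast
  then have "integrable lborel (\<lambda>x. M\<^sup>2 * indicator (cball (0::'a) K) x :: real)"
    by (intro integrable_mult_right integrable_real_indicator) auto
  moreover have "(\<lambda>x. (M * indicator (cball (0::'a) K) x)\<^sup>2) = (\<lambda>x. M\<^sup>2 * indicator (cball (0::'a) K) x)"
    by (auto simp: indicator_def fun_eq_iff)
  ultimately show "square_integrable (\<lambda>x. M * indicator (cball (0::'a) K) x :: real)"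
    by (auto simp: square_integrable_def intro!: borel_measurable_times borel_measurable_indicator)
  show "\<bar>f x\<bar> \<le> \<bar>M * indicator (cball 0 K) x\<bar>" for x
    using assms(2)[of x] assms(3)[of x] by (auto simp: indicator_def)
qed (rule assms(1))

lemma test_function_square_integrable:
  assumes "test_function \<phi>"
  shows "square_integrable \<phi>"
proof -
  obtain K where K: "K > 0" "\<And>x. norm x > K \<Longrightarrow> \<phi> x = 0"
    using test_function_support[OF assms] by blast
  obtain M where M: "M > 0" "\<And>x. \<bar>\<phi> x\<bar> \<le> M"
    using test_function_bounded[OF assms] by blast
  show ?thesis
    by (rule square_integrable_bounded_support[of _ M K])
       (use M K smooth_continuous[OF test_function_smooth[OF assms]]
        in \<open>auto intro: borel_measurable_continuous_onI\<close>)
qed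

lemma sqnorm_tendsto_0:
  fixes f :: "nat \<Rightarrow> 'a::euclidean_space \<Rightarrow> real"
  assumes "\<And>n. f n \<in> borel_measurable borel" "square_integrable w"
    "\<And>n x. \<bar>f n x\<bar> \<le> w x" "AE x in lborel. (\<lambda>n. f n x) \<longlonglongrightarrow> 0"
  shows "(\<lambda>n. sqnorm (f n)) \<longlonglongrightarrow> 0"
proof -
  have "(\<lambda>n. \<integral>x. (f n x)\<^sup>2 \<partial>lborel) \<longlonglongrightarrow> integral\<^sup>L lborel (\<lambda>x::'a. 0)"
  proof (rule integral_dominated_convergence[where f = "\<lambda>x. 0" and s = "\<lambda>n x. (f n x)\<^sup>2" and w = "\<lambda>x. (w x)\<^sup>2"])
    show "integrable lborel (\<lambda>x. (w x)\<^sup>2)"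
      using assms(2) by (rule square_integrable_integrable)
    show "AE x in lborel. (\<lambda>n. (f n x)\<^sup>2) \<longlonglongrightarrow> 0"
      using assms(4) by eventually_elim (auto intro!: tendsto_eq_intros)
    show "AE x in lborel. norm ((f n x)\<^sup>2) \<le> (w x)\<^sup>2" for n
      using assms(3)[of n] by (auto simp: abs_le_square_iff[symmetric] intro!: always_eventually order_trans[OF _ abs_ge_self])
    show "(\<lambda>x. (f n x)\<^sup>2) \<in> borel_measurable lborel" for n
      using assms(1)[of n] by simp
  qed simp
  then show ?thesis by (simp add: sqnorm_def)
qed

lemma sqnorm_approximation:
  assumes "\<And>n. f n \<in> borel_measurable borel" "g \<in> borel_measurable borel" "square_integrable w"
    "\<And>n x. \<bar>f n x - g x\<bar> \<le> w x" "AE x in lborel. (\<lambda>n. f n x) \<longlonglongrightarrow> g x" "e > 0"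
  obtains n where "sqnorm (\<lambda>x. f n x - g x) < e"
proof -
  have "(\<lambda>n. sqnorm (\<lambda>x. f n x - g x)) \<longlonglongrightarrow> 0"
  proof (rule sqnorm_tendsto_0)
    show "AE x in lborel. (\<lambda>n. f n x - g x) \<longlonglongrightarrow> 0"
      using assms(5) by eventually_elim (rule LIM_zero)
  qed (use assms in auto)
  then have "eventually (\<lambda>n. sqnorm (\<lambda>x. f n x - g x) < e) sequentially"
    using order_tendstoD(2) assms(6) by blast
  then show ?thesis using that eventually_happens'[OF sequentially_bot] by blast
qed

text \<open>Truncation in height and in space; dominated convergence with dominating function \<open>\<bar>f\<bar>\<close>.\<close>

lemma bounded_functions_dense:
  fixes f :: "'a::euclidean_space \<Rightarrow> real"
  assumes f: "square_integrable f" and e: "e > 0"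
  obtains g M K where "g \<in> borel_measurable borel" "\<And>x. \<bar>g x\<bar> \<le> M" "M > 0"
    "\<And>x. x \<notin> cball 0 K \<Longrightarrow> g x = 0" "sqnorm (\<lambda>x. g x - f x) < e"
proof -
  define g where "g n x = (if norm x \<le> real n \<and> \<bar>f x\<bar> \<le> real n then f x else 0)" for n x
  have fm [measurable]: "f \<in> borel_measurable borel" using f by (rule square_integrable_measurable)
  have gm: "g n \<in> borel_measurable borel" for n unfolding g_def by measurable
  obtain n where n: "sqnorm (\<lambda>x. g n x - f x) < e"
  proof (rule sqnorm_approximation[where f = g and g = f and w = "\<lambda>x. \<bar>f x\<bar>"])
    show "square_integrable (\<lambda>x. \<bar>f x\<bar>)"
      by (rule square_integrable_dominated[OF f]) auto
    have "(\<lambda>n. g n x) \<longlonglongrightarrow> f x" for x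
    proof (rule tendsto_eventually)
      obtain N where N: "norm x + \<bar>f x\<bar> \<le> real N" using real_arch_simple by blast
      have "norm x \<le> real n \<and> \<bar>f x\<bar> \<le> real n" if "N \<le> n" for n
        using N that norm_ge_zero[of x] abs_ge_zero[of "f x"] by linarith
      then show "eventually (\<lambda>n. g n x = f x) sequentially"
        by (intro eventually_sequentiallyI[of N]) (auto simp: g_def)
    qed
    then show "AE x in lborel. (\<lambda>n. g n x) \<longlonglongrightarrow> f x" by simp
  qed (use e gm fm in \<open>auto simp: g_def\<close>)
  show ?thesis
    by (rule that[of "g n" "real n + 1" "real n"]) (use gm n in \<open>auto simp: g_def\<close>)
qed

text \<open>A bounded measurable function is an almost everywhere limit of continuous ones, each of which is
uniformly close to a polynomial on a box. Multiplying the polynomial by a smooth cutoff of the box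
gives a test function, and dominated convergence applies because everything lives on one box.\<close>

lemma test_functions_approximate_bounded:
  fixes g :: "real ^ 'n::finite \<Rightarrow> real"
  assumes gm: "g \<in> borel_measurable borel" and M: "\<And>x. \<bar>g x\<bar> \<le> M" and "M > 0"
    and K: "\<And>x. x \<notin> cball 0 K \<Longrightarrow> g x = 0" and e: "e > 0"
  obtains \<phi> where "test_function \<phi>" "sqnorm (\<lambda>x. \<phi> x - g x) < e"
proof -
  obtain a where a: "cball (0 :: real ^ 'n) K \<subseteq> box (-a) a"
    using bounded_subset_box_symmetric[OF bounded_cball] by blast
  have "g \<in> borel_measurable lebesgue"
    using measurable_completion[of g lborel borel] gm by simp
  then have "g measurable_on UNIV"
    by (simp add: lebesgue_measurable_imp_measurable_on)
  then obtain N q where N: "negligible N" and q: "\<And>n. continuous_on UNIV (q n)"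
    and qlim: "\<And>x. x \<notin> N \<Longrightarrow> (\<lambda>n. q n x) \<longlonglongrightarrow> g x"
    unfolding measurable_on_def by auto
  \<comment> \<open>Clipping at height M keeps the limit, as g is bounded by M, and gives a dominating function.\<close>
  define c where "c n x = max (- M) (min M (q n x))" for n :: nat and x
  have c: "continuous_on UNIV (c n)" for n
    unfolding c_def by (intro continuous_intros q)
  have cM: "\<bar>c n x\<bar> \<le> M" for n x using \<open>M > 0\<close> by (auto simp: c_def)
  have clim: "(\<lambda>n. c n x) \<longlonglongrightarrow> g x" if "x \<notin> N" for x
  proof -
    have "(\<lambda>n. c n x) \<longlonglongrightarrow> max (- M) (min M (g x))"
      unfolding c_def by (intro tendsto_intros qlim that)
    then show ?thesis using M[of x] by (simp add: max_absorb2 min_absorb2 abs_le_iff)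
  qed
  have "\<exists>p. real_polynomial_function p \<and> (\<forall>x\<in>cbox (-a) a. \<bar>c n x - p x\<bar> < inverse (real (Suc n)))" for n
    by (rule Stone_Weierstrass_real_polynomial_function
          [OF compact_cbox continuous_on_subset[OF c[of n]], of "-a" a "inverse (real (Suc n))"]) auto
  then obtain p where p: "\<And>n. real_polynomial_function (p n)"
    and pc: "\<And>n x. x \<in> cbox (-a) a \<Longrightarrow> \<bar>c n x - p n x\<bar> < inverse (real (Suc n))"
    by metis
  define \<phi> where "\<phi> n x = p n x * box_cutoff n (-a) a x" for n x
  have "smooth (\<phi> n)" for n
    unfolding \<phi>_def
    by (rule smooth_mult[OF smooth_real_polynomial_function[OF p] smooth_box_cutoff])
  then have tf: "test_function (\<phi> n)" for n
    by (rule test_functionI[of _ "box (-a) a"])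
       (auto simp: \<phi>_def box_cutoff_eq_0)
  obtain n where "sqnorm (\<lambda>x. \<phi> n x - g x) < e"
  proof (rule sqnorm_approximation[where f = \<phi> and g = g
        and w = "\<lambda>x. (2 * M + 1) * indicator (box (-a) a) x"])
    show "\<phi> n \<in> borel_measurable borel" for n
      using tf test_function_square_integrable square_integrable_measurable by blast
    obtain R where R: "box (-a) a \<subseteq> cball 0 R"
      using bounded_subset_ballD[OF bounded_box, of "-a" a 0] ball_subset_cball by blast
    show "square_integrable (\<lambda>x. (2 * M + 1) * indicator (box (-a) a) x)"
      by (rule square_integrable_bounded_support[of _ "2 * M + 1" R])
         (use \<open>M > 0\<close> R in \<open>auto simp: indicator_def\<close>)
    fix n and x :: "real ^ 'n"
    show "\<bar>\<phi> n x - g x\<bar> \<le> (2 * M + 1) * indicator (box (-a) a) x"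
    proof (cases "x \<in> box (-a) a")
      case True
      have "inverse (real (Suc n)) \<le> 1" by (simp add: field_simps)
      then have "\<bar>c n x - p n x\<bar> < 1"
        using pc[of x n] True box_subset_cbox[of "-a" a] by fastforce
      then have "\<bar>p n x\<bar> \<le> M + 1" using cM[of n x] by linarith
      then have "\<bar>\<phi> n x\<bar> \<le> (M + 1) * 1"
        unfolding \<phi>_def abs_mult
        by (intro mult_mono) (use \<open>M > 0\<close> box_cutoff_bounds[of n "-a" a x] in auto)
      then show ?thesis using M[of x] True by simp
    next
      case False
      then have "g x = 0" using K a by blast
      with False show ?thesis by (simp add: \<phi>_def box_cutoff_eq_0)
    qed
  next
    have "(\<lambda>n. \<phi> n x) \<longlonglongrightarrow> g x" if x: "x \<notin> N" for x
    proof (cases "x \<in> box (-a) a")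
      case True
      have "\<bar>c n x - p n x\<bar> < inverse (real (Suc n))" for n
        using pc[of x n] True box_subset_cbox by blast
      then have "(\<lambda>n. c n x - p n x) \<longlonglongrightarrow> 0"
        by (intro Lim_null_comparison[OF _ LIMSEQ_inverse_real_of_nat])
           (auto intro!: always_eventually less_imp_le)
      from tendsto_diff[OF clim[OF x] this] have "(\<lambda>n. p n x) \<longlonglongrightarrow> g x" by simp
      from tendsto_mult[OF this box_cutoff_tendsto[of "-a" a x]] show ?thesis
        using True by (simp add: \<phi>_def)
    next
      case False
      then have "g x = 0" using K a by blast
      with False show ?thesis by (simp add: \<phi>_def box_cutoff_eq_0)
    qed
    moreover have "AE x in lborel. x \<notin> N"
      using AE_not_in[of N lebesgue] N by (simp add: negligible_iff_null_sets AE_completion_iff)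
    ultimately show "AE x in lborel. (\<lambda>n. \<phi> n x) \<longlonglongrightarrow> g x" by auto
  qed (use e gm in auto)
  then show ?thesis using that tf by blast
qed

proposition test_functions_dense:
  fixes f :: "real ^ 'n::finite \<Rightarrow> real"
  assumes f: "square_integrable f" and e: "e > 0"
  obtains \<phi> where "test_function \<phi>" "sqnorm (\<lambda>x. f x - \<phi> x) < e"
proof -
  have e4: "e / 4 > 0" using e by simp
  obtain g M K where g: "g \<in> borel_measurable borel" "\<And>x. \<bar>g x\<bar> \<le> M" "M > 0"
    "\<And>x. x \<notin> cball 0 K \<Longrightarrow> g x = 0" and gf: "sqnorm (\<lambda>x. g x - f x) < e / 4"
    using bounded_functions_dense[OF f e4] by blast
  obtain \<phi> where \<phi>: "test_function \<phi>" and \<phi>g: "sqnorm (\<lambda>x. \<phi> x - g x) < e / 4"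
    using test_functions_approximate_bounded[OF g e4] by blast
  have "sqnorm (\<lambda>x. \<phi> x - f x) \<le> 2 * sqnorm (\<lambda>x. \<phi> x - g x) + 2 * sqnorm (\<lambda>x. g x - f x)"
    by (rule sqnorm_triangle[OF test_function_square_integrable[OF \<phi>]
          square_integrable_bounded_support[OF g(1,2,4)] f])
  also have "\<dots> < e" using gf \<phi>g by simp
  finally have "sqnorm (\<lambda>x. f x - \<phi> x) < e" by (simp add: sqnorm_def power2_commute)
  then show ?thesis using that \<phi> by blast
qed

section \<open>Translations of square integrable functions\<close>

lemma integral_translate:
  fixes f :: "'a::euclidean_space \<Rightarrow> real"
  assumes "f \<in> borel_measurable borel"
  shows "(\<integral>x. f (x + h) \<partial>lborel) = integral\<^sup>L lborel f"
proof -
  have "integral\<^sup>L (distr lborel borel ((+) h)) f = (\<integral>x. f (h + x) \<partial>lborel)"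
    by (rule integral_distr) (use assms in auto)
  then show ?thesis by (simp add: lborel_distr_plus add.commute)
qed

lemma integrable_translate:
  fixes f :: "'a::euclidean_space \<Rightarrow> real"
  assumes "f \<in> borel_measurable borel" "integrable lborel f"
  shows "integrable lborel (\<lambda>x. f (x + h))"
proof -
  have "integrable (distr lborel borel ((+) h)) f \<longleftrightarrow> integrable lborel (\<lambda>x. f (h + x))"
    by (rule integrable_distr_eq) (use assms in auto)
  then show ?thesis using assms by (simp add: lborel_distr_plus add.commute)
qed

lemma square_integrable_translate:
  assumes "square_integrable f"
  shows "square_integrable (\<lambda>x. f (x + h))"
  unfolding square_integrable_def
proof
  have [measurable]: "f \<in> borel_measurable borel"
    using assms by (rule square_integrable_measurable)
  show "(\<lambda>x. f (x + h)) \<in> borel_measurable borel" by measurable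
  show "integrable lborel (\<lambda>x. (f (x + h))\<^sup>2)"
    by (rule integrable_translate[of "\<lambda>x. (f x)\<^sup>2"])
       (use assms in \<open>auto simp: square_integrable_integrable\<close>)
qed

lemma sqnorm_translate:
  assumes "square_integrable f"
  shows "sqnorm (\<lambda>x. f (x + h)) = sqnorm f"
proof -
  have [measurable]: "f \<in> borel_measurable borel"
    using assms by (rule square_integrable_measurable)
  show ?thesis unfolding sqnorm_def by (rule integral_translate) measurable
qed

definition translation_sqdiff :: "('a::euclidean_space \<Rightarrow> real) \<Rightarrow> 'a \<Rightarrow> real" where
  "translation_sqdiff f h = sqnorm (\<lambda>x. f (x + h) - f x)"

lemma translation_sqdiff_nonneg: "0 \<le> translation_sqdiff f h"
  by (simp add: translation_sqdiff_def sqnorm_nonneg)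

lemma square_integrable_translation_diff:
  "square_integrable f \<Longrightarrow> square_integrable (\<lambda>x. f (x + h) - f x)"
  by (intro square_integrable_diff square_integrable_translate)

lemma translation_sqdiff_measurable:
  assumes "square_integrable f"
  shows "translation_sqdiff f \<in> borel_measurable borel"
proof -
  have [measurable]: "f \<in> borel_measurable borel"
    using assms by (rule square_integrable_measurable)
  show ?thesis unfolding translation_sqdiff_def sqnorm_def
    by (rule lborel.borel_measurable_lebesgue_integral) measurable
qed

lemma translation_sqdiff_le:
  assumes "square_integrable f"
  shows "translation_sqdiff f h \<le> 4 * sqnorm f"
proof -
  have "translation_sqdiff f h \<le> 2 * sqnorm (\<lambda>x. f (x + h)) + 2 * sqnorm (\<lambda>x. - f x)"
    unfolding translation_sqdiff_def
    using sqnorm_add_le[of "\<lambda>x. f (x + h)" "\<lambda>x. - f x"] square_integrable_translate[OF assms]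
      square_integrable_cmult[OF assms, of "-1"] by simp
  then show ?thesis using sqnorm_translate[OF assms] by (simp add: sqnorm_def)
qed

lemma test_function_translation_sqdiff_tendsto_0:
  assumes \<phi>: "test_function \<phi>"
  shows "(translation_sqdiff \<phi> \<longlongrightarrow> 0) (at 0)"
  unfolding tendsto_at_iff_sequentially comp_def
proof (intro allI impI)
  fix X :: "nat \<Rightarrow> real ^ 'a" assume X: "X \<longlonglongrightarrow> 0"
  obtain K where K: "K > 0" "\<And>x. norm x > K \<Longrightarrow> \<phi> x = 0"
    using test_function_support[OF \<phi>] by blast
  obtain M where M: "M > 0" "\<And>x. \<bar>\<phi> x\<bar> \<le> M"
    using test_function_bounded[OF \<phi>] by blast
  obtain B where B: "\<And>k. norm (X k) \<le> B"
    using convergent_imp_bounded[OF X] by (auto simp: bounded_iff)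
  have B0: "0 \<le> B" using B[of 0] norm_ge_zero order_trans by blast
  have cont: "continuous_on UNIV \<phi>"
    using smooth_continuous test_function_smooth \<phi> by blast
  have m [measurable]: "\<phi> \<in> borel_measurable borel"
    using cont by (rule borel_measurable_continuous_onI)
  show "(\<lambda>k. translation_sqdiff \<phi> (X k)) \<longlonglongrightarrow> 0"
    unfolding translation_sqdiff_def
  proof (rule sqnorm_tendsto_0[where w = "\<lambda>x. 2 * M * indicator (cball 0 (K + B)) x"])
    show "square_integrable (\<lambda>x. 2 * M * indicator (cball (0 :: real ^ 'a) (K + B)) x)"
      by (rule square_integrable_bounded_support[of _ "2 * M" "K + B"])
         (use M in \<open>auto simp: indicator_def intro!: borel_measurable_times borel_measurable_indicator\<close>)
    fix k and x :: "real ^ 'a"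
    show "\<bar>\<phi> (x + X k) - \<phi> x\<bar> \<le> 2 * M * indicator (cball 0 (K + B)) x"
    proof (cases "norm x > K + B")
      case True
      then have "norm (x + X k) > K" using norm_diff_ineq[of x "X k"] B[of k] by linarith
      then show ?thesis using True K(2)[of "x + X k"] K(2)[of x] B0 by simp
    next
      case False
      then show ?thesis using M(2)[of x] M(2)[of "x + X k"] by simp
    qed
  next
    have "(\<lambda>k. \<phi> (x + X k) - \<phi> x) \<longlonglongrightarrow> 0" for x
    proof -
      have "(\<lambda>k. x + X k) \<longlonglongrightarrow> x" using tendsto_add[OF tendsto_const[of x] X] by simp
      then have "(\<lambda>k. \<phi> (x + X k)) \<longlonglongrightarrow> \<phi> x"
        by (rule continuous_on_tendsto_compose[OF cont]) auto
      then show ?thesis by (rule LIM_zero)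
    qed
    then show "AE x in lborel. (\<lambda>k. \<phi> (x + X k) - \<phi> x) \<longlonglongrightarrow> 0" by simp
  qed simp
qed

text \<open>Continuity of translations in the mean: true for test functions by dominated convergence, and in
general because the quantity at \<open>f\<close> exceeds twice that at an approximation \<open>\<phi>\<close> by at most
\<open>8 \<parallel>f - \<phi>\<parallel>\<^sup>2\<close>, uniformly in \<open>h\<close>.\<close>

proposition translation_sqdiff_tendsto_0:
  fixes f :: "real ^ 'n::finite \<Rightarrow> real"
  assumes f: "square_integrable f"
  shows "(translation_sqdiff f \<longlongrightarrow> 0) (at 0)"
proof (rule tendstoI)
  fix e :: real assume e: "e > 0"
  then obtain \<phi> where \<phi>: "test_function \<phi>" and f\<phi>: "sqnorm (\<lambda>x. f x - \<phi> x) < e / 12"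
    using test_functions_dense[OF f, of "e / 12"] by auto
  have s\<phi>: "square_integrable \<phi>" by (rule test_function_square_integrable[OF \<phi>])
  have le: "translation_sqdiff f h \<le> 2 * translation_sqdiff \<phi> h + 8 * sqnorm (\<lambda>x. f x - \<phi> x)" for h
  proof -
    have d: "square_integrable (\<lambda>x. f x - \<phi> x)" by (rule square_integrable_diff[OF f s\<phi>])
    have "translation_sqdiff f h = sqnorm (\<lambda>x. (\<phi> (x + h) - \<phi> x)
        + ((\<lambda>x. f x - \<phi> x) (x + h) - (\<lambda>x. f x - \<phi> x) x))"
      by (simp add: translation_sqdiff_def algebra_simps)
    also have "\<dots> \<le> 2 * translation_sqdiff \<phi> h + 2 * translation_sqdiff (\<lambda>x. f x - \<phi> x) h"
      unfolding translation_sqdiff_def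
      by (rule sqnorm_add_le[OF square_integrable_translation_diff[OF s\<phi>]
            square_integrable_translation_diff[OF d]])
    also have "\<dots> \<le> 2 * translation_sqdiff \<phi> h + 8 * sqnorm (\<lambda>x. f x - \<phi> x)"
      using translation_sqdiff_le[OF d, of h] by simp
    finally show ?thesis .
  qed
  have "eventually (\<lambda>h. translation_sqdiff \<phi> h < e / 6) (at 0)"
    using order_tendstoD(2)[OF test_function_translation_sqdiff_tendsto_0[OF \<phi>], of "e / 6"] e by simp
  then show "eventually (\<lambda>h. dist (translation_sqdiff f h) 0 < e) (at 0)"
  proof eventually_elim
    case (elim h)
    show ?case using le[of h] elim f\<phi> translation_sqdiff_nonneg[of f h] by (simp add: dist_real_def)
  qed
qed

lemma mult_le_weighted_squares:
  fixes a b \<epsilon> :: real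
  assumes "\<epsilon> > 0"
  shows "2 * \<bar>a * b\<bar> \<le> \<epsilon> * a\<^sup>2 + b\<^sup>2 / \<epsilon>"
proof -
  have "0 \<le> (\<epsilon> * \<bar>a\<bar> - \<bar>b\<bar>)\<^sup>2 / \<epsilon>" using assms by simp
  also have "\<dots> = \<epsilon> * a\<^sup>2 + b\<^sup>2 / \<epsilon> - 2 * \<bar>a * b\<bar>"
    using assms by (simp add: power2_diff power_mult_distrib abs_mult field_simps power2_eq_square)
  finally show ?thesis by simp
qed

text \<open>The square expands to \<open>2 \<parallel>f\<parallel>\<^sup>2 - 2 \<integral> f(x) f(x + h) dx\<close>. Let \<open>g\<close> vanish outside the ball of radius \<open>K\<close> and be
close to \<open>f\<close>. When \<open>\<bar>h\<bar> > 2K\<close>, at least one of \<open>x\<close> and \<open>x + h\<close> lies outside the ball, and there \<open>f\<close>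
equals, up to sign, the small function \<open>r = g - f\<close>. So the product \<open>f(x) f(x + h)\<close> always has a small
factor, and a weighted inequality between means bounds its integral.\<close>

proposition translation_sqdiff_at_infinity:
  fixes f :: "'a::euclidean_space \<Rightarrow> real"
  assumes f: "square_integrable f"
  shows "(translation_sqdiff f \<longlongrightarrow> 2 * sqnorm f) at_infinity"
proof (rule tendstoI)
  fix e :: real assume e: "e > 0"
  \<comment> \<open>The weight makes the main part 2 * \<epsilon> * sqnorm f at most e / 2; then r is chosen small against e * \<epsilon>.\<close>
  define \<epsilon> where "\<epsilon> = e / (4 * (sqnorm f + 1))"
  have N: "sqnorm f + 1 > 0" using sqnorm_nonneg[of f] by linarith
  have \<epsilon>: "\<epsilon> > 0" using e N by (simp add: \<epsilon>_def)
  have e\<epsilon>: "e * \<epsilon> / 4 > 0" using e \<epsilon> by simp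
  obtain g M K where g: "g \<in> borel_measurable borel" "\<And>x. \<bar>g x\<bar> \<le> M" "M > 0"
    "\<And>x. x \<notin> cball 0 K \<Longrightarrow> g x = 0" and gf: "sqnorm (\<lambda>x. g x - f x) < e * \<epsilon> / 4"
    by (rule bounded_functions_dense[OF f e\<epsilon>]) (rule that)
  define r where "r x = g x - f x" for x
  have r: "square_integrable r"
    unfolding r_def[abs_def] by (intro square_integrable_diff f square_integrable_bounded_support[OF g(1,2,4)])
  have bound: "\<bar>translation_sqdiff f h - 2 * sqnorm f\<bar> < e" if h: "norm h > 2 * \<bar>K\<bar>" for h
  proof -
    let ?b = "\<lambda>x. \<epsilon> * ((f (x + h))\<^sup>2 + (f x)\<^sup>2) + ((r (x + h))\<^sup>2 + (r x)\<^sup>2) / \<epsilon>"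
    note int = square_integrable_integrable[OF f] square_integrable_integrable[OF r]
      square_integrable_integrable[OF square_integrable_translate[OF f]]
      square_integrable_integrable[OF square_integrable_translate[OF r]]
      square_integrable_integrable[OF square_integrable_translation_diff[OF f]]
      integrable_mult_square_integrable[OF f square_integrable_translate[OF f]]
      integrable_abs[OF integrable_mult_square_integrable[OF f square_integrable_translate[OF f, of h]]]
    have pt: "2 * \<bar>f x * f (x + h)\<bar> \<le> ?b x" for x
    proof (cases "norm x > \<bar>K\<bar>")
      case True
      then have "(r x)\<^sup>2 = (f x)\<^sup>2" using g(4)[of x] by (simp add: r_def)
      moreover have "0 \<le> \<epsilon> * (f x)\<^sup>2 + (r (x + h))\<^sup>2 / \<epsilon>" using \<epsilon> by simp
      ultimately show ?thesis
        using mult_le_weighted_squares[OF \<epsilon>, of "f (x + h)" "f x"]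
        by (simp add: distrib_left add_divide_distrib mult.commute)
    next
      case False
      have "norm (x + h) > \<bar>K\<bar>"
        using False h norm_triangle_ineq4[of "x + h" x] by simp
      then have "(r (x + h))\<^sup>2 = (f (x + h))\<^sup>2" using g(4)[of "x + h"] by (simp add: r_def)
      moreover have "0 \<le> \<epsilon> * (f (x + h))\<^sup>2 + (r x)\<^sup>2 / \<epsilon>" using \<epsilon> by simp
      ultimately show ?thesis
        using mult_le_weighted_squares[OF \<epsilon>, of "f x" "f (x + h)"]
        by (simp add: distrib_left add_divide_distrib)
    qed
    have "translation_sqdiff f h = (\<integral>x. ((f (x + h))\<^sup>2 + (f x)\<^sup>2) - 2 * (f x * f (x + h)) \<partial>lborel)"
      unfolding translation_sqdiff_def sqnorm_def by (simp add: power2_diff algebra_simps)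
    also have "\<dots> = sqnorm (\<lambda>x. f (x + h)) + sqnorm f - 2 * (\<integral>x. f x * f (x + h) \<partial>lborel)"
      using int by (simp add: sqnorm_def)
    finally have "\<bar>translation_sqdiff f h - 2 * sqnorm f\<bar> = \<bar>\<integral>x. 2 * (f x * f (x + h)) \<partial>lborel\<bar>"
      using sqnorm_translate[OF f, of h] by simp
    also have "\<dots> \<le> (\<integral>x. \<bar>2 * (f x * f (x + h))\<bar> \<partial>lborel)"
      by (rule integral_abs_bound)
    also have "\<dots> \<le> (\<integral>x. ?b x \<partial>lborel)"
      by (rule integral_mono) (use int pt in \<open>auto simp: abs_mult\<close>)
    also have "\<dots> = \<epsilon> * (sqnorm (\<lambda>x. f (x + h)) + sqnorm f) + (sqnorm (\<lambda>x. r (x + h)) + sqnorm r) / \<epsilon>"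
      using int by (simp add: sqnorm_def)
    also have "\<dots> = 2 * \<epsilon> * sqnorm f + 2 * sqnorm r / \<epsilon>"
      using sqnorm_translate[OF f, of h] sqnorm_translate[OF r, of h] by simp
    also have "2 * sqnorm r / \<epsilon> < e / 2"
      using gf \<epsilon> by (simp add: r_def[abs_def] field_simps)
    also have "2 * \<epsilon> * sqnorm f \<le> 2 * \<epsilon> * (sqnorm f + 1)" using \<epsilon> by simp
    also have "\<dots> = e / 2" using N by (simp add: \<epsilon>_def field_simps)
    finally show ?thesis by simp
  qed
  show "eventually (\<lambda>h. dist (translation_sqdiff f h) (2 * sqnorm f) < e) at_infinity"
    unfolding eventually_at_infinity dist_real_def
    by (rule exI[of _ "2 * \<bar>K\<bar> + 1"]) (use bound in auto)
qed

section \<open>Difference quotients of functions with a square integrable gradient\<close>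

definition has_L2_gradient :: "(real ^ 'n::finite \<Rightarrow> real) \<Rightarrow> (real ^ 'n \<Rightarrow> real ^ 'n) \<Rightarrow> bool" where
  "has_L2_gradient u g \<longleftrightarrow> square_integrable u \<and> (\<forall>i. square_integrable (\<lambda>x. g x $ i)) \<and>
     (\<forall>\<phi> i. test_function \<phi> \<longrightarrow>
        (\<integral>x. u x * partial_deriv i \<phi> x \<partial>lborel) = - (\<integral>x. g x $ i * \<phi> x \<partial>lborel))"

lemma inner_vec_sum: "(h :: real ^ 'n::finite) \<bullet> y = (\<Sum>i\<in>UNIV. h $ i * y $ i)"
  by (simp add: inner_vec_def)

lemma test_function_line_deriv:
  assumes "test_function \<phi>"
  shows "((\<lambda>s. \<phi> (x + s *\<^sub>R v)) has_real_derivative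
           (\<Sum>i\<in>UNIV. v $ i * partial_deriv i \<phi> (x + s *\<^sub>R v))) (at s)"
proof -
  have "(\<phi> has_derivative (\<lambda>h. \<Sum>i\<in>UNIV. h $ i * partial_deriv i \<phi> (x + s *\<^sub>R v))) (at (x + s *\<^sub>R v))"
    by (rule has_derivative_of_partials[OF smooth_differentiable[OF test_function_smooth[OF assms]]])
  moreover have "((\<lambda>s. x + s *\<^sub>R v) has_derivative (\<lambda>t. t *\<^sub>R v)) (at s)"
    by (auto intro!: derivative_eq_intros)
  ultimately have "((\<lambda>s. \<phi> (x + s *\<^sub>R v)) has_derivative
      (\<lambda>t. \<Sum>i\<in>UNIV. (t *\<^sub>R v) $ i * partial_deriv i \<phi> (x + s *\<^sub>R v))) (at s)"
    by (rule has_derivative_compose[rotated])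
  moreover have "(\<lambda>t. \<Sum>i\<in>UNIV. (t *\<^sub>R v) $ i * partial_deriv i \<phi> (x + s *\<^sub>R v))
      = (*) (\<Sum>i\<in>UNIV. v $ i * partial_deriv i \<phi> (x + s *\<^sub>R v))"
    by (simp add: fun_eq_iff sum_distrib_left mult_ac)
  ultimately show ?thesis by (simp add: has_field_derivative_def)
qed

lemma test_function_lipschitz_on_lines:
  assumes "test_function \<phi>"
  obtains L where "\<And>x s t. \<bar>\<phi> (x + s *\<^sub>R v) - \<phi> (x + t *\<^sub>R v)\<bar> \<le> L * \<bar>s - t\<bar>" "L \<ge> 0"
proof -
  have "\<exists>M. \<forall>x. \<bar>partial_deriv i \<phi> x\<bar> \<le> M" for i
    using test_function_bounded[OF test_function_partial_deriv[OF assms]] by metis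
  then obtain M where M: "\<And>i x. \<bar>partial_deriv i \<phi> x\<bar> \<le> M i" by metis
  define L where "L = (\<Sum>i\<in>UNIV. \<bar>v $ i\<bar> * M i)"
  have D: "\<bar>\<Sum>i\<in>UNIV. v $ i * partial_deriv i \<phi> x\<bar> \<le> L" for x
    unfolding L_def
    by (rule order_trans[OF sum_abs]) (auto simp: abs_mult intro!: sum_mono mult_left_mono M)
  have "\<bar>\<phi> (x + s *\<^sub>R v) - \<phi> (x + t *\<^sub>R v)\<bar> \<le> L * \<bar>s - t\<bar>" for x s t
    using field_differentiable_bound[of UNIV "\<lambda>s. \<phi> (x + s *\<^sub>R v)"
        "\<lambda>s. \<Sum>i\<in>UNIV. v $ i * partial_deriv i \<phi> (x + s *\<^sub>R v)" L s t]
      test_function_line_deriv[OF assms] D by (simp add: norm_minus_commute)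
  moreover have "L \<ge> 0" using D[of undefined] by linarith
  ultimately show ?thesis by (rule that)
qed

text \<open>Differentiating under the integral moves the derivative onto the test function, and the weak
formulation, applied to the translated test function, moves it onto \<open>u\<close> with a change of sign. The
exchange is justified by dominated convergence: the difference quotients of \<open>\<phi>\<close> along a line are bounded by
a Lipschitz constant and, for bounded increments, supported in one ball.\<close>

lemma translated_pairing_deriv:
  fixes u :: "real ^ 'n::finite \<Rightarrow> real"
  assumes ug: "has_L2_gradient u g" and \<phi>: "test_function \<phi>"
  shows "((\<lambda>t. \<integral>x. u x * \<phi> (x + t *\<^sub>R v) \<partial>lborel) has_real_derivative
           - (\<integral>x. (v \<bullet> g x) * \<phi> (x + t *\<^sub>R v) \<partial>lborel)) (at t)"
proof -
  define A where "A t = (\<integral>x. u x * \<phi> (x + t *\<^sub>R v) \<partial>lborel)" for t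
  define D where "D x = (\<Sum>i\<in>UNIV. v $ i * partial_deriv i \<phi> (x + t *\<^sub>R v))" for x
  have u: "square_integrable u" and g: "\<And>i. square_integrable (\<lambda>x. g x $ i)"
    and weak: "\<And>\<phi> i. test_function \<phi> \<Longrightarrow>
      (\<integral>x. u x * partial_deriv i \<phi> x \<partial>lborel) = - (\<integral>x. g x $ i * \<phi> x \<partial>lborel)"
    using ug unfolding has_L2_gradient_def by blast+
  have \<phi>t: "test_function (\<lambda>x. \<phi> (x + c))" for c by (rule test_function_translate[OF \<phi>])
  note sq\<phi> = test_function_square_integrable[OF \<phi>t]
  note sqD = test_function_square_integrable[OF test_function_translate[OF test_function_partial_deriv[OF \<phi>]]]
  have uD: "(\<integral>x. u x * D x \<partial>lborel) = - (\<integral>x. (v \<bullet> g x) * \<phi> (x + t *\<^sub>R v) \<partial>lborel)"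
  proof -
    have "(\<integral>x. u x * D x \<partial>lborel) = (\<integral>x. (\<Sum>i\<in>UNIV. v $ i * (u x * partial_deriv i \<phi> (x + t *\<^sub>R v))) \<partial>lborel)"
      by (simp add: D_def sum_distrib_left mult_ac)
    also have "\<dots> = (\<Sum>i\<in>UNIV. v $ i * (\<integral>x. u x * partial_deriv i \<phi> (x + t *\<^sub>R v) \<partial>lborel))"
      by (simp add: integrable_mult_square_integrable[OF u sqD])
    also have "\<dots> = (\<Sum>i\<in>UNIV. v $ i * - (\<integral>x. g x $ i * \<phi> (x + t *\<^sub>R v) \<partial>lborel))"
      using weak[OF \<phi>t] partial_deriv_translate[OF smooth_differentiable[OF test_function_smooth[OF \<phi>]]] by simp
    also have "\<dots> = - (\<integral>x. (\<Sum>i\<in>UNIV. v $ i * (g x $ i * \<phi> (x + t *\<^sub>R v))) \<partial>lborel)"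
      by (simp add: integrable_mult_square_integrable[OF g sq\<phi>] sum_negf)
    also have "\<dots> = - (\<integral>x. (v \<bullet> g x) * \<phi> (x + t *\<^sub>R v) \<partial>lborel)"
      by (simp add: inner_vec_sum sum_distrib_right mult.assoc)
    finally show ?thesis .
  qed
  obtain L where L: "\<And>x s t. \<bar>\<phi> (x + s *\<^sub>R v) - \<phi> (x + t *\<^sub>R v)\<bar> \<le> L * \<bar>s - t\<bar>" "L \<ge> 0"
    by (rule test_function_lipschitz_on_lines[OF \<phi>, of v]) (rule that)
  obtain K where K: "K > 0" "\<And>x. norm x > K \<Longrightarrow> \<phi> x = 0"
    using test_function_support[OF \<phi>] by blast
  have "((\<lambda>s. (A (t + s) - A t) / s) \<longlongrightarrow> (\<integral>x. u x * D x \<partial>lborel)) (at 0)"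
    unfolding tendsto_at_iff_sequentially comp_def
  proof (intro allI impI)
    fix X :: "nat \<Rightarrow> real" assume X0: "\<forall>k. X k \<in> UNIV - {0}" and X: "X \<longlonglongrightarrow> 0"
    obtain B where B: "\<And>k. \<bar>X k\<bar> \<le> B"
      using convergent_imp_bounded[OF X] by (auto simp: bounded_iff)
    define R where "R = K + (\<bar>t\<bar> + B) * norm v"
    let ?q = "\<lambda>k x. (\<phi> (x + (t + X k) *\<^sub>R v) - \<phi> (x + t *\<^sub>R v)) / X k"
    have quot: "(A (t + X k) - A t) / X k = (\<integral>x. u x * ?q k x \<partial>lborel)" for k
    proof -
      have "A (t + X k) - A t = (\<integral>x. u x * \<phi> (x + (t + X k) *\<^sub>R v) - u x * \<phi> (x + t *\<^sub>R v) \<partial>lborel)"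
        unfolding A_def
        by (rule Bochner_Integration.integral_diff[symmetric])
           (rule integrable_mult_square_integrable[OF u sq\<phi>])+
      also have "\<dots> / X k = (\<integral>x. (u x * \<phi> (x + (t + X k) *\<^sub>R v) - u x * \<phi> (x + t *\<^sub>R v)) / X k \<partial>lborel)"
        by (rule integral_divide_zero[symmetric])
      finally show ?thesis by (simp add: right_diff_distrib)
    qed
    have "(\<lambda>k. \<integral>x. u x * ?q k x \<partial>lborel) \<longlonglongrightarrow> (\<integral>x. u x * D x \<partial>lborel)"
    proof (rule integral_dominated_convergence[where w = "\<lambda>x. \<bar>u x\<bar> * (L * indicator (cball 0 R) x)"])
      have um [measurable]: "u \<in> borel_measurable borel"
        by (rule square_integrable_measurable[OF u])
      have m [measurable]: "(\<lambda>x. \<phi> (x + c)) \<in> borel_measurable borel" for c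
        by (rule square_integrable_measurable[OF sq\<phi>])
      have "D \<in> borel_measurable borel"
        unfolding D_def
        by (intro borel_measurable_sum borel_measurable_times borel_measurable_const
              square_integrable_measurable[OF sqD])
      then show "(\<lambda>x. u x * D x) \<in> borel_measurable lborel" by simp
      show "(\<lambda>x. u x * ?q k x) \<in> borel_measurable lborel" for k by simp
      have "square_integrable (\<lambda>x. \<bar>u x\<bar>)"
        by (rule square_integrable_dominated[OF u]) auto
      moreover have "square_integrable (\<lambda>x :: real ^ 'n. L * indicator (cball 0 R) x)"
        by (rule square_integrable_bounded_support[of _ L R])
           (use L(2) in \<open>auto simp: indicator_def intro!: borel_measurable_times borel_measurable_indicator\<close>)
      ultimately show "integrable lborel (\<lambda>x. \<bar>u x\<bar> * (L * indicator (cball 0 R) x))"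
        by (rule integrable_mult_square_integrable)
      have "(\<lambda>k. u x * ?q k x) \<longlonglongrightarrow> u x * D x" for x
      proof -
        have "((\<lambda>s. (\<phi> (x + (t + s) *\<^sub>R v) - \<phi> (x + t *\<^sub>R v)) / s) \<longlongrightarrow> D x) (at 0)"
          using test_function_line_deriv[OF \<phi>, of x v t] unfolding DERIV_def D_def .
        then have "(\<lambda>k. ?q k x) \<longlonglongrightarrow> D x"
          unfolding tendsto_at_iff_sequentially comp_def using X X0 by blast
        then show ?thesis by (rule tendsto_mult_left)
      qed
      then show "AE x in lborel. (\<lambda>k. u x * ?q k x) \<longlonglongrightarrow> u x * D x" by simp
      fix k
      have "\<bar>?q k x\<bar> \<le> L * indicator (cball 0 R) x" for x
      proof (cases "norm x > R")
        case True
        have vanish: "\<phi> (x + s *\<^sub>R v) = 0" if "\<bar>s\<bar> \<le> \<bar>t\<bar> + B" for s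
        proof (rule K(2))
          have "norm (s *\<^sub>R v) \<le> (\<bar>t\<bar> + B) * norm v" using that by (simp add: mult_right_mono)
          then show "norm (x + s *\<^sub>R v) > K"
            using True norm_diff_ineq[of x "s *\<^sub>R v"] unfolding R_def by linarith
        qed
        have "\<bar>t + X k\<bar> \<le> \<bar>t\<bar> + B" "\<bar>t\<bar> \<le> \<bar>t\<bar> + B" using B[of k] by linarith+
        then show ?thesis using vanish L(2) by simp
      next
        case False
        have "X k \<noteq> 0" using X0 by simp
        then show ?thesis using False L(1)[of x "t + X k" t] by (simp add: field_simps)
      qed
      then show "AE x in lborel. norm (u x * ?q k x) \<le> \<bar>u x\<bar> * (L * indicator (cball 0 R) x)"
        by (auto simp: abs_mult simp del: abs_divide times_divide_eq_right intro!: mult_left_mono always_eventually)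
    qed
    then show "(\<lambda>k. (A (t + X k) - A t) / X k) \<longlonglongrightarrow> (\<integral>x. u x * D x \<partial>lborel)"
      by (simp only: quot)
  qed
  then have "(A has_real_derivative (\<integral>x. u x * D x \<partial>lborel)) (at t)"
    unfolding DERIV_def .
  then show ?thesis unfolding uD A_def[abs_def] .
qed

lemma sqnorm_diff:
  assumes "square_integrable f" "square_integrable g"
  shows "sqnorm (\<lambda>x. f x - g x) = sqnorm f - 2 * (\<integral>x. f x * g x \<partial>lborel) + sqnorm g"
proof -
  have "sqnorm (\<lambda>x. f x - g x) = (\<integral>x. (f x)\<^sup>2 - 2 * (f x * g x) + (g x)\<^sup>2 \<partial>lborel)"
    unfolding sqnorm_def by (simp add: power2_diff algebra_simps)
  then show ?thesis
    using square_integrable_integrable[OF assms(1)] square_integrable_integrable[OF assms(2)]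
      integrable_mult_square_integrable[OF assms] by (simp add: sqnorm_def)
qed

text \<open>For every \<open>\<phi>\<close> the identity \<open>2 \<langle>f, \<phi>\<rangle> - \<parallel>\<phi>\<parallel>\<^sup>2 = \<parallel>f\<parallel>\<^sup>2 - \<parallel>f - \<phi>\<parallel>\<^sup>2\<close> holds, so its left-hand side comes
arbitrarily close to \<open>\<parallel>f\<parallel>\<^sup>2\<close> as \<open>\<phi>\<close> runs through a dense set.\<close>

lemma sqnorm_le_by_duality:
  fixes f :: "real ^ 'n::finite \<Rightarrow> real"
  assumes f: "square_integrable f"
    and le: "\<And>\<phi>. test_function \<phi> \<Longrightarrow> 2 * (\<integral>x. f x * \<phi> x \<partial>lborel) \<le> C + sqnorm \<phi>"
  shows "sqnorm f \<le> C"
proof (rule field_le_epsilon)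
  fix e :: real assume "e > 0"
  then obtain \<phi> where \<phi>: "test_function \<phi>" "sqnorm (\<lambda>x. f x - \<phi> x) < e"
    using test_functions_dense[OF f] by blast
  then show "sqnorm f \<le> C + e"
    using sqnorm_diff[OF f test_function_square_integrable[OF \<phi>(1)]] le[OF \<phi>(1)] by simp
qed

lemma square_integrable_inner:
  fixes g :: "real ^ 'n::finite \<Rightarrow> real ^ 'n"
  assumes "\<And>i. square_integrable (\<lambda>x. g x $ i)"
  shows "square_integrable (\<lambda>x. h \<bullet> g x)"
  unfolding inner_vec_sum by (intro square_integrable_sum square_integrable_cmult assms)

text \<open>The mean value theorem for \<open>A(t) = \<integral> u(x) \<phi>(x - t h) dx\<close> on \<open>[0, 1]\<close>. The point \<open>\<theta>\<close> depends on the test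
function \<open>\<phi>\<close>, which is why the hypothesis is uniform in \<open>\<theta>\<close>.\<close>

lemma sqnorm_difference_remainder_le:
  fixes u :: "real ^ 'n::finite \<Rightarrow> real"
  assumes ug: "has_L2_gradient u g"
    and C: "\<And>\<theta>. 0 < \<theta> \<Longrightarrow> \<theta> < 1 \<Longrightarrow> translation_sqdiff (\<lambda>x. h \<bullet> g x) (\<theta> *\<^sub>R h) \<le> C"
  shows "sqnorm (\<lambda>x. u (x + h) - u x - h \<bullet> g x) \<le> C"
proof (rule sqnorm_le_by_duality)
  have u: "square_integrable u" and g: "\<And>i. square_integrable (\<lambda>x. g x $ i)"
    using ug unfolding has_L2_gradient_def by blast+
  let ?G = "\<lambda>x. h \<bullet> g x"
  have G: "square_integrable ?G" by (rule square_integrable_inner[OF g])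
  show "square_integrable (\<lambda>x. u (x + h) - u x - h \<bullet> g x)"
    by (intro square_integrable_diff square_integrable_translate u G)
  fix \<phi> :: "real ^ 'n \<Rightarrow> real" assume \<phi>: "test_function \<phi>"
  have s\<phi>: "square_integrable (\<lambda>x. \<phi> (x + c))" for c
    by (rule test_function_square_integrable[OF test_function_translate[OF \<phi>]])
  have s\<phi>0: "square_integrable \<phi>" by (rule test_function_square_integrable[OF \<phi>])
  have shift: "(\<integral>x. w (x + c) * \<phi> x \<partial>lborel) = (\<integral>x. w x * \<phi> (x - c) \<partial>lborel)"
    if w: "square_integrable w" for w c
  proof -
    have [measurable]: "w \<in> borel_measurable borel" "\<phi> \<in> borel_measurable borel"
      using w s\<phi>0 by (auto dest: square_integrable_measurable)
    show ?thesis using integral_translate[of "\<lambda>x. w x * \<phi> (x - c)" c] by simp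
  qed
  define A where "A t = (\<integral>x. u x * \<phi> (x + t *\<^sub>R - h) \<partial>lborel)" for t
  have "(A has_real_derivative (\<integral>x. ?G x * \<phi> (x - t *\<^sub>R h) \<partial>lborel)) (at t)" for t
    using translated_pairing_deriv[OF ug \<phi>, of "- h" t] by (simp add: A_def[abs_def])
  from MVT2[of 0 1 A, OF _ this]
  obtain \<theta> where \<theta>: "0 < \<theta>" "\<theta> < 1" and mvt: "A 1 - A 0 = (\<integral>x. ?G x * \<phi> (x - \<theta> *\<^sub>R h) \<partial>lborel)"
    by auto
  have tG: "square_integrable (\<lambda>x. ?G (x + \<theta> *\<^sub>R h))" by (rule square_integrable_translate[OF G])
  let ?D = "\<lambda>x. ?G (x + \<theta> *\<^sub>R h) - ?G x"
  have D: "square_integrable ?D" by (rule square_integrable_translation_diff[OF G])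
  have "(\<integral>x. (u (x + h) - u x - ?G x) * \<phi> x \<partial>lborel)
      = (\<integral>x. u (x + h) * \<phi> x - u x * \<phi> x - ?G x * \<phi> x \<partial>lborel)"
    by (simp add: left_diff_distrib)
  also have "\<dots> = (\<integral>x. u (x + h) * \<phi> x \<partial>lborel) - (\<integral>x. u x * \<phi> x \<partial>lborel) - (\<integral>x. ?G x * \<phi> x \<partial>lborel)"
    using integrable_mult_square_integrable[OF square_integrable_translate[OF u] s\<phi>0]
      integrable_mult_square_integrable[OF u s\<phi>0] integrable_mult_square_integrable[OF G s\<phi>0] by simp
  also have "\<dots> = A 1 - A 0 - (\<integral>x. ?G x * \<phi> x \<partial>lborel)"
    using shift[OF u, of h] by (simp add: A_def)
  also have "\<dots> = (\<integral>x. ?G (x + \<theta> *\<^sub>R h) * \<phi> x \<partial>lborel) - (\<integral>x. ?G x * \<phi> x \<partial>lborel)"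
    unfolding mvt shift[OF G, of "\<theta> *\<^sub>R h"] ..
  also have "\<dots> = (\<integral>x. ?D x * \<phi> x \<partial>lborel)"
    using integrable_mult_square_integrable[OF tG s\<phi>0] integrable_mult_square_integrable[OF G s\<phi>0]
    by (simp add: left_diff_distrib)
  finally have eq: "(\<integral>x. (u (x + h) - u x - ?G x) * \<phi> x \<partial>lborel) = (\<integral>x. ?D x * \<phi> x \<partial>lborel)" .
  have "2 * (\<integral>x. ?D x * \<phi> x \<partial>lborel) \<le> sqnorm ?D + sqnorm \<phi>"
    using sqnorm_diff[OF D s\<phi>0] sqnorm_nonneg[of "\<lambda>x. ?D x - \<phi> x"] by simp
  also have "sqnorm ?D \<le> C" using C[OF \<theta>] unfolding translation_sqdiff_def .
  finally show "2 * (\<integral>x. (u (x + h) - u x - ?G x) * \<phi> x \<partial>lborel) \<le> C + sqnorm \<phi>"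
    unfolding eq by simp
qed

lemma sqnorm_inner_le:
  fixes g :: "real ^ 'n::finite \<Rightarrow> real ^ 'n"
  assumes "\<And>i. square_integrable (\<lambda>x. g x $ i)"
  shows "sqnorm (\<lambda>x. h \<bullet> g x) \<le> (norm h)\<^sup>2 * (\<Sum>i\<in>UNIV. sqnorm (\<lambda>x. g x $ i))"
proof -
  have "sqnorm (\<lambda>x. h \<bullet> g x) \<le> (\<integral>x. (norm h)\<^sup>2 * (\<Sum>i\<in>UNIV. (g x $ i)\<^sup>2) \<partial>lborel)"
    unfolding sqnorm_def
  proof (rule integral_mono)
    show "(h \<bullet> g x)\<^sup>2 \<le> (norm h)\<^sup>2 * (\<Sum>i\<in>UNIV. (g x $ i)\<^sup>2)" for x
      using Cauchy_Schwarz_ineq[of h "g x"] unfolding power2_norm_eq_inner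
      by (simp add: inner_vec_sum power2_eq_square)
  qed (use assms square_integrable_inner[OF assms] in
        \<open>auto intro!: integrable_mult_right Bochner_Integration.integrable_sum simp: square_integrable_integrable\<close>)
  then show ?thesis using assms by (simp add: sqnorm_def square_integrable_integrable)
qed

text \<open>With \<open>r = a - b\<close> one has \<open>a\<^sup>2 - b\<^sup>2 = 2 b r + r\<^sup>2\<close>, and the mixed term is split with weight \<open>\<epsilon>\<close>. This
transfers an estimate of the remainder to the squared norms themselves.\<close>

lemma sqnorm_close:
  assumes a: "square_integrable a" and b: "square_integrable b" and \<epsilon>: "\<epsilon> > 0"
  shows "\<bar>sqnorm a - sqnorm b\<bar> \<le> \<epsilon> * sqnorm b + (1 + 1 / \<epsilon>) * sqnorm (\<lambda>x. a x - b x)"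
proof -
  let ?r = "\<lambda>x. a x - b x"
  have r: "square_integrable ?r" by (rule square_integrable_diff[OF a b])
  note int = square_integrable_integrable[OF a] square_integrable_integrable[OF b]
    square_integrable_integrable[OF r]
  have "\<bar>sqnorm a - sqnorm b\<bar> = \<bar>\<integral>x. (a x)\<^sup>2 - (b x)\<^sup>2 \<partial>lborel\<bar>"
    using int by (simp add: sqnorm_def)
  also have "\<dots> \<le> (\<integral>x. \<bar>(a x)\<^sup>2 - (b x)\<^sup>2\<bar> \<partial>lborel)" by (rule integral_abs_bound)
  also have "\<dots> \<le> (\<integral>x. \<epsilon> * (b x)\<^sup>2 + (1 + 1 / \<epsilon>) * (?r x)\<^sup>2 \<partial>lborel)"
  proof (rule integral_mono)
    fix x
    have "(a x)\<^sup>2 - (b x)\<^sup>2 = 2 * (b x * ?r x) + (?r x)\<^sup>2"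
      by (simp add: power2_eq_square algebra_simps)
    then have "\<bar>(a x)\<^sup>2 - (b x)\<^sup>2\<bar> \<le> 2 * \<bar>b x * ?r x\<bar> + (?r x)\<^sup>2"
      using abs_triangle_ineq[of "2 * (b x * ?r x)" "(?r x)\<^sup>2"] by (simp add: abs_mult)
    then show "\<bar>(a x)\<^sup>2 - (b x)\<^sup>2\<bar> \<le> \<epsilon> * (b x)\<^sup>2 + (1 + 1 / \<epsilon>) * (?r x)\<^sup>2"
      using mult_le_weighted_squares[OF \<epsilon>, of "b x" "?r x"] by (simp add: algebra_simps)
  qed (use int in auto)
  also have "\<dots> = \<epsilon> * sqnorm b + (1 + 1 / \<epsilon>) * sqnorm ?r"
    using int by (simp add: sqnorm_def)
  finally show ?thesis .
qed

text \<open>The remainder has squared norm \<open>o(\<bar>h\<bar>\<^sup>2)\<close>, because translations of the components of \<open>g\<close> are continuous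
in the mean.\<close>

proposition translation_sqdiff_second_order:
  fixes u :: "real ^ 'n::finite \<Rightarrow> real"
  assumes ug: "has_L2_gradient u g" and e: "e > 0"
  obtains \<delta> where "\<delta> > 0"
    "\<And>h. norm h < \<delta> \<Longrightarrow> \<bar>translation_sqdiff u h - sqnorm (\<lambda>x. h \<bullet> g x)\<bar> \<le> e * (norm h)\<^sup>2"
proof -
  have u: "square_integrable u" and g: "\<And>i. square_integrable (\<lambda>x. g x $ i)"
    using ug unfolding has_L2_gradient_def by blast+
  have G: "square_integrable (\<lambda>x. h \<bullet> g x)" for h by (rule square_integrable_inner[OF g])
  define N where "N = (\<Sum>i\<in>UNIV. sqnorm (\<lambda>x. g x $ i))"
  have N: "N \<ge> 0" unfolding N_def by (intro sum_nonneg sqnorm_nonneg)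
  \<comment> \<open>Half of the error e comes from the weight \<epsilon>, the other half from the remainder bound \<eta>.\<close>
  define \<epsilon> where "\<epsilon> = e / (2 * (N + 1))"
  have \<epsilon>: "\<epsilon> > 0" using e N by (simp add: \<epsilon>_def)
  define \<eta> where "\<eta> = e / (2 * (1 + 1 / \<epsilon>))"
  have \<epsilon>': "1 + 1 / \<epsilon> > 0" using \<epsilon> by (simp add: add_pos_pos)
  then have \<eta>: "\<eta> > 0" using e by (simp add: \<eta>_def)
  let ?\<omega> = "\<lambda>k. \<Sum>i\<in>UNIV. translation_sqdiff (\<lambda>x. g x $ i) k"
  have "(?\<omega> \<longlongrightarrow> (\<Sum>i\<in>(UNIV::'n set). 0)) (at 0)"
    by (intro tendsto_sum translation_sqdiff_tendsto_0 g)
  then have "eventually (\<lambda>k. ?\<omega> k < \<eta>) (at 0)" using \<eta> by (intro order_tendstoD(2)) auto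
  then obtain \<delta> where \<delta>: "\<delta> > 0" "\<And>k. k \<noteq> 0 \<Longrightarrow> norm k < \<delta> \<Longrightarrow> ?\<omega> k < \<eta>"
    unfolding eventually_at by auto
  show ?thesis
  proof (rule that[OF \<delta>(1)])
    fix h :: "real ^ 'n" assume h: "norm h < \<delta>"
    have "sqnorm (\<lambda>x. u (x + h) - u x - h \<bullet> g x) \<le> (norm h)\<^sup>2 * \<eta>"
    proof (rule sqnorm_difference_remainder_le[OF ug])
      fix \<theta> :: real assume \<theta>: "0 < \<theta>" "\<theta> < 1"
      have "translation_sqdiff (\<lambda>x. h \<bullet> g x) (\<theta> *\<^sub>R h) = sqnorm (\<lambda>x. h \<bullet> (g (x + \<theta> *\<^sub>R h) - g x))"
        by (simp add: translation_sqdiff_def inner_diff_right)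
      also have "\<dots> \<le> (norm h)\<^sup>2 * (\<Sum>i\<in>UNIV. sqnorm (\<lambda>x. (g (x + \<theta> *\<^sub>R h) - g x) $ i))"
        by (rule sqnorm_inner_le) (use square_integrable_translation_diff[OF g] in simp)
      also have "\<dots> = (norm h)\<^sup>2 * ?\<omega> (\<theta> *\<^sub>R h)"
        by (simp add: translation_sqdiff_def)
      also have "\<dots> \<le> (norm h)\<^sup>2 * \<eta>"
      proof (cases "h = 0")
        case False
        have "norm (\<theta> *\<^sub>R h) \<le> norm h" using \<theta> by (simp add: mult_left_le_one_le)
        then have "norm (\<theta> *\<^sub>R h) < \<delta>" using h by linarith
        then have "?\<omega> (\<theta> *\<^sub>R h) < \<eta>" using \<theta> False by (intro \<delta>(2)) auto
        then show ?thesis by (intro mult_left_mono) auto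
      qed simp
      finally show "translation_sqdiff (\<lambda>x. h \<bullet> g x) (\<theta> *\<^sub>R h) \<le> (norm h)\<^sup>2 * \<eta>" .
    qed
    then have "(1 + 1 / \<epsilon>) * sqnorm (\<lambda>x. u (x + h) - u x - h \<bullet> g x) \<le> (1 + 1 / \<epsilon>) * ((norm h)\<^sup>2 * \<eta>)"
      using \<epsilon>' by (intro mult_left_mono) auto
    also have "(1 + 1 / \<epsilon>) * ((norm h)\<^sup>2 * \<eta>) = (e / 2) * (norm h)\<^sup>2"
    proof -
      have "c * (e / (2 * c)) = e / 2" if "c > 0" for c :: real using that by simp
      from this[OF \<epsilon>'] have "(1 + 1 / \<epsilon>) * \<eta> = e / 2" unfolding \<eta>_def .
      then show ?thesis by (metis mult.assoc mult.commute)
    qed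
    finally have 1: "(1 + 1 / \<epsilon>) * sqnorm (\<lambda>x. u (x + h) - u x - h \<bullet> g x) \<le> (e / 2) * (norm h)\<^sup>2" .
    have "\<epsilon> * sqnorm (\<lambda>x. h \<bullet> g x) \<le> \<epsilon> * ((norm h)\<^sup>2 * (N + 1))"
      using sqnorm_inner_le[OF g, of h] \<epsilon> unfolding N_def[symmetric]
      by (intro mult_left_mono) (auto simp: distrib_left intro: order_trans)
    also have "\<epsilon> * ((norm h)\<^sup>2 * (N + 1)) = (e / 2) * (norm h)\<^sup>2"
    proof -
      have "\<epsilon> * (N + 1) = e / 2" unfolding \<epsilon>_def using N by (simp add: field_simps)
      then show ?thesis by (metis mult.assoc mult.commute)
    qed
    finally have 2: "\<epsilon> * sqnorm (\<lambda>x. h \<bullet> g x) \<le> (e / 2) * (norm h)\<^sup>2" .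
    show "\<bar>translation_sqdiff u h - sqnorm (\<lambda>x. h \<bullet> g x)\<bar> \<le> e * (norm h)\<^sup>2"
      using sqnorm_close[OF square_integrable_translation_diff[OF u, of h] G[of h] \<epsilon>] 1 2
      unfolding translation_sqdiff_def[symmetric] by (simp add: field_simps)
  qed
qed

section \<open>Radial integrals\<close>

text \<open>The surface area of the unit sphere, expressed through the volume of the unit ball; the two are
related by differentiating \<open>r \<mapsto> unit_ball_vol n * r ^ n\<close> at \<open>1\<close>.\<close>

definition sphere_area :: "'a::euclidean_space itself \<Rightarrow> real" where
  "sphere_area _ = real DIM('a) * unit_ball_vol (real DIM('a))"

lemma sphere_area_nonneg: "0 \<le> sphere_area TYPE('a::euclidean_space)"
  by (simp add: sphere_area_def)

text \<open>Integration in polar coordinates for radial functions. Both measures give a half-line \<open>{..a}\<close> the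
volume of the ball of radius \<open>a\<close>, and these half-lines generate the Borel sets.\<close>

lemma distr_norm_lborel:
  "distr (lborel :: 'a::euclidean_space measure) borel norm =
     density lborel (\<lambda>r. ennreal (sphere_area TYPE('a) * r ^ (DIM('a) - 1)) * indicator {0..} r)"
    (is "?M = ?N")
proof (rule measure_eqI_generator_eq[where E = "range atMost" and A = "\<lambda>n. {..real n}" and \<Omega> = UNIV])
  let ?V = "unit_ball_vol (real DIM('a))"
  have M: "emeasure ?M {..a} = (if a < 0 then 0 else ennreal (?V * a ^ DIM('a)))" for a :: real
  proof -
    have "emeasure ?M {..a} = emeasure lborel (cball (0::'a) a)"
      by (subst emeasure_distr) (auto intro!: arg_cong[where f = "emeasure lborel"])
    then show ?thesis by (auto simp: emeasure_cball)
  qed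
  have N: "emeasure ?N {..a} = (if a < 0 then 0 else ennreal (?V * a ^ DIM('a)))" for a :: real
  proof -
    have "emeasure ?N {..a} = (\<integral>\<^sup>+r. ennreal (sphere_area TYPE('a) * r ^ (DIM('a) - 1)) * indicator {0..a} r \<partial>lborel)"
      by (subst emeasure_density) (auto intro!: nn_integral_cong simp: indicator_def)
    also have "\<dots> = (if a < 0 then 0 else ennreal (?V * a ^ DIM('a)))"
    proof (cases "a < 0")
      case False
      have "(\<integral>\<^sup>+r. ennreal (sphere_area TYPE('a) * r ^ (DIM('a) - 1)) * indicator {0..a} r \<partial>lborel)
          = ennreal (?V * a ^ DIM('a) - ?V * 0 ^ DIM('a))"
        by (rule nn_integral_FTC_Icc)
           (use False in \<open>auto intro!: derivative_eq_intros simp: sphere_area_def\<close>)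
      then show ?thesis using False by simp
    qed simp
    finally show ?thesis .
  qed
  show "emeasure ?M X = emeasure ?N X" if "X \<in> range atMost" for X
    using that M N by auto
  show "emeasure ?M {..real n} \<noteq> \<infinity>" for n by (simp add: M)
  show "Int_stable (range (atMost :: real \<Rightarrow> real set))"
    by (auto simp: Int_stable_def)
  show "(\<Union>n. {..real n}) = UNIV" using real_arch_simple by auto
  have "sets (borel :: real measure) = sigma_sets UNIV (range atMost)"
    by (subst borel_eq_atMost) (simp add: full_SetCompr_eq)
  then show "sets ?M = sigma_sets UNIV (range atMost)" "sets ?N = sigma_sets UNIV (range atMost)"
    by simp_all
qed auto

lemma nn_integral_radial:
  assumes [measurable]: "f \<in> borel_measurable borel"
  shows "(\<integral>\<^sup>+h. f (norm (h :: 'a::euclidean_space)) \<partial>lborel) =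
    (\<integral>\<^sup>+r. ennreal (sphere_area TYPE('a) * r ^ (DIM('a) - 1)) * indicator {0..} r * f r \<partial>lborel)"
proof -
  have "(\<integral>\<^sup>+h. f (norm (h :: 'a)) \<partial>lborel) = integral\<^sup>N (distr lborel borel (norm :: 'a \<Rightarrow> real)) f"
    by (rule nn_integral_distr[symmetric]) auto
  also have "\<dots> = (\<integral>\<^sup>+r. ennreal (sphere_area TYPE('a) * r ^ (DIM('a) - 1)) * indicator {0..} r * f r \<partial>lborel)"
    unfolding distr_norm_lborel by (rule nn_integral_density) auto
  finally show ?thesis .
qed

lemma nn_integral_kernel_tail:
  assumes s: "s > 0" and R: "R > 0"
  shows "(\<integral>\<^sup>+h. ennreal (1 / norm h powr (real DIM('a) + 2 * s)) * indicator {h. R \<le> norm h} h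
      \<partial>(lborel :: 'a::euclidean_space measure))
    = ennreal (sphere_area TYPE('a) * R powr (- 2 * s) / (2 * s))"
proof -
  let ?S = "sphere_area TYPE('a)" and ?p = "real DIM('a) + 2 * s"
  have "(\<integral>\<^sup>+h. ennreal (1 / norm h powr ?p) * indicator {h. R \<le> norm h} h \<partial>(lborel :: 'a measure))
      = (\<integral>\<^sup>+h. ennreal (1 / norm h powr ?p) * indicator {R..} (norm h) \<partial>(lborel :: 'a measure))"
    by (auto intro!: nn_integral_cong simp: indicator_def)
  also have "\<dots> = (\<integral>\<^sup>+r. ennreal (?S * r ^ (DIM('a) - 1)) * indicator {0..} r
      * (ennreal (1 / r powr ?p) * indicator {R..} r) \<partial>lborel)"
    by (rule nn_integral_radial) measurable
  also have "\<dots> = (\<integral>\<^sup>+r. ennreal (?S * r powr (- 1 - 2 * s)) * indicator {R..} r \<partial>lborel)"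
  proof (rule nn_integral_cong)
    fix r :: real
    have "?S * r ^ (DIM('a) - 1) * (1 / r powr ?p) = ?S * r powr (- 1 - 2 * s)" if "R \<le> r"
    proof -
      have "r > 0" using that R by simp
      then have "r ^ (DIM('a) - 1) = r powr (real DIM('a) - 1)"
        by (simp add: powr_realpow[symmetric] of_nat_diff DIM_positive Suc_leI)
      moreover have "r powr (real DIM('a) - 1) / r powr ?p = r powr (- 1 - 2 * s)"
        by (simp add: powr_diff[symmetric])
      ultimately show ?thesis by (metis mult.assoc mult.right_neutral times_divide_eq_right)
    qed
    then show "ennreal (?S * r ^ (DIM('a) - 1)) * indicator {0..} r
        * (ennreal (1 / r powr ?p) * indicator {R..} r)
      = ennreal (?S * r powr (- 1 - 2 * s)) * indicator {R..} r"
      using R by (auto simp: indicator_def ennreal_mult'[symmetric] sphere_area_nonneg simp flip: ennreal_mult'')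
  qed
  also have "\<dots> = ennreal (?S * (- (R powr (- 1 - 2 * s + 1)) / (- 1 - 2 * s + 1)))"
    by (rule nn_integral_has_integral_lebesgue'
          [OF _ has_integral_mult_right[OF has_integral_powr_to_inf]])
       (use s R in \<open>auto intro: mult_nonneg_nonneg sphere_area_nonneg\<close>)
  also have "?S * (- (R powr (- 1 - 2 * s + 1)) / (- 1 - 2 * s + 1)) = ?S * R powr (- 2 * s) / (2 * s)"
    using s by (simp add: field_simps)
  finally show ?thesis .
qed

lemma nn_integral_kernel_core:
  assumes s: "s < 1" and R: "R > 0"
  shows "(\<integral>\<^sup>+h. ennreal ((norm h)\<^sup>2 / norm h powr (real DIM('a) + 2 * s)) * indicator {h. norm h \<le> R} h
      \<partial>(lborel :: 'a::euclidean_space measure))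
    = ennreal (sphere_area TYPE('a) * R powr (2 - 2 * s) / (2 - 2 * s))"
proof -
  let ?S = "sphere_area TYPE('a)" and ?p = "real DIM('a) + 2 * s"
  have "(\<integral>\<^sup>+h. ennreal ((norm h)\<^sup>2 / norm h powr ?p) * indicator {h. norm h \<le> R} h \<partial>(lborel :: 'a measure))
      = (\<integral>\<^sup>+h. ennreal ((norm h)\<^sup>2 / norm h powr ?p) * indicator {..R} (norm h) \<partial>(lborel :: 'a measure))"
    by (auto intro!: nn_integral_cong simp: indicator_def)
  also have "\<dots> = (\<integral>\<^sup>+r. ennreal (?S * r ^ (DIM('a) - 1)) * indicator {0..} r
      * (ennreal (r\<^sup>2 / r powr ?p) * indicator {..R} r) \<partial>lborel)"
    by (rule nn_integral_radial) measurable
  also have "\<dots> = (\<integral>\<^sup>+r. ennreal (?S * r powr (1 - 2 * s)) * indicator {0..R} r \<partial>lborel)"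
  proof (rule nn_integral_cong)
    fix r :: real
    have "?S * r ^ (DIM('a) - 1) * (r\<^sup>2 / r powr ?p) = ?S * r powr (1 - 2 * s)" if "0 \<le> r"
    proof (cases "r = 0")
      case False
      then have r: "r > 0" using that by simp
      have "r ^ (DIM('a) - 1) * r\<^sup>2 = r ^ (DIM('a) + 1)"
        using DIM_positive[where 'a = 'a] by (simp add: power_add[symmetric])
      also have "\<dots> = r powr (real DIM('a) + 1)"
        using r by (simp add: powr_add powr_realpow)
      finally have "r ^ (DIM('a) - 1) * r\<^sup>2 = r powr (real DIM('a) + 1)" .
      then have "?S * r ^ (DIM('a) - 1) * (r\<^sup>2 / r powr ?p) = ?S * (r powr (real DIM('a) + 1) / r powr ?p)"
        by (metis mult.assoc times_divide_eq_right)
      also have "\<dots> = ?S * r powr (1 - 2 * s)" by (simp add: powr_diff[symmetric])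
      finally show ?thesis .
    qed simp
    then show "ennreal (?S * r ^ (DIM('a) - 1)) * indicator {0..} r
        * (ennreal (r\<^sup>2 / r powr ?p) * indicator {..R} r)
      = ennreal (?S * r powr (1 - 2 * s)) * indicator {0..R} r"
      by (auto simp: indicator_def ennreal_mult'[symmetric] sphere_area_nonneg simp flip: ennreal_mult'')
  qed
  also have "\<dots> = ennreal (?S * (R powr (1 - 2 * s + 1) / (1 - 2 * s + 1)))"
    by (rule nn_integral_has_integral_lebesgue'
          [OF _ has_integral_mult_right[OF has_integral_powr_from_0]])
       (use s R in \<open>auto intro: mult_nonneg_nonneg sphere_area_nonneg\<close>)
  also have "?S * (R powr (1 - 2 * s + 1) / (1 - 2 * s + 1)) = ?S * R powr (2 - 2 * s) / (2 - 2 * s)"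
    by simp
  finally show ?thesis .
qed

text \<open>Reflections and permutations of the coordinates preserve both the norm and Lebesgue measure, since
they map boxes to boxes of equal volume. Together they determine the second moments of a radial weight
up to their trace.\<close>

definition flip_coord :: "'n::finite \<Rightarrow> real ^ 'n \<Rightarrow> real ^ 'n" where
  "flip_coord i x = (\<chi> k. if k = i then - x $ k else x $ k)"

definition permute_coords :: "('n::finite \<Rightarrow> 'n) \<Rightarrow> real ^ 'n \<Rightarrow> real ^ 'n" where
  "permute_coords p x = (\<chi> k. x $ p k)"

lemma prod_Basis_vec: "(\<Prod>b\<in>Basis. (x :: real ^ 'n::finite) \<bullet> b) = (\<Prod>i\<in>UNIV. x $ i)"
proof -
  have inj: "inj (\<lambda>i :: 'n. axis i (1::real))" by (auto simp: inj_on_def axis_eq_axis)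
  have Basis: "(Basis :: (real ^ 'n) set) = (\<lambda>i. axis i 1) ` UNIV" by (auto simp: Basis_vec_def)
  show ?thesis unfolding Basis by (subst prod.reindex[OF inj]) (simp add: inner_axis)
qed

lemma emeasure_lborel_box_vec:
  fixes l u :: "real ^ 'n::finite"
  assumes "\<And>i. l $ i \<le> u $ i"
  shows "emeasure lborel (box l u) = ennreal (\<Prod>i\<in>UNIV. u $ i - l $ i)"
proof -
  have "l \<bullet> b \<le> u \<bullet> b" if "b \<in> Basis" for b
    using that assms by (auto simp: Basis_vec_def inner_axis)
  then show ?thesis
    using prod_Basis_vec[of "u - l"] by (simp add: emeasure_lborel_box_eq)
qed

lemma lborel_eqI_vec:
  fixes M :: "(real ^ 'n::finite) measure"
  assumes "\<And>l u. (\<And>i. l $ i \<le> u $ i) \<Longrightarrow> emeasure M (box l u) = ennreal (\<Prod>i\<in>UNIV. u $ i - l $ i)"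
    and "sets M = sets borel"
  shows "M = lborel"
proof (rule sym, rule lborel_eqI)
  fix l u :: "real ^ 'n" assume "\<And>b. b \<in> Basis \<Longrightarrow> l \<bullet> b \<le> u \<bullet> b"
  then have "l \<bullet> axis i 1 \<le> u \<bullet> axis i 1" for i by (auto simp: Basis_vec_def)
  then have "l $ i \<le> u $ i" for i by (simp add: inner_axis)
  from assms(1)[OF this] show "emeasure M (box l u) = ennreal (\<Prod>b\<in>Basis. (u - l) \<bullet> b)"
    by (simp only: prod_Basis_vec vector_minus_component)
qed (rule assms(2))

lemma flip_coord_measurable [measurable]: "flip_coord i \<in> borel_measurable borel"
proof (rule borel_measurable_continuous_onI)
  have "flip_coord i = (\<lambda>x. \<chi> k. if k = i then - x $ k else x $ k)" by (rule ext) (rule flip_coord_def)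
  moreover have "continuous_on UNIV (\<lambda>x :: real ^ 'a. if k = i then - x $ k else x $ k)" for k
    by (cases "k = i") (auto intro!: continuous_intros)
  ultimately show "continuous_on UNIV (flip_coord i)" by (auto intro: continuous_on_vec_lambda)
qed

lemma permute_coords_measurable [measurable]: "permute_coords p \<in> borel_measurable borel"
proof (rule borel_measurable_continuous_onI)
  have "permute_coords p = (\<lambda>x. \<chi> k. x $ p k)" by (rule ext) (rule permute_coords_def)
  then show "continuous_on UNIV (permute_coords p)" by (auto intro!: continuous_intros)
qed

lemma distr_flip_coord: "distr lborel borel (flip_coord i) = (lborel :: (real ^ 'n::finite) measure)"
proof (rule lborel_eqI_vec)
  fix l u :: "real ^ 'n" assume le: "\<And>k. l $ k \<le> u $ k"
  let ?l = "\<chi> k. if k = i then - u $ k else l $ k" and ?u = "\<chi> k. if k = i then - l $ k else u $ k"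
  have "flip_coord i -` box l u = box ?l ?u"
    by (auto simp: mem_box_cart flip_coord_def split: if_splits) (metis minus_less_iff less_minus_iff)+
  moreover have "emeasure lborel (box ?l ?u) = ennreal (\<Prod>k\<in>UNIV. ?u $ k - ?l $ k)"
    by (rule emeasure_lborel_box_vec) (use le in auto)
  moreover have "(\<Prod>k\<in>UNIV. ?u $ k - ?l $ k) = (\<Prod>k\<in>UNIV. u $ k - l $ k)"
    by (rule prod.cong) auto
  ultimately show "emeasure (distr lborel borel (flip_coord i)) (box l u) = ennreal (\<Prod>k\<in>UNIV. u $ k - l $ k)"
    by (simp add: emeasure_distr)
qed simp

lemma distr_permute_coords:
  assumes p: "\<And>k. p (p k) = k"
  shows "distr lborel borel (permute_coords p) = (lborel :: (real ^ 'n::finite) measure)"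
proof (rule lborel_eqI_vec)
  fix l u :: "real ^ 'n" assume le: "\<And>k. l $ k \<le> u $ k"
  have "permute_coords p -` box l u = box (permute_coords p l) (permute_coords p u)"
    by (auto simp: mem_box_cart permute_coords_def) (metis p)+
  moreover have "emeasure lborel (box (permute_coords p l) (permute_coords p u))
      = ennreal (\<Prod>k\<in>UNIV. permute_coords p u $ k - permute_coords p l $ k)"
    by (rule emeasure_lborel_box_vec) (use le in \<open>simp add: permute_coords_def\<close>)
  moreover have "(\<Prod>k\<in>UNIV. permute_coords p u $ k - permute_coords p l $ k) = (\<Prod>k\<in>UNIV. u $ k - l $ k)"
    by (rule prod.reindex_bij_witness[of _ p p]) (auto simp: p permute_coords_def)
  ultimately show "emeasure (distr lborel borel (permute_coords p)) (box l u) = ennreal (\<Prod>k\<in>UNIV. u $ k - l $ k)"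
    by (simp add: emeasure_distr)
qed simp

lemma norm_flip_coord: "norm (flip_coord i x) = norm x"
  unfolding norm_vec_def L2_set_def by (rule arg_cong[where f = sqrt]) (auto intro: sum.cong simp: flip_coord_def)

lemma norm_permute_coords:
  assumes "\<And>k. p (p k) = k"
  shows "norm (permute_coords p x) = norm x"
  unfolding norm_vec_def L2_set_def
  by (rule arg_cong[where f = sqrt], rule sum.reindex_bij_witness[of _ p p])
     (auto simp: assms permute_coords_def)

text \<open>Reflecting one coordinate shows that the mixed moments \<open>\<integral> h\<^sub>i h\<^sub>j w(\<bar>h\<bar>) dh\<close> vanish, exchanging two
coordinates that the pure ones agree; the common value is the trace divided by \<open>n\<close>.\<close>

proposition radial_second_moments:
  fixes w :: "real \<Rightarrow> real" and a :: "real ^ 'n::finite"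
  assumes [measurable]: "w \<in> borel_measurable borel"
    and int: "integrable lborel (\<lambda>h :: real ^ 'n. (norm h)\<^sup>2 * w (norm h))"
  shows "integrable lborel (\<lambda>h. (h \<bullet> a)\<^sup>2 * w (norm h))"
    and "(\<integral>h. (h \<bullet> a)\<^sup>2 * w (norm h) \<partial>lborel)
      = (norm a)\<^sup>2 / real CARD('n) * integral\<^sup>L lborel (\<lambda>h :: real ^ 'n. (norm h)\<^sup>2 * w (norm h))"
proof -
  let ?b = "\<lambda>i j (h :: real ^ 'n). h $ i * h $ j * w (norm h)"
  define B where "B i j = integral\<^sup>L lborel (?b i j)" for i j
  have bm: "?b i j \<in> borel_measurable borel" for i j by measurable
  have bi: "integrable lborel (?b i j)" for i j
  proof (rule Bochner_Integration.integrable_bound[OF int])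
    have "\<bar>h $ i * h $ j\<bar> \<le> (norm h)\<^sup>2" for h :: "real ^ 'n"
      unfolding abs_mult power2_eq_square by (intro mult_mono component_le_norm_cart) auto
    then show "AE h in lborel. norm (?b i j h) \<le> norm ((norm h)\<^sup>2 * w (norm h))"
      by (auto simp: abs_mult intro!: always_eventually mult_right_mono)
  qed (use bm in simp)
  have off: "B i j = 0" if "i \<noteq> j" for i j
  proof -
    have "B i j = integral\<^sup>L (distr lborel borel (flip_coord i)) (?b i j)"
      by (simp add: B_def distr_flip_coord)
    also have "\<dots> = (\<integral>h. ?b i j (flip_coord i h) \<partial>lborel)"
      by (rule integral_distr) (use bm in auto)
    also have "\<dots> = - B i j"
      using that by (simp add: norm_flip_coord B_def) (simp add: flip_coord_def)
    finally show ?thesis by simp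
  qed
  have diag: "B i i = B j j" for i j
  proof -
    define p where "p k = (if k = i then j else if k = j then i else k)" for k
    have p: "p (p k) = k" for k by (auto simp: p_def)
    have "B j j = integral\<^sup>L (distr lborel borel (permute_coords p)) (?b j j)"
      by (simp add: B_def distr_permute_coords[OF p])
    also have "\<dots> = (\<integral>h. ?b j j (permute_coords p h) \<partial>lborel)"
      by (rule integral_distr) (use bm in auto)
    also have "\<dots> = B i i"
      by (simp add: norm_permute_coords[OF p] B_def) (simp add: permute_coords_def p_def)
    finally show ?thesis by simp
  qed
  have expand: "(h \<bullet> a)\<^sup>2 * w (norm h) = (\<Sum>i\<in>UNIV. \<Sum>j\<in>UNIV. a $ i * a $ j * ?b i j h)" for h
    unfolding power2_eq_square inner_vec_sum sum_product
    unfolding sum_distrib_right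
    by (intro sum.cong refl) (simp add: mult_ac)
  show "integrable lborel (\<lambda>h. (h \<bullet> a)\<^sup>2 * w (norm h))"
    unfolding expand by (intro Bochner_Integration.integrable_sum integrable_mult_right bi)
  have norm2: "(norm x)\<^sup>2 = (\<Sum>i\<in>UNIV. x $ i * x $ i)" for x :: "real ^ 'n"
    unfolding power2_norm_eq_inner inner_vec_sum ..
  define c where "c = B undefined undefined"
  have Bc: "B i j = (if i = j then c else 0)" for i j
    using off diag[of i undefined] by (auto simp: c_def)
  have "integral\<^sup>L lborel (\<lambda>h :: real ^ 'n. (norm h)\<^sup>2 * w (norm h)) = (\<integral>h. (\<Sum>i\<in>UNIV. ?b i i h) \<partial>lborel)"
    by (simp add: norm2 sum_distrib_right)
  also have "\<dots> = (\<Sum>i\<in>UNIV. B i i)" using bi by (simp add: B_def)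
  also have "\<dots> = real CARD('n) * c" by (simp add: Bc)
  finally have tr: "integral\<^sup>L lborel (\<lambda>h :: real ^ 'n. (norm h)\<^sup>2 * w (norm h)) = real CARD('n) * c" .
  have "(\<integral>h. (h \<bullet> a)\<^sup>2 * w (norm h) \<partial>lborel) = (\<Sum>i\<in>UNIV. \<Sum>j\<in>UNIV. a $ i * a $ j * B i j)"
    unfolding expand using bi by (simp add: B_def)
  also have "\<dots> = (norm a)\<^sup>2 * c"
    by (simp add: Bc norm2 sum_distrib_right if_distrib[of "\<lambda>t. _ * t"] cong: if_cong)
  finally show "(\<integral>h. (h \<bullet> a)\<^sup>2 * w (norm h) \<partial>lborel)
      = (norm a)\<^sup>2 / real CARD('n) * integral\<^sup>L lborel (\<lambda>h :: real ^ 'n. (norm h)\<^sup>2 * w (norm h))"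
    unfolding tr by simp
qed

section \<open>The two limits for weighted kernel integrals\<close>

definition kernel_energy :: "real \<Rightarrow> ('a::euclidean_space \<Rightarrow> real) \<Rightarrow> ennreal" where
  "kernel_energy s \<omega> = (\<integral>\<^sup>+h. ennreal (\<omega> h / norm h powr (real DIM('a) + 2 * s)) \<partial>lborel)"

text \<open>A limit in the extended half-line from two-sided bounds in real numbers. The lower bound is harmless
when \<open>L - e\<close> is negative, as \<open>ennreal\<close> then gives \<open>0\<close>.\<close>

lemma tendsto_ennrealI:
  fixes F :: "'a \<Rightarrow> ennreal"
  assumes L: "0 \<le> L"
    and upper: "\<And>e. e > 0 \<Longrightarrow> eventually (\<lambda>s. F s \<le> ennreal (L + e)) A"
    and lower: "\<And>e. e > 0 \<Longrightarrow> eventually (\<lambda>s. ennreal (L - e) \<le> F s) A"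
  shows "(F \<longlongrightarrow> ennreal L) A"
proof (rule order_tendstoI)
  fix a assume a: "a < ennreal L"
  then obtain r where r: "a = ennreal r" "0 \<le> r" by (cases a) auto
  then have rL: "r < L" using a by (simp add: ennreal_less_iff)
  then have "a < ennreal (L - (L - r) / 2)" using r by (simp add: ennreal_less_iff field_simps)
  moreover have "eventually (\<lambda>s. ennreal (L - (L - r) / 2) \<le> F s) A"
    using rL by (intro lower) simp
  ultimately show "eventually (\<lambda>s. a < F s) A"
    by (auto elim!: eventually_mono intro: less_le_trans)
next
  fix a assume a: "ennreal L < a"
  obtain e where e: "e > 0" "ennreal (L + e) < a"
  proof (cases a)
    case (real r)
    then have "L < r" using a L by (simp add: ennreal_less_iff)
    then show ?thesis using real L
      by (intro that[of "(r - L) / 2"]) (auto simp: ennreal_less_iff field_simps)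
  next
    case top
    then show ?thesis by (intro that[of 1]) auto
  qed
  then show "eventually (\<lambda>s. F s < a) A"
    using upper[OF e(1)] by (auto elim!: eventually_mono intro: le_less_trans)
qed

lemma ennreal_sum_of_products:
  assumes "0 \<le> a" "0 \<le> b" "0 \<le> c" "0 \<le> d"
  shows "ennreal a * ennreal b + ennreal c * ennreal d = ennreal (a * b + c * d)"
  using assms by (simp add: ennreal_mult ennreal_plus)

text \<open>Choose \<open>R\<close> with \<open>\<omega>\<close> within \<open>\<epsilon>\<close> of \<open>L\<close> for \<open>\<bar>h\<bar> \<ge> R\<close>. The integral over that region, times \<open>s\<close>, lies between
\<open>(L - \<epsilon>) S R\<^bsup>-2s\<^esup> / 2\<close> and \<open>(L + \<epsilon>) S R\<^bsup>-2s\<^esup> / 2\<close>. Inside the ball the kernel is at most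
\<open>R\<^bsup>2(s0 - s)\<^esup>\<close> times the kernel of order \<open>s0\<close>, so that the inner part stays bounded and the factor \<open>s\<close>
removes it.\<close>

proposition kernel_energy_tendsto_at_0:
  fixes \<omega> :: "'a::euclidean_space \<Rightarrow> real"
  assumes m [measurable]: "\<omega> \<in> borel_measurable borel" and nn: "\<And>h. 0 \<le> \<omega> h"
    and lim: "(\<omega> \<longlongrightarrow> L) at_infinity" and s0: "s0 > 0" and fin: "kernel_energy s0 \<omega> < \<infinity>"
  shows "((\<lambda>s. ennreal s * kernel_energy s \<omega>) \<longlongrightarrow> ennreal (sphere_area TYPE('a) * L / 2)) (at_right 0)"
proof -
  let ?S = "sphere_area TYPE('a)" and ?n = "real DIM('a)"
  have S: "0 \<le> ?S" by (rule sphere_area_nonneg)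
  have L: "0 \<le> L"
    by (rule tendsto_lowerbound[OF lim]) (use nn trivial_limit_at_infinity in auto)
  have tail_radius: "\<exists>R>0. \<forall>h. R \<le> norm h \<longrightarrow> \<bar>\<omega> h - L\<bar> \<le> e" if "e > 0" for e
    using tendstoD[OF lim that] unfolding eventually_at_infinity_pos dist_real_def
    by (metis less_imp_le)
  have ev: "eventually (\<lambda>s::real. 0 < s \<and> s < s0) (at_right 0)"
    using s0 by (auto simp: eventually_at_right_field)
  obtain E where E: "E \<ge> 0" "kernel_energy s0 \<omega> = ennreal E"
    using fin by (cases "kernel_energy s0 \<omega>") auto
  show ?thesis
  proof (rule tendsto_ennrealI)
    fix e :: real assume e: "e > 0"
    \<comment> \<open>The limits below are off by at most ?S * \<epsilon> / 2 < e; adding 1 avoids a case distinction on ?S.\<close>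
    define \<epsilon> where "\<epsilon> = e / (?S + 1)"
    have \<epsilon>: "\<epsilon> > 0" "?S * \<epsilon> \<le> e" using e S by (auto simp: \<epsilon>_def field_simps)
    obtain R where R: "R > 0" "\<And>h. R \<le> norm h \<Longrightarrow> \<bar>\<omega> h - L\<bar> \<le> \<epsilon>"
      using tail_radius[OF \<epsilon>(1)] by blast
    have up: "ennreal s * kernel_energy s \<omega>
        \<le> ennreal (s * R powr (2 * (s0 - s)) * E + (L + \<epsilon>) * (?S * R powr (- 2 * s) / 2))"
      if s: "0 < s \<and> s < s0" for s
    proof -
      let ?K = "\<lambda>h. ennreal (1 / norm h powr (?n + 2 * s)) * indicator {h. R \<le> norm h} (h::'a)"
      have pt: "ennreal (\<omega> h / norm h powr (?n + 2 * s))
          \<le> ennreal (R powr (2 * (s0 - s))) * ennreal (\<omega> h / norm h powr (?n + 2 * s0))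
            + ennreal (L + \<epsilon>) * ?K h" for h :: 'a
      proof (cases "R \<le> norm h")
        case True
        then have "\<omega> h \<le> L + \<epsilon>" using R(2)[of h] by linarith
        then have "\<omega> h / norm h powr (?n + 2 * s) \<le> (L + \<epsilon>) * (1 / norm h powr (?n + 2 * s))"
          by (simp add: divide_right_mono)
        then have "ennreal (\<omega> h / norm h powr (?n + 2 * s)) \<le> ennreal (L + \<epsilon>) * ?K h"
          using True by (simp add: ennreal_mult''[symmetric] ennreal_leI)
        then show ?thesis by (rule add_increasing[rotated]) simp
      next
        case False
        have "\<omega> h / norm h powr (?n + 2 * s) \<le> R powr (2 * (s0 - s)) * (\<omega> h / norm h powr (?n + 2 * s0))"
        proof (cases "h = 0")
          case False
          have "1 / norm h powr (?n + 2 * s) = norm h powr (2 * (s0 - s)) / norm h powr (?n + 2 * s0)"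
            using False by (simp add: powr_diff[symmetric] powr_minus_divide[symmetric] algebra_simps)
          also have "\<dots> \<le> R powr (2 * (s0 - s)) / norm h powr (?n + 2 * s0)"
            using \<open>\<not> R \<le> norm h\<close> s by (intro divide_right_mono powr_mono2) auto
          finally have "\<omega> h * (1 / norm h powr (?n + 2 * s))
              \<le> \<omega> h * (R powr (2 * (s0 - s)) / norm h powr (?n + 2 * s0))"
            by (rule mult_left_mono[OF _ nn])
          then show ?thesis by (simp add: mult_ac)
        qed simp
        then have "ennreal (\<omega> h / norm h powr (?n + 2 * s))
            \<le> ennreal (R powr (2 * (s0 - s))) * ennreal (\<omega> h / norm h powr (?n + 2 * s0))"
          by (simp add: ennreal_mult'[symmetric] ennreal_leI)
        then show ?thesis by (rule add_increasing2[rotated]) simp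
      qed
      have "kernel_energy s \<omega> \<le> (\<integral>\<^sup>+h. ennreal (R powr (2 * (s0 - s))) * ennreal (\<omega> h / norm h powr (?n + 2 * s0))
            + ennreal (L + \<epsilon>) * ?K h \<partial>lborel)"
        unfolding kernel_energy_def by (rule nn_integral_mono) (rule pt)
      also have "\<dots> = ennreal (R powr (2 * (s0 - s))) * kernel_energy s0 \<omega> + ennreal (L + \<epsilon>) * (\<integral>\<^sup>+h. ?K h \<partial>lborel)"
        unfolding kernel_energy_def by (simp add: nn_integral_add nn_integral_cmult)
      also have "\<dots> = ennreal (R powr (2 * (s0 - s))) * ennreal E
          + ennreal (L + \<epsilon>) * ennreal (?S * R powr (- 2 * s) / (2 * s))"
        using s R(1) by (simp only: E(2) nn_integral_kernel_tail)
      also have "\<dots> = ennreal (R powr (2 * (s0 - s)) * E + (L + \<epsilon>) * (?S * R powr (- 2 * s) / (2 * s)))"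
        by (rule ennreal_sum_of_products) (use s L \<epsilon>(1) E(1) S in auto)
      finally have "ennreal s * kernel_energy s \<omega>
          \<le> ennreal s * ennreal (R powr (2 * (s0 - s)) * E + (L + \<epsilon>) * (?S * R powr (- 2 * s) / (2 * s)))"
        by (rule mult_left_mono) simp
      also have "\<dots> = ennreal (s * (R powr (2 * (s0 - s)) * E + (L + \<epsilon>) * (?S * R powr (- 2 * s) / (2 * s))))"
        using s by (simp add: ennreal_mult')
      also have "s * (R powr (2 * (s0 - s)) * E + (L + \<epsilon>) * (?S * R powr (- 2 * s) / (2 * s)))
          = s * R powr (2 * (s0 - s)) * E + (L + \<epsilon>) * (?S * R powr (- 2 * s) / 2)"
        using s by (simp add: field_simps)
      finally show ?thesis .
    qed
    have "((\<lambda>s. s * R powr (2 * (s0 - s)) * E + (L + \<epsilon>) * (?S * R powr (- 2 * s) / 2))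
        \<longlongrightarrow> 0 * R powr (2 * (s0 - 0)) * E + (L + \<epsilon>) * (?S * R powr (- 2 * 0) / 2)) (at_right 0)"
      using R(1) by (intro tendsto_intros) auto
    moreover have "0 * R powr (2 * (s0 - 0)) * E + (L + \<epsilon>) * (?S * R powr (- 2 * 0) / 2) < ?S * L / 2 + e"
      using R(1) \<epsilon> e by (simp add: field_simps)
    ultimately have "eventually (\<lambda>s. s * R powr (2 * (s0 - s)) * E + (L + \<epsilon>) * (?S * R powr (- 2 * s) / 2)
        < ?S * L / 2 + e) (at_right 0)"
      by (rule order_tendstoD)
    with ev show "eventually (\<lambda>s. ennreal s * kernel_energy s \<omega> \<le> ennreal (?S * L / 2 + e)) (at_right 0)"
      by eventually_elim (rule order_trans[OF up ennreal_leI], auto)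
    have low: "ennreal ((L - \<epsilon>) * (?S * R powr (- 2 * s) / 2)) \<le> ennreal s * kernel_energy s \<omega>"
      if s: "0 < s \<and> s < s0" for s
    proof -
      let ?K = "\<lambda>h. ennreal (1 / norm h powr (?n + 2 * s)) * indicator {h. R \<le> norm h} (h::'a)"
      have pt: "ennreal (L - \<epsilon>) * ?K h \<le> ennreal (\<omega> h / norm h powr (?n + 2 * s))" for h :: 'a
      proof (cases "R \<le> norm h")
        case True
        then have "L - \<epsilon> \<le> \<omega> h" using R(2)[of h] by linarith
        then have "(L - \<epsilon>) * (1 / norm h powr (?n + 2 * s)) \<le> \<omega> h / norm h powr (?n + 2 * s)"
          by (simp add: divide_right_mono)
        then show ?thesis using True by (simp add: ennreal_mult''[symmetric] ennreal_leI)
      qed simp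
      have "ennreal (L - \<epsilon>) * ennreal (?S * R powr (- 2 * s) / (2 * s)) = ennreal (L - \<epsilon>) * (\<integral>\<^sup>+h. ?K h \<partial>lborel)"
        using s R(1) by (simp add: nn_integral_kernel_tail)
      also have "\<dots> = (\<integral>\<^sup>+h. ennreal (L - \<epsilon>) * ?K h \<partial>lborel)"
        by (rule nn_integral_cmult[symmetric]) measurable
      also have "\<dots> \<le> kernel_energy s \<omega>"
        unfolding kernel_energy_def by (rule nn_integral_mono) (rule pt)
      finally have "ennreal s * (ennreal (L - \<epsilon>) * ennreal (?S * R powr (- 2 * s) / (2 * s))) \<le> ennreal s * kernel_energy s \<omega>"
        by (rule mult_left_mono) simp
      moreover have "ennreal s * (ennreal (L - \<epsilon>) * ennreal (?S * R powr (- 2 * s) / (2 * s)))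
          = ennreal (s * ((L - \<epsilon>) * (?S * R powr (- 2 * s) / (2 * s))))"
      proof -
        have "0 \<le> s" "0 \<le> ?S * R powr (- 2 * s) / (2 * s)" using s S by auto
        then show ?thesis by (simp only: ennreal_mult' ennreal_mult'')
      qed
      moreover have "s * ((L - \<epsilon>) * (?S * R powr (- 2 * s) / (2 * s))) = (L - \<epsilon>) * (?S * R powr (- 2 * s) / 2)"
        using s by (simp add: field_simps)
      ultimately show ?thesis by metis
    qed
    have "((\<lambda>s. (L - \<epsilon>) * (?S * R powr (- 2 * s) / 2))
        \<longlongrightarrow> (L - \<epsilon>) * (?S * R powr (- 2 * 0) / 2)) (at_right 0)"
      using R(1) by (intro tendsto_intros) auto
    moreover have "?S * L / 2 - e < (L - \<epsilon>) * (?S * R powr (- 2 * 0) / 2)"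
      using R(1) \<epsilon> e by (simp add: field_simps)
    ultimately have "eventually (\<lambda>s. ?S * L / 2 - e < (L - \<epsilon>) * (?S * R powr (- 2 * s) / 2)) (at_right 0)"
      by (rule order_tendstoD)
    with ev show "eventually (\<lambda>s. ennreal (?S * L / 2 - e) \<le> ennreal s * kernel_energy s \<omega>) (at_right 0)"
      by eventually_elim (rule order_trans[OF ennreal_leI low], auto)
  qed (use S L in simp)
qed

text \<open>The hypothesis on \<open>Q\<close> is what polar coordinates give for a quadratic form. Choose \<open>R\<close> with \<open>\<omega>\<close> within
\<open>\<epsilon> \<bar>h\<bar>\<^sup>2\<close> of \<open>Q\<close> on the ball of radius \<open>R\<close>. There \<open>Q\<close> contributes \<open>c R\<^bsup>2-2s\<^esup>\<close> after multiplication by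
\<open>1 - s\<close>, and the error \<open>\<epsilon> S R\<^bsup>2-2s\<^esup> / 2\<close>; outside the ball the integral stays bounded as \<open>s \<rightarrow> 1\<close>, because \<open>\<omega>\<close> is
bounded, and the factor \<open>1 - s\<close> removes it.\<close>

proposition kernel_energy_tendsto_at_1:
  fixes \<omega> Q :: "'a::euclidean_space \<Rightarrow> real"
  assumes m [measurable]: "\<omega> \<in> borel_measurable borel" "Q \<in> borel_measurable borel"
    and nn: "\<And>h. 0 \<le> \<omega> h" "\<And>h. 0 \<le> Q h" and M: "\<And>h. \<omega> h \<le> M"
    and close: "\<And>e. e > 0 \<Longrightarrow> \<exists>\<delta>>0. \<forall>h. norm h < \<delta> \<longrightarrow> \<bar>\<omega> h - Q h\<bar> \<le> e * (norm h)\<^sup>2"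
    and c: "c \<ge> 0"
    and Q: "\<And>s R. s < 1 \<Longrightarrow> R > 0 \<Longrightarrow>
      (\<integral>\<^sup>+h. ennreal (Q h / norm h powr (real DIM('a) + 2 * s)) * indicator {h. norm h \<le> R} h \<partial>lborel)
        = ennreal (c * R powr (2 - 2 * s) / (1 - s))"
  shows "((\<lambda>s. ennreal (1 - s) * kernel_energy s \<omega>) \<longlongrightarrow> ennreal c) (at_left 1)"
proof -
  let ?S = "sphere_area TYPE('a)" and ?n = "real DIM('a)"
  have S: "0 \<le> ?S" by (rule sphere_area_nonneg)
  have M0: "0 \<le> M" using nn(1)[of undefined] M[of undefined] by linarith
  have ev: "eventually (\<lambda>s::real. 0 < s \<and> s < 1) (at_left 1)"
    unfolding eventually_at_left_field by (rule exI[of _ 0]) auto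
  show ?thesis
  proof (rule tendsto_ennrealI[OF c])
    fix e :: real assume e: "e > 0"
    \<comment> \<open>The limits below are off by at most ?S * \<epsilon> / 2 < e.\<close>
    define \<epsilon> where "\<epsilon> = e / (?S + 1)"
    have \<epsilon>: "\<epsilon> > 0" "?S * \<epsilon> \<le> e" using e S by (auto simp: \<epsilon>_def field_simps)
    obtain \<delta> where "\<delta> > 0" "\<And>h. norm h < \<delta> \<Longrightarrow> \<bar>\<omega> h - Q h\<bar> \<le> \<epsilon> * (norm h)\<^sup>2"
      using close[OF \<epsilon>(1)] by blast
    then obtain R where R: "R > 0" "\<And>h. norm h \<le> R \<Longrightarrow> \<bar>\<omega> h - Q h\<bar> \<le> \<epsilon> * (norm h)\<^sup>2"
      using that[of "\<delta> / 2"] by (metis field_sum_of_halves half_gt_zero le_less_trans less_add_same_cancel1)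
    let ?T = "\<lambda>s h. ennreal (1 / norm h powr (?n + 2 * s)) * indicator {h. R \<le> norm h} (h::'a)"
    let ?C = "\<lambda>s h. ennreal ((norm h)\<^sup>2 / norm h powr (?n + 2 * s)) * indicator {h. norm h \<le> R} (h::'a)"
    let ?Q = "\<lambda>s h. ennreal (Q h / norm h powr (?n + 2 * s)) * indicator {h. norm h \<le> R} (h::'a)"
    have up: "ennreal (1 - s) * kernel_energy s \<omega>
        \<le> ennreal ((c + \<epsilon> * ?S / 2) * R powr (2 - 2 * s) + (1 - s) * (M * (?S * R powr (- 2 * s) / (2 * s))))"
      if s: "0 < s \<and> s < 1" for s
    proof -
      have pt: "ennreal (\<omega> h / norm h powr (?n + 2 * s)) \<le> ?Q s h + ennreal \<epsilon> * ?C s h + ennreal M * ?T s h"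
        for h :: 'a
      proof (cases "norm h \<le> R")
        case True
        then have "\<omega> h \<le> Q h + \<epsilon> * (norm h)\<^sup>2" using R(2)[of h] by linarith
        then have "\<omega> h / norm h powr (?n + 2 * s)
            \<le> Q h / norm h powr (?n + 2 * s) + \<epsilon> * ((norm h)\<^sup>2 / norm h powr (?n + 2 * s))"
          using divide_right_mono[of "\<omega> h" "Q h + \<epsilon> * (norm h)\<^sup>2" "norm h powr (?n + 2 * s)"]
          by (simp add: add_divide_distrib)
        then have "ennreal (\<omega> h / norm h powr (?n + 2 * s)) \<le> ?Q s h + ennreal \<epsilon> * ?C s h"
          using True \<epsilon>(1) nn(2)[of h]
          by (simp add: ennreal_mult'[symmetric] ennreal_plus[symmetric] ennreal_leI del: ennreal_plus)
        then show ?thesis by (rule add_increasing2[rotated]) simp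
      next
        case False
        have "\<omega> h / norm h powr (?n + 2 * s) \<le> M * (1 / norm h powr (?n + 2 * s))"
          using M by (simp add: divide_right_mono)
        then have "ennreal (\<omega> h / norm h powr (?n + 2 * s)) \<le> ennreal M * ?T s h"
          using False M0 by (simp add: ennreal_mult'[symmetric] ennreal_leI)
        then show ?thesis by (rule add_increasing[rotated]) simp
      qed
      have "kernel_energy s \<omega> \<le> (\<integral>\<^sup>+h. ?Q s h + ennreal \<epsilon> * ?C s h + ennreal M * ?T s h \<partial>lborel)"
        unfolding kernel_energy_def by (rule nn_integral_mono) (rule pt)
      also have "\<dots> = (\<integral>\<^sup>+h. ?Q s h \<partial>lborel) + ennreal \<epsilon> * (\<integral>\<^sup>+h. ?C s h \<partial>lborel)
          + ennreal M * (\<integral>\<^sup>+h. ?T s h \<partial>lborel)"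
        by (simp add: nn_integral_add nn_integral_cmult)
      also have "\<dots> = ennreal (c * R powr (2 - 2 * s) / (1 - s)
          + \<epsilon> * (?S * R powr (2 - 2 * s) / (2 - 2 * s)) + M * (?S * R powr (- 2 * s) / (2 * s)))"
      proof -
        have C: "ennreal \<epsilon> * ennreal (?S * R powr (2 - 2 * s) / (2 - 2 * s))
            + ennreal M * ennreal (?S * R powr (- 2 * s) / (2 * s))
          = ennreal (\<epsilon> * (?S * R powr (2 - 2 * s) / (2 - 2 * s)) + M * (?S * R powr (- 2 * s) / (2 * s)))"
          by (rule ennreal_sum_of_products) (use s \<epsilon>(1) S M0 in auto)
        have s': "0 < s" "s < 1" using s by auto
        show ?thesis
          unfolding nn_integral_kernel_tail[OF s'(1) R(1)] nn_integral_kernel_core[OF s'(2) R(1)]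
            Q[OF s'(2) R(1)] add.assoc C
          by (rule ennreal_plus[symmetric]) (use s \<epsilon>(1) S M0 c in auto)
      qed
      finally have "ennreal (1 - s) * kernel_energy s \<omega> \<le> ennreal (1 - s) * ennreal (c * R powr (2 - 2 * s) / (1 - s)
          + \<epsilon> * (?S * R powr (2 - 2 * s) / (2 - 2 * s)) + M * (?S * R powr (- 2 * s) / (2 * s)))"
        by (rule mult_left_mono) simp
      also have "\<dots> = ennreal ((1 - s) * (c * R powr (2 - 2 * s) / (1 - s)
          + \<epsilon> * (?S * R powr (2 - 2 * s) / (2 - 2 * s)) + M * (?S * R powr (- 2 * s) / (2 * s))))"
        using s by (simp add: ennreal_mult')
      also have "(1 - s) * (c * R powr (2 - 2 * s) / (1 - s)
          + \<epsilon> * (?S * R powr (2 - 2 * s) / (2 - 2 * s)) + M * (?S * R powr (- 2 * s) / (2 * s)))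
        = (c + \<epsilon> * ?S / 2) * R powr (2 - 2 * s) + (1 - s) * (M * (?S * R powr (- 2 * s) / (2 * s)))"
      proof -
        have "(1 - s) * (x / (1 - s)) = x" "(1 - s) * (y / (2 - 2 * s)) = y / 2" for x y
          using s by (auto simp: field_simps)
        from this(1)[of "c * R powr (2 - 2 * s)"] this(2)[of "\<epsilon> * (?S * R powr (2 - 2 * s))"]
        show ?thesis by (simp add: distrib_left distrib_right mult_ac)
      qed
      finally show ?thesis .
    qed
    have "((\<lambda>s. (c + \<epsilon> * ?S / 2) * R powr (2 - 2 * s) + (1 - s) * (M * (?S * R powr (- 2 * s) / (2 * s))))
        \<longlongrightarrow> (c + \<epsilon> * ?S / 2) * R powr (2 - 2 * 1) + (1 - 1) * (M * (?S * R powr (- 2 * 1) / (2 * 1)))) (at_left 1)"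
      using R(1) by (intro tendsto_intros) auto
    moreover have "(c + \<epsilon> * ?S / 2) * R powr (2 - 2 * 1) + (1 - 1) * (M * (?S * R powr (- 2 * 1) / (2 * 1))) < c + e"
      using R(1) \<epsilon> e by (simp add: field_simps)
    ultimately have "eventually (\<lambda>s. (c + \<epsilon> * ?S / 2) * R powr (2 - 2 * s)
        + (1 - s) * (M * (?S * R powr (- 2 * s) / (2 * s))) < c + e) (at_left 1)"
      by (rule order_tendstoD)
    with ev show "eventually (\<lambda>s. ennreal (1 - s) * kernel_energy s \<omega> \<le> ennreal (c + e)) (at_left 1)"
      by eventually_elim (rule order_trans[OF up ennreal_leI], auto)
    have low: "ennreal ((c - \<epsilon> * ?S / 2) * R powr (2 - 2 * s)) \<le> ennreal (1 - s) * kernel_energy s \<omega>"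
      if s: "0 < s \<and> s < 1" for s
    proof -
      have pt: "?Q s h \<le> ennreal (\<omega> h / norm h powr (?n + 2 * s)) + ennreal \<epsilon> * ?C s h" for h :: 'a
      proof (cases "norm h \<le> R")
        case True
        then have "Q h \<le> \<omega> h + \<epsilon> * (norm h)\<^sup>2" using R(2)[of h] by linarith
        then have "Q h / norm h powr (?n + 2 * s)
            \<le> \<omega> h / norm h powr (?n + 2 * s) + \<epsilon> * ((norm h)\<^sup>2 / norm h powr (?n + 2 * s))"
          using divide_right_mono[of "Q h" "\<omega> h + \<epsilon> * (norm h)\<^sup>2" "norm h powr (?n + 2 * s)"]
          by (simp add: add_divide_distrib)
        then show ?thesis using True \<epsilon>(1) nn(1)[of h]
          by (simp add: ennreal_mult'[symmetric] ennreal_plus[symmetric] ennreal_leI del: ennreal_plus)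
      qed simp
      have "ennreal (c * R powr (2 - 2 * s) / (1 - s)) = (\<integral>\<^sup>+h. ?Q s h \<partial>lborel)"
        using s R(1) by (simp add: Q)
      also have "\<dots> \<le> (\<integral>\<^sup>+h. ennreal (\<omega> h / norm h powr (?n + 2 * s)) + ennreal \<epsilon> * ?C s h \<partial>lborel)"
        by (rule nn_integral_mono) (rule pt)
      also have "\<dots> = kernel_energy s \<omega> + ennreal \<epsilon> * (\<integral>\<^sup>+h. ?C s h \<partial>lborel)"
        unfolding kernel_energy_def by (simp add: nn_integral_add nn_integral_cmult)
      also have "ennreal \<epsilon> * (\<integral>\<^sup>+h. ?C s h \<partial>lborel) = ennreal (\<epsilon> * (?S * R powr (2 - 2 * s) / (2 - 2 * s)))"
      proof -
        have "s < 1" "0 \<le> \<epsilon>" using s \<epsilon>(1) by auto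
        then show ?thesis by (simp only: nn_integral_kernel_core R(1) ennreal_mult')
      qed
      finally have "ennreal (c * R powr (2 - 2 * s) / (1 - s)) - ennreal (\<epsilon> * (?S * R powr (2 - 2 * s) / (2 - 2 * s)))
          \<le> kernel_energy s \<omega>"
        by (simp add: ennreal_minus_le_iff add.commute)
      then have "ennreal (c * R powr (2 - 2 * s) / (1 - s) - \<epsilon> * (?S * R powr (2 - 2 * s) / (2 - 2 * s))) \<le> kernel_energy s \<omega>"
        using s S \<epsilon>(1) by (subst ennreal_minus[symmetric]) auto
      then have "ennreal (1 - s) * ennreal (c * R powr (2 - 2 * s) / (1 - s) - \<epsilon> * (?S * R powr (2 - 2 * s) / (2 - 2 * s)))
          \<le> ennreal (1 - s) * kernel_energy s \<omega>"
        by (rule mult_left_mono) simp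
      moreover have "ennreal (1 - s) * ennreal (c * R powr (2 - 2 * s) / (1 - s) - \<epsilon> * (?S * R powr (2 - 2 * s) / (2 - 2 * s)))
          = ennreal ((1 - s) * (c * R powr (2 - 2 * s) / (1 - s) - \<epsilon> * (?S * R powr (2 - 2 * s) / (2 - 2 * s))))"
        using s by (simp add: ennreal_mult')
      moreover have "(1 - s) * (c * R powr (2 - 2 * s) / (1 - s) - \<epsilon> * (?S * R powr (2 - 2 * s) / (2 - 2 * s)))
          = (c - \<epsilon> * ?S / 2) * R powr (2 - 2 * s)"
      proof -
        have "(1 - s) * (x / (1 - s)) = x" "(1 - s) * (y / (2 - 2 * s)) = y / 2" for x y
          using s by (auto simp: field_simps)
        from this(1)[of "c * R powr (2 - 2 * s)"] this(2)[of "\<epsilon> * (?S * R powr (2 - 2 * s))"]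
        show ?thesis by (simp add: right_diff_distrib left_diff_distrib mult_ac)
      qed
      ultimately show ?thesis by simp
    qed
    have "((\<lambda>s. (c - \<epsilon> * ?S / 2) * R powr (2 - 2 * s))
        \<longlongrightarrow> (c - \<epsilon> * ?S / 2) * R powr (2 - 2 * 1)) (at_left 1)"
      using R(1) by (intro tendsto_intros) auto
    moreover have "c - e < (c - \<epsilon> * ?S / 2) * R powr (2 - 2 * 1)"
      using R(1) \<epsilon> e by (simp add: field_simps)
    ultimately have "eventually (\<lambda>s. c - e < (c - \<epsilon> * ?S / 2) * R powr (2 - 2 * s)) (at_left 1)"
      by (rule order_tendstoD)
    with ev show "eventually (\<lambda>s. ennreal (c - e) \<le> ennreal (1 - s) * kernel_energy s \<omega>) (at_left 1)"
      by eventually_elim (rule order_trans[OF ennreal_leI low], auto)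
  qed
qed

section \<open>The Gagliardo energy as a kernel integral\<close>

lemma nn_integral_translate:
  fixes f :: "'a::euclidean_space \<Rightarrow> ennreal"
  assumes "f \<in> borel_measurable borel"
  shows "(\<integral>\<^sup>+x. f (h + x) \<partial>lborel) = integral\<^sup>N lborel f"
proof -
  have "integral\<^sup>N (distr lborel borel ((+) h)) f = (\<integral>\<^sup>+x. f (h + x) \<partial>lborel)"
    by (rule nn_integral_distr) (use assms in auto)
  then show ?thesis by (simp add: lborel_distr_plus)
qed

lemma nn_integral_sqnorm:
  assumes "square_integrable f"
  shows "(\<integral>\<^sup>+x. ennreal ((f x)\<^sup>2) \<partial>lborel) = ennreal (sqnorm f)"
  unfolding sqnorm_def
  by (rule nn_integral_eq_integral) (use assms in \<open>auto simp: square_integrable_integrable\<close>)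

lemma gagliardo_integral_eq_kernel_energy:
  fixes u :: "'a::euclidean_space \<Rightarrow> real"
  assumes u: "square_integrable u"
  shows "(\<integral>\<^sup>+(x, y). ennreal (\<bar>u x - u y\<bar>\<^sup>2 / norm (x - y) powr (real DIM('a) + 2 * s)) \<partial>lborel)
    = kernel_energy s (translation_sqdiff u)"
proof -
  let ?p = "real DIM('a) + 2 * s"
  have um [measurable]: "u \<in> borel_measurable borel" by (rule square_integrable_measurable[OF u])
  let ?F = "\<lambda>x y. ennreal (\<bar>u x - u y\<bar>\<^sup>2 / norm (x - y) powr ?p)"
  have "(\<integral>\<^sup>+(x, y). ?F x y \<partial>lborel) = (\<integral>\<^sup>+(x, y). ?F x y \<partial>(lborel \<Otimes>\<^sub>M lborel))"
    by (simp only: lborel_prod)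
  also have "\<dots> = (\<integral>\<^sup>+x. \<integral>\<^sup>+y. ?F x y \<partial>lborel \<partial>lborel)"
    by (subst lborel.nn_integral_fst[symmetric]) auto
  also have "\<dots> = (\<integral>\<^sup>+x. \<integral>\<^sup>+h. ?F x (x + h) \<partial>lborel \<partial>lborel)"
    by (intro nn_integral_cong nn_integral_translate[symmetric]) measurable
  also have "\<dots> = (\<integral>\<^sup>+h. \<integral>\<^sup>+x. ?F x (x + h) \<partial>lborel \<partial>lborel)"
    by (rule lborel_pair.Fubini'[symmetric]) measurable
  also have "\<dots> = kernel_energy s (translation_sqdiff u)"
    unfolding kernel_energy_def
  proof (rule nn_integral_cong)
    fix h :: 'a
    have "(\<integral>\<^sup>+x. ?F x (x + h) \<partial>lborel)
        = (\<integral>\<^sup>+x. ennreal ((u (x + h) - u x)\<^sup>2) * ennreal (1 / norm h powr ?p) \<partial>lborel)"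
      by (intro nn_integral_cong) (simp add: ennreal_mult'[symmetric] power2_commute)
    also have "\<dots> = ennreal (translation_sqdiff u h) * ennreal (1 / norm h powr ?p)"
      by (subst nn_integral_multc)
         (auto simp: translation_sqdiff_def nn_integral_sqnorm square_integrable_translation_diff[OF u])
    finally show "(\<integral>\<^sup>+x. ?F x (x + h) \<partial>lborel) = ennreal (translation_sqdiff u h / norm h powr ?p)"
      by (simp add: ennreal_mult'[symmetric] translation_sqdiff_nonneg)
  qed
  finally show ?thesis .
qed

lemma second_moment_over_ball:
  fixes a :: "real ^ 'n::finite"
  assumes s: "s < 1" and R: "R > 0"
  shows "(\<integral>\<^sup>+h. ennreal ((h \<bullet> a)\<^sup>2 / norm h powr (real CARD('n) + 2 * s)) * indicator {h. norm h \<le> R} h \<partial>lborel)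
    = ennreal ((norm a)\<^sup>2 / real CARD('n) * (sphere_area TYPE(real ^ 'n) * R powr (2 - 2 * s) / (2 - 2 * s)))"
proof -
  define w where "w r = indicator {..R} r / r powr (real CARD('n) + 2 * s)" for r :: real
  have w [measurable]: "w \<in> borel_measurable borel" unfolding w_def by measurable
  have w0: "0 \<le> w r" for r by (simp add: w_def)
  let ?I = "sphere_area TYPE(real ^ 'n) * R powr (2 - 2 * s) / (2 - 2 * s)"
  have I0: "0 \<le> ?I" using s by (simp add: sphere_area_nonneg)
  have "(\<integral>\<^sup>+h. ennreal ((norm h)\<^sup>2 * w (norm h)) \<partial>(lborel :: (real ^ 'n) measure))
      = (\<integral>\<^sup>+h. ennreal ((norm h)\<^sup>2 / norm h powr (real DIM(real ^ 'n) + 2 * s))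
          * indicator {h. norm h \<le> R} h \<partial>(lborel :: (real ^ 'n) measure))"
    by (intro nn_integral_cong) (simp add: w_def indicator_def)
  also have "\<dots> = ennreal ?I" by (rule nn_integral_kernel_core[OF s R])
  finally have I: "(\<integral>\<^sup>+h. ennreal ((norm h)\<^sup>2 * w (norm h)) \<partial>(lborel :: (real ^ 'n) measure)) = ennreal ?I" .
  have "has_bochner_integral (lborel :: (real ^ 'n) measure) (\<lambda>h. (norm h)\<^sup>2 * w (norm h)) ?I"
    by (rule has_bochner_integral_nn_integral[OF _ _ I0 I]) (auto simp: w0)
  then have int: "integrable (lborel :: (real ^ 'n) measure) (\<lambda>h. (norm h)\<^sup>2 * w (norm h))"
    and val: "integral\<^sup>L (lborel :: (real ^ 'n) measure) (\<lambda>h. (norm h)\<^sup>2 * w (norm h)) = ?I"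
    by (auto simp: has_bochner_integral_iff)
  have "(\<integral>\<^sup>+h. ennreal ((h \<bullet> a)\<^sup>2 / norm h powr (real CARD('n) + 2 * s)) * indicator {h. norm h \<le> R} h \<partial>lborel)
      = (\<integral>\<^sup>+h. ennreal ((h \<bullet> a)\<^sup>2 * w (norm h)) \<partial>lborel)"
    by (intro nn_integral_cong) (simp add: w_def indicator_def)
  also have "\<dots> = ennreal (\<integral>h. (h \<bullet> a)\<^sup>2 * w (norm h) \<partial>lborel)"
    by (rule nn_integral_eq_integral[OF radial_second_moments(1)[OF w int]]) (simp add: w0)
  also have "\<dots> = ennreal ((norm a)\<^sup>2 / real CARD('n) * ?I)"
    unfolding radial_second_moments(2)[OF w int] val ..
  finally show ?thesis .
qed

lemma borel_measurable_vec_components: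
  fixes g :: "real ^ 'n::finite \<Rightarrow> real ^ 'n"
  assumes "\<And>i. (\<lambda>x. g x $ i) \<in> borel_measurable borel"
  shows "g \<in> borel_measurable borel"
  using assms by (subst borel_measurable_euclidean_space) (auto simp: Basis_vec_def inner_axis)

lemma sqnorm_inner_measurable:
  fixes g :: "real ^ 'n::finite \<Rightarrow> real ^ 'n"
  assumes [measurable]: "g \<in> borel_measurable borel"
  shows "(\<lambda>h. sqnorm (\<lambda>x. h \<bullet> g x)) \<in> borel_measurable borel"
  unfolding sqnorm_def
  by (rule lborel.borel_measurable_lebesgue_integral) measurable

text \<open>Exchanging the integrals over \<open>h\<close> and \<open>x\<close> leaves, for each \<open>x\<close>, the second moment of the kernel in
the direction of \<open>g x\<close>.\<close>

lemma averaged_directional_energy: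
  fixes g :: "real ^ 'n::finite \<Rightarrow> real ^ 'n"
  assumes g: "\<And>i. square_integrable (\<lambda>x. g x $ i)" and s: "s < 1" and R: "R > 0"
  shows "(\<integral>\<^sup>+h. ennreal (sqnorm (\<lambda>x. h \<bullet> g x) / norm h powr (real CARD('n) + 2 * s))
      * indicator {h. norm h \<le> R} h \<partial>lborel)
    = ennreal (sphere_area TYPE(real ^ 'n) / (2 * real CARD('n)) * (\<Sum>i\<in>UNIV. sqnorm (\<lambda>x. g x $ i))
        * R powr (2 - 2 * s) / (1 - s))"
proof -
  let ?p = "real CARD('n) + 2 * s"
  let ?I = "sphere_area TYPE(real ^ 'n) * R powr (2 - 2 * s) / (2 - 2 * s)"
  have I0: "0 \<le> ?I" using s by (simp add: sphere_area_nonneg)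
  have gm [measurable]: "g \<in> borel_measurable borel"
    by (rule borel_measurable_vec_components[OF square_integrable_measurable[OF g]])
  have sq: "(norm y)\<^sup>2 = (\<Sum>i\<in>UNIV. (y $ i)\<^sup>2)" for y :: "real ^ 'n"
    unfolding power2_norm_eq_inner inner_vec_sum by (simp add: power2_eq_square)
  have "(\<integral>\<^sup>+h. ennreal (sqnorm (\<lambda>x. h \<bullet> g x) / norm h powr ?p) * indicator {h. norm h \<le> R} h \<partial>lborel)
      = (\<integral>\<^sup>+h. \<integral>\<^sup>+x. ennreal ((h \<bullet> g x)\<^sup>2 / norm h powr ?p) * indicator {h. norm h \<le> R} h \<partial>lborel \<partial>lborel)"
  proof (rule nn_integral_cong)
    fix h :: "real ^ 'n"
    have hm: "(\<lambda>x. ennreal ((h \<bullet> g x)\<^sup>2)) \<in> borel_measurable lborel"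
      by measurable
    have "(\<integral>\<^sup>+x. ennreal ((h \<bullet> g x)\<^sup>2 / norm h powr ?p) * indicator {h. norm h \<le> R} h \<partial>lborel)
        = (\<integral>\<^sup>+x. ennreal ((h \<bullet> g x)\<^sup>2) * (ennreal (1 / norm h powr ?p) * indicator {h. norm h \<le> R} h) \<partial>lborel)"
      by (intro nn_integral_cong) (simp add: ennreal_mult'[symmetric] mult.assoc[symmetric])
    also have "\<dots> = ennreal (sqnorm (\<lambda>x. h \<bullet> g x)) * (ennreal (1 / norm h powr ?p) * indicator {h. norm h \<le> R} h)"
      by (subst nn_integral_multc[OF hm]) (simp add: nn_integral_sqnorm square_integrable_inner[OF g])
    also have "\<dots> = ennreal (sqnorm (\<lambda>x. h \<bullet> g x) / norm h powr ?p) * indicator {h. norm h \<le> R} h"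
      by (simp add: ennreal_mult'[symmetric] mult.assoc[symmetric] sqnorm_nonneg)
    finally show "ennreal (sqnorm (\<lambda>x. h \<bullet> g x) / norm h powr ?p) * indicator {h. norm h \<le> R} h
        = (\<integral>\<^sup>+x. ennreal ((h \<bullet> g x)\<^sup>2 / norm h powr ?p) * indicator {h. norm h \<le> R} h \<partial>lborel)" ..
  qed
  also have "\<dots> = (\<integral>\<^sup>+x. \<integral>\<^sup>+h. ennreal ((h \<bullet> g x)\<^sup>2 / norm h powr ?p) * indicator {h. norm h \<le> R} h \<partial>lborel \<partial>lborel)"
    by (rule lborel_pair.Fubini') measurable
  also have "\<dots> = (\<integral>\<^sup>+x. ennreal ((norm (g x))\<^sup>2 / real CARD('n) * ?I) \<partial>lborel)"
    by (simp only: second_moment_over_ball[OF s R])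
  also have "\<dots> = ennreal (\<integral>x. (norm (g x))\<^sup>2 / real CARD('n) * ?I \<partial>lborel)"
  proof (rule nn_integral_eq_integral)
    show "integrable lborel (\<lambda>x. (norm (g x))\<^sup>2 / real CARD('n) * ?I)"
      unfolding sq using g by (intro integrable_mult_left integrable_divide Bochner_Integration.integrable_sum)
        (auto simp: square_integrable_integrable)
    show "AE x in lborel. 0 \<le> (norm (g x))\<^sup>2 / real CARD('n) * ?I"
      by (intro AE_I2 mult_nonneg_nonneg I0) simp
  qed
  also have "(\<integral>x. (norm (g x))\<^sup>2 / real CARD('n) * ?I \<partial>lborel)
      = (\<Sum>i\<in>UNIV. sqnorm (\<lambda>x. g x $ i)) / real CARD('n) * ?I"
    unfolding sq using g by (simp add: sqnorm_def square_integrable_integrable)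
  also have "\<dots> = sphere_area TYPE(real ^ 'n) / (2 * real CARD('n)) * (\<Sum>i\<in>UNIV. sqnorm (\<lambda>x. g x $ i))
        * R powr (2 - 2 * s) / (1 - s)"
    using s by (simp add: field_simps)
  finally show ?thesis .
qed

theorem gagliardo_limit_at_0:
  fixes u :: "real ^ 'n::finite \<Rightarrow> real"
  assumes u: "square_integrable u" and s0: "s0 > 0"
    and fin: "kernel_energy s0 (translation_sqdiff u) < \<infinity>"
  shows "((\<lambda>s. ennreal s * kernel_energy s (translation_sqdiff u)) \<longlongrightarrow>
           ennreal (sphere_area TYPE(real ^ 'n) * sqnorm u)) (at_right 0)"
  using kernel_energy_tendsto_at_0[OF translation_sqdiff_measurable[OF u] translation_sqdiff_nonneg
      translation_sqdiff_at_infinity[OF u] s0 fin] by (simp add: mult.assoc[symmetric])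

theorem gagliardo_limit_at_1:
  fixes u :: "real ^ 'n::finite \<Rightarrow> real"
  assumes ug: "has_L2_gradient u g"
  shows "((\<lambda>s. ennreal (1 - s) * kernel_energy s (translation_sqdiff u)) \<longlongrightarrow>
           ennreal (sphere_area TYPE(real ^ 'n) / (2 * real CARD('n)) * (\<Sum>i\<in>UNIV. sqnorm (\<lambda>x. g x $ i))))
         (at_left 1)"
proof -
  have u: "square_integrable u" and g: "\<And>i. square_integrable (\<lambda>x. g x $ i)"
    using ug unfolding has_L2_gradient_def by blast+
  show ?thesis
  proof (rule kernel_energy_tendsto_at_1[where Q = "\<lambda>h. sqnorm (\<lambda>x. h \<bullet> g x)" and M = "4 * sqnorm u"])
    show "(\<lambda>h. sqnorm (\<lambda>x. h \<bullet> g x)) \<in> borel_measurable borel"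
      by (rule sqnorm_inner_measurable[OF borel_measurable_vec_components[OF square_integrable_measurable[OF g]]])
    show "\<exists>\<delta>>0. \<forall>h. norm h < \<delta> \<longrightarrow> \<bar>translation_sqdiff u h - sqnorm (\<lambda>x. h \<bullet> g x)\<bar> \<le> e * (norm h)\<^sup>2"
      if "e > 0" for e
      using translation_sqdiff_second_order[OF ug that] by metis
    show "0 \<le> sphere_area TYPE(real ^ 'n) / (2 * real CARD('n)) * (\<Sum>i\<in>UNIV. sqnorm (\<lambda>x. g x $ i))"
      by (intro mult_nonneg_nonneg divide_nonneg_nonneg sphere_area_nonneg sum_nonneg sqnorm_nonneg) auto
    show "(\<integral>\<^sup>+h. ennreal (sqnorm (\<lambda>x. h \<bullet> g x) / norm h powr (real DIM(real ^ 'n) + 2 * s))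
        * indicator {h. norm h \<le> R} h \<partial>lborel)
      = ennreal (sphere_area TYPE(real ^ 'n) / (2 * real CARD('n)) * (\<Sum>i\<in>UNIV. sqnorm (\<lambda>x. g x $ i))
          * R powr (2 - 2 * s) / (1 - s))" if "s < 1" "R > 0" for s R
      using averaged_directional_energy[OF g that] by simp
  qed (use u in \<open>auto intro: translation_sqdiff_measurable translation_sqdiff_nonneg translation_sqdiff_le sqnorm_nonneg\<close>)
qed

section \<open>Representatives of weak derivatives\<close>

lemma L2_fun_borel_representative:
  assumes "L2_fun v"
  obtains u where "square_integrable u" "AE x in lborel. v x = u x"
proof -
  obtain u where u [measurable]: "u \<in> borel_measurable lborel" and eq: "AE x in lborel. v x = u x"
    using assms completion_ex_borel_measurable_real[of v lborel] unfolding L2_fun_def by auto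
  have "integrable lebesgue (\<lambda>x. (u x)\<^sup>2)"
  proof (rule integrable_cong_AE_imp)
    show "integrable lebesgue (\<lambda>x. (v x)\<^sup>2)" using assms by (simp add: L2_fun_def)
    show "(\<lambda>x. (u x)\<^sup>2) \<in> borel_measurable lebesgue" by (rule measurable_completion) measurable
    show "AE x in lebesgue. (v x)\<^sup>2 = (u x)\<^sup>2"
      by (rule AE_completion) (use eq in eventually_elim, simp)
  qed
  then have "integrable lborel (\<lambda>x. (u x)\<^sup>2)"
    by (subst (asm) integrable_completion) measurable
  then have "square_integrable u" using u by (simp add: square_integrable_def)
  then show ?thesis using eq that by blast
qed

lemma integral_lebesgue_mult_representative:
  fixes v u \<phi> :: "'a::euclidean_space \<Rightarrow> real"
  assumes v: "v \<in> borel_measurable lebesgue" and u: "u \<in> borel_measurable borel"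
    and eq: "AE x in lborel. v x = u x" and \<phi>: "\<phi> \<in> borel_measurable borel"
  shows "integral\<^sup>L lebesgue (\<lambda>x. v x * \<phi> x) = (\<integral>x. u x * \<phi> x \<partial>lborel)"
proof -
  have m: "(\<lambda>x. u x * \<phi> x) \<in> borel_measurable lborel" using u \<phi> by simp
  have "\<phi> \<in> borel_measurable lebesgue" 
    by (rule measurable_completion) (use \<phi> in simp)
  then have "(\<lambda>x. v x * \<phi> x) \<in> borel_measurable lebesgue"
    using v by (rule borel_measurable_times[rotated])
  moreover have "AE x in lebesgue. v x * \<phi> x = u x * \<phi> x"
    using AE_completion[OF eq] by eventually_elim simp
  ultimately have "integral\<^sup>L lebesgue (\<lambda>x. v x * \<phi> x) = integral\<^sup>L lebesgue (\<lambda>x. u x * \<phi> x)"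
    by (rule integral_cong_AE[OF _ measurable_completion[OF m]])
  also have "\<dots> = (\<integral>x. u x * \<phi> x \<partial>lborel)" by (rule integral_completion[OF m])
  finally show ?thesis .
qed

lemma integral_lebesgue_square_representative:
  assumes v: "L2_fun v" and u: "square_integrable u" and eq: "AE x in lborel. v x = u x"
  shows "integral\<^sup>L lebesgue (\<lambda>x. \<bar>v x\<bar>\<^sup>2) = sqnorm u"
proof -
  have m: "(\<lambda>x. (u x)\<^sup>2) \<in> borel_measurable lborel"
    using square_integrable_measurable[OF u] by simp
  have "integral\<^sup>L lebesgue (\<lambda>x. \<bar>v x\<bar>\<^sup>2) = integral\<^sup>L lebesgue (\<lambda>x. (u x)\<^sup>2)"
  proof (rule integral_cong_AE[OF _ measurable_completion[OF m]])
    show "(\<lambda>x. \<bar>v x\<bar>\<^sup>2) \<in> borel_measurable lebesgue"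
      using v by (auto simp: L2_fun_def intro: borel_measurable_power)
    show "AE x in lebesgue. \<bar>v x\<bar>\<^sup>2 = (u x)\<^sup>2"
      using AE_completion[OF eq] by eventually_elim simp
  qed
  also have "\<dots> = sqnorm u" unfolding sqnorm_def by (rule integral_completion[OF m])
  finally show ?thesis .
qed

text \<open>The two integrands differ only where one of the two coordinates lies in the null set on which \<open>v\<close>
and \<open>u\<close> differ, which is a null set in the product.\<close>

lemma gagliardo_integral_representative:
  fixes v :: "'a::euclidean_space \<Rightarrow> real"
  assumes u: "square_integrable u" and eq: "AE x in lborel. v x = u x"
  shows "(\<integral>\<^sup>+(x, y). ennreal (\<bar>v x - v y\<bar>\<^sup>2 / norm (x - y) powr (real DIM('a) + 2 * s)) \<partial>lebesgue)
    = kernel_energy s (translation_sqdiff u)"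
proof -
  obtain N where N: "N \<in> null_sets lborel" "\<And>x. x \<notin> N \<Longrightarrow> v x = u x"
    using eq by (auto elim!: AE_E3)
  have "N \<times> UNIV \<in> null_sets (lborel \<Otimes>\<^sub>M lborel :: ('a \<times> 'a) measure)"
    using lborel.times_in_null_sets1[OF N(1), of UNIV] by simp
  moreover have "UNIV \<times> N \<in> null_sets (lborel \<Otimes>\<^sub>M lborel :: ('a \<times> 'a) measure)"
    using lborel.times_in_null_sets2[OF _ N(1), of UNIV lborel] by simp
  ultimately have "AE z in (lborel :: ('a \<times> 'a) measure). z \<notin> N \<times> UNIV \<and> z \<notin> UNIV \<times> N"
    by (auto simp only: lborel_prod intro: AE_not_in AE_conjI)
  then have ae: "AE z in (lborel :: ('a \<times> 'a) measure). v (fst z) = u (fst z) \<and> v (snd z) = u (snd z)"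
    by eventually_elim (use N(2) in \<open>auto simp: mem_Times_iff\<close>)
  show ?thesis
    unfolding nn_integral_completion gagliardo_integral_eq_kernel_energy[OF u, symmetric]
    by (rule nn_integral_cong_AE) (use ae in eventually_elim, simp add: case_prod_beta)
qed

lemma has_weak_deriv_weak_deriv:
  "\<exists>w. has_weak_deriv \<alpha> v w \<Longrightarrow> has_weak_deriv \<alpha> v (weak_deriv \<alpha> v)"
  unfolding weak_deriv_def by (rule someI_ex[of "has_weak_deriv \<alpha> v"])

lemma multi_partial_axis:
  assumes "smooth \<phi>"
  shows "multi_partial (axis i 1) \<phi> = partial_deriv i \<phi>"
  using multi_partial_eq[OF assms, of "[i]" "axis i 1"] by (simp add: axis_def)

lemma multi_partial_add_axis:
  fixes \<alpha> :: "nat ^ 'n::finite"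
  assumes "smooth \<phi>"
  shows "multi_partial (\<alpha> + axis i 1) \<phi> = multi_partial \<alpha> (partial_deriv i \<phi>)"
proof -
  obtain js where js: "\<And>k. count (mset js) k = \<alpha> $ k" using multi_index_list_exists[of \<alpha>] by blast
  have "multi_partial (\<alpha> + axis i 1) \<phi> = foldr partial_deriv (js @ [i]) \<phi>"
    by (rule multi_partial_eq[OF assms]) (simp add: js axis_def)
  also have "\<dots> = multi_partial \<alpha> (partial_deriv i \<phi>)"
    by (simp add: multi_partial_eq[OF smooth_partial_deriv[OF assms] js])
  finally show ?thesis .
qed

lemma mi_abs_axis: "mi_abs (axis i 1) = 1"
  by (simp add: mi_abs_def axis_def)

lemma mi_abs_add_axis: "mi_abs (\<alpha> + axis i 1) = mi_abs \<alpha> + 1"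
  by (simp add: mi_abs_def sum.distrib axis_def)

text \<open>Use \<open>\<partial>\<^sub>i \<phi>\<close> as a test function in the definition of \<open>\<partial>\<^sup>\<alpha> v\<close>. The representative \<open>w\<close> is arbitrary, so the
gradient of a chosen weak derivative is available for every choice.\<close>

lemma weak_deriv_of_weak_deriv:
  fixes v :: "real ^ 'n::finite \<Rightarrow> real"
  assumes w: "has_weak_deriv \<alpha> v w" and g: "has_weak_deriv (\<alpha> + axis i 1) v g"
  shows "has_weak_deriv (axis i 1) w g"
  unfolding has_weak_deriv_def
proof (intro conjI allI impI)
  show "L2_fun w" "L2_fun g" using w g by (auto simp: has_weak_deriv_def)
  fix \<phi> :: "real ^ 'n \<Rightarrow> real" assume \<phi>: "test_function \<phi>"
  have sm: "smooth \<phi>" by (rule test_function_smooth[OF \<phi>])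
  have "integral\<^sup>L lebesgue (\<lambda>x. v x * multi_partial \<alpha> (partial_deriv i \<phi>) x)
      = (-1) ^ mi_abs \<alpha> * integral\<^sup>L lebesgue (\<lambda>x. w x * partial_deriv i \<phi> x)"
    using w test_function_partial_deriv[OF \<phi>] by (simp add: has_weak_deriv_def)
  moreover have "integral\<^sup>L lebesgue (\<lambda>x. v x * multi_partial \<alpha> (partial_deriv i \<phi>) x)
      = (-1) ^ (mi_abs \<alpha> + 1) * integral\<^sup>L lebesgue (\<lambda>x. g x * \<phi> x)"
    using g \<phi> unfolding has_weak_deriv_def mi_abs_add_axis multi_partial_add_axis[OF sm, symmetric] by blast
  ultimately have "(-1) ^ mi_abs \<alpha> * integral\<^sup>L lebesgue (\<lambda>x. w x * partial_deriv i \<phi> x)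
      = (-1) ^ mi_abs \<alpha> * (- integral\<^sup>L lebesgue (\<lambda>x. g x * \<phi> x))" by simp
  then have "integral\<^sup>L lebesgue (\<lambda>x. w x * partial_deriv i \<phi> x) = - integral\<^sup>L lebesgue (\<lambda>x. g x * \<phi> x)"
    by (subst (asm) mult_cancel_left) simp
  then show "integral\<^sup>L lebesgue (\<lambda>x. w x * multi_partial (axis i 1) \<phi> x)
      = (-1) ^ mi_abs (axis i 1 :: nat ^ 'n) * integral\<^sup>L lebesgue (\<lambda>x. g x * \<phi> x)"
    by (simp add: multi_partial_axis[OF sm] mi_abs_axis del: One_nat_def)
qed

text \<open>Passing to Borel representatives of \<open>w\<close> and of all its first derivatives does not affect the integrals
against test functions.\<close>

lemma has_L2_gradient_representative:
  fixes w :: "real ^ 'n::finite \<Rightarrow> real"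
  assumes g: "\<And>i. has_weak_deriv (axis i 1) w (g i)"
    and u: "square_integrable u" "AE x in lborel. w x = u x"
  obtains G where "has_L2_gradient u G" "\<And>i. AE x in lborel. g i x = G x $ i"
proof -
  have "\<exists>Gi. square_integrable Gi \<and> (AE x in lborel. g i x = Gi x)" for i
    using g[of i] L2_fun_borel_representative[of "g i"] unfolding has_weak_deriv_def by metis
  then obtain H where H: "\<And>i. square_integrable (H i)" "\<And>i. AE x in lborel. g i x = H i x"
    by metis
  define G where "G x = (\<chi> i. H i x)" for x
  have "has_L2_gradient u G"
    unfolding has_L2_gradient_def
  proof (intro conjI allI impI)
    show "square_integrable u" by (rule u(1))
    show "square_integrable (\<lambda>x. G x $ i)" for i using H(1)[of i] by (simp add: G_def)
    fix \<phi> :: "real ^ 'n \<Rightarrow> real" and i assume \<phi>: "test_function \<phi>"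
    note test_m = square_integrable_measurable[OF test_function_square_integrable]
    have "integral\<^sup>L lebesgue (\<lambda>x. w x * partial_deriv i \<phi> x) = - integral\<^sup>L lebesgue (\<lambda>x. g i x * \<phi> x)"
    proof -
      have "integral\<^sup>L lebesgue (\<lambda>x. w x * multi_partial (axis i 1) \<phi> x)
          = (-1) ^ mi_abs (axis i 1 :: nat ^ 'n) * integral\<^sup>L lebesgue (\<lambda>x. g i x * \<phi> x)"
        using g[of i] \<phi> unfolding has_weak_deriv_def by blast
      then show ?thesis
        by (simp add: multi_partial_axis[OF test_function_smooth[OF \<phi>]] mi_abs_axis del: One_nat_def)
    qed
    moreover have "integral\<^sup>L lebesgue (\<lambda>x. w x * partial_deriv i \<phi> x) = (\<integral>x. u x * partial_deriv i \<phi> x \<partial>lborel)"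
      using g[of i] u test_m[OF test_function_partial_deriv[OF \<phi>]]
      by (intro integral_lebesgue_mult_representative)
         (auto simp: has_weak_deriv_def L2_fun_def square_integrable_measurable)
    moreover have "integral\<^sup>L lebesgue (\<lambda>x. g i x * \<phi> x) = (\<integral>x. H i x * \<phi> x \<partial>lborel)"
      using g[of i] H[of i] test_m[OF \<phi>]
      by (intro integral_lebesgue_mult_representative)
         (auto simp: has_weak_deriv_def L2_fun_def square_integrable_measurable)
    ultimately show "(\<integral>x. u x * partial_deriv i \<phi> x \<partial>lborel) = - (\<integral>x. G x $ i * \<phi> x \<partial>lborel)"
      by (simp add: G_def)
  qed
  then show ?thesis using H(2) by (intro that[of G]) (auto simp: G_def)
qed


section \<open>The limits of the fractional semi-norms\<close>

lemma sphere_area_vec: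
  "sphere_area TYPE(real ^ 'n::finite) = 2 * pi powr (real CARD('n) / 2) / Gamma (real CARD('n) / 2)"
proof -
  let ?n = "real CARD('n)"
  have n: "?n > 0" by simp
  have "?n / 2 \<notin> \<int>\<^sub>\<le>\<^sub>0"
  proof
    assume "?n / 2 \<in> \<int>\<^sub>\<le>\<^sub>0"
    then obtain m where "?n / 2 = of_int m" "m \<le> 0" by (elim nonpos_Ints_cases)
    then have "?n / 2 \<le> 0" by simp
    then show False using n by simp
  qed
  then have Gamma: "Gamma (?n / 2 + 1) = ?n / 2 * Gamma (?n / 2)" by (rule Gamma_plus1)
  have "sphere_area TYPE(real ^ 'n) = ?n * (pi powr (?n / 2) / Gamma (?n / 2 + 1))"
    by (simp add: sphere_area_def unit_ball_vol_def)
  also have "\<dots> = 2 * pi powr (?n / 2) / Gamma (?n / 2)"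
    unfolding Gamma using n by simp
  finally show ?thesis .
qed

lemma frac_seminorm_sq_eq_sum:
  assumes "\<And>\<alpha>. mi_abs \<alpha> = l \<Longrightarrow> square_integrable (U \<alpha>)"
    and "\<And>\<alpha>. mi_abs \<alpha> = l \<Longrightarrow> AE x in lborel. weak_deriv \<alpha> v x = U \<alpha> x"
  shows "frac_seminorm_sq l s v = (\<Sum>\<alpha> | mi_abs \<alpha> = l. kernel_energy s (translation_sqdiff (U \<alpha>)))"
  unfolding frac_seminorm_sq_def
proof (rule sum.cong)
  fix \<alpha> :: "nat ^ 'a" assume "\<alpha> \<in> {\<alpha>. mi_abs \<alpha> = l}"
  then show "(\<integral>\<^sup>+ (x, y). ennreal (\<bar>weak_deriv \<alpha> v x - weak_deriv \<alpha> v y\<bar>\<^sup>2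
        / norm (x - y) powr (real CARD('a) + 2 * s)) \<partial>lebesgue) = kernel_energy s (translation_sqdiff (U \<alpha>))"
    using gagliardo_integral_representative[OF assms(1) assms(2), of \<alpha> s] by simp
qed simp

theorem theorem4p6:
  fixes l :: nat
  shows
    "(\<forall>\<sigma>\<^sub>0 \<in> {0<..<1}. \<forall>v \<in> (sobolev_frac l \<sigma>\<^sub>0 :: (real ^ 'n::finite \<Rightarrow> real) set).
        ((\<lambda>\<sigma>. ennreal \<sigma> * frac_seminorm_sq l \<sigma> v) \<longlongrightarrow>
           ennreal (2 * pi powr (real CARD('n) / 2) / Gamma (real CARD('n) / 2) * (seminorm l v)\<^sup>2))
          (at_right 0)) \<and>
     (\<forall>v \<in> (sobolev (l + 1) :: (real ^ 'n \<Rightarrow> real) set).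
        ((\<lambda>\<sigma>. ennreal (1 - \<sigma>) * frac_seminorm_sq l \<sigma> v) \<longlongrightarrow>
           ennreal (pi powr (real CARD('n) / 2) / (real CARD('n) * Gamma (real CARD('n) / 2))
                      * (grad_seminorm l v)\<^sup>2))
          (at_left 1))"
proof (intro conjI ballI)
  let ?A = "{\<alpha> :: nat ^ 'n. mi_abs \<alpha> = l}"
  let ?S = "sphere_area TYPE(real ^ 'n)"
  have S: "0 \<le> ?S" by (rule sphere_area_nonneg)
  have representatives: "\<exists>U. \<forall>\<alpha>\<in>?A. square_integrable (U \<alpha>) \<and> (AE x in lborel. weak_deriv \<alpha> v x = U \<alpha> x)"
    if "v \<in> sobolev l" for v :: "real ^ 'n \<Rightarrow> real"
  proof (rule bchoice, rule ballI)
    fix \<alpha> assume "\<alpha> \<in> ?A"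
    then have "L2_fun (weak_deriv \<alpha> v)"
      using that has_weak_deriv_weak_deriv[of \<alpha> v] by (auto simp: sobolev_def has_weak_deriv_def)
    then show "\<exists>u. square_integrable u \<and> (AE x in lborel. weak_deriv \<alpha> v x = u x)"
      using L2_fun_borel_representative by metis
  qed
  {
    fix s0 :: real and v :: "real ^ 'n \<Rightarrow> real"
    assume s0: "s0 \<in> {0<..<1}" and v: "v \<in> sobolev_frac l s0"
    have vl: "v \<in> sobolev l" and fin: "frac_seminorm_sq l s0 v < \<infinity>"
      using v by (auto simp: sobolev_frac_def)
    obtain U where U: "\<And>\<alpha>. mi_abs \<alpha> = l \<Longrightarrow> square_integrable (U \<alpha>)"
      "\<And>\<alpha>. mi_abs \<alpha> = l \<Longrightarrow> AE x in lborel. weak_deriv \<alpha> v x = U \<alpha> x"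
      using representatives[OF vl] by auto
    have norm_eq: "(seminorm l v)\<^sup>2 = (\<Sum>\<alpha>\<in>?A. sqnorm (U \<alpha>))"
    proof -
      have "integral\<^sup>L lebesgue (\<lambda>x. \<bar>weak_deriv \<alpha> v x\<bar>\<^sup>2) = sqnorm (U \<alpha>)" if "\<alpha> \<in> ?A" for \<alpha>
        using that vl has_weak_deriv_weak_deriv[of \<alpha> v] U[of \<alpha>]
        by (intro integral_lebesgue_square_representative) (auto simp: sobolev_def has_weak_deriv_def)
      then have "(\<Sum>\<alpha>\<in>?A. integral\<^sup>L lebesgue (\<lambda>x. \<bar>weak_deriv \<alpha> v x\<bar>\<^sup>2)) = (\<Sum>\<alpha>\<in>?A. sqnorm (U \<alpha>))"
        by (rule sum.cong[OF refl])
      then show ?thesis by (simp add: seminorm_def sum_nonneg sqnorm_nonneg)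
    qed
    have sum_eq: "frac_seminorm_sq l s v = (\<Sum>\<alpha>\<in>?A. kernel_energy s (translation_sqdiff (U \<alpha>)))" for s
      by (rule frac_seminorm_sq_eq_sum) (use U in auto)
    have "((\<lambda>\<sigma>. \<Sum>\<alpha>\<in>?A. ennreal \<sigma> * kernel_energy \<sigma> (translation_sqdiff (U \<alpha>)))
        \<longlongrightarrow> (\<Sum>\<alpha>\<in>?A. ennreal (?S * sqnorm (U \<alpha>)))) (at_right 0)"
    proof (intro tendsto_sum gagliardo_limit_at_0)
      fix \<alpha> assume \<alpha>: "\<alpha> \<in> ?A"
      show "square_integrable (U \<alpha>)" using U(1) \<alpha> by simp
      show "0 < s0" using s0 by simp
      have "kernel_energy s0 (translation_sqdiff (U \<alpha>)) \<le> frac_seminorm_sq l s0 v"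
        unfolding sum_eq by (rule member_le_sum[OF \<alpha>]) (auto simp: finite_mi_abs_eq)
      then show "kernel_energy s0 (translation_sqdiff (U \<alpha>)) < \<infinity>" using fin by (rule le_less_trans)
    qed
    moreover have "(\<Sum>\<alpha>\<in>?A. ennreal (?S * sqnorm (U \<alpha>))) = ennreal (?S * (seminorm l v)\<^sup>2)"
      unfolding norm_eq sum_distrib_left by (rule sum_ennreal) (simp add: S sqnorm_nonneg)
    ultimately show "((\<lambda>\<sigma>. ennreal \<sigma> * frac_seminorm_sq l \<sigma> v) \<longlongrightarrow>
        ennreal (2 * pi powr (real CARD('n) / 2) / Gamma (real CARD('n) / 2) * (seminorm l v)\<^sup>2)) (at_right 0)"
      unfolding sphere_area_vec[symmetric] sum_eq sum_distrib_left by simp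
  next
    fix v :: "real ^ 'n \<Rightarrow> real" assume v: "v \<in> sobolev (l + 1)"
    have vl: "v \<in> sobolev l" using v by (auto simp: sobolev_def)
    let ?w = "\<lambda>\<alpha>. weak_deriv \<alpha> v"
    obtain U where U: "\<And>\<alpha>. mi_abs \<alpha> = l \<Longrightarrow> square_integrable (U \<alpha>)"
      "\<And>\<alpha>. mi_abs \<alpha> = l \<Longrightarrow> AE x in lborel. weak_deriv \<alpha> v x = U \<alpha> x"
      using representatives[OF vl] by auto
    have grad: "has_weak_deriv (axis i 1) (?w \<alpha>) (weak_deriv (axis i 1) (?w \<alpha>))" if "\<alpha> \<in> ?A" for \<alpha> i
    proof -
      have "has_weak_deriv \<alpha> v (?w \<alpha>)"
        using that v by (intro has_weak_deriv_weak_deriv) (auto simp: sobolev_def)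
      moreover have "has_weak_deriv (\<alpha> + axis i 1) v (weak_deriv (\<alpha> + axis i 1) v)"
        using that v mi_abs_add_axis[of \<alpha> i] by (intro has_weak_deriv_weak_deriv) (auto simp: sobolev_def)
      ultimately show ?thesis
        by (intro has_weak_deriv_weak_deriv exI) (rule weak_deriv_of_weak_deriv)
    qed
    have "\<forall>\<alpha>\<in>?A. \<exists>G. has_L2_gradient (U \<alpha>) G \<and>
        (\<forall>i. AE x in lborel. weak_deriv (axis i 1) (?w \<alpha>) x = G x $ i)"
    proof
      fix \<alpha> assume \<alpha>: "\<alpha> \<in> ?A"
      then have "square_integrable (U \<alpha>)" "AE x in lborel. ?w \<alpha> x = U \<alpha> x" using U by auto
      from has_L2_gradient_representative[OF grad[OF \<alpha>] this]
      show "\<exists>G. has_L2_gradient (U \<alpha>) G \<and> (\<forall>i. AE x in lborel. weak_deriv (axis i 1) (?w \<alpha>) x = G x $ i)"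
        by metis
    qed
    from bchoice[OF this] obtain G where G: "\<And>\<alpha>. \<alpha> \<in> ?A \<Longrightarrow> has_L2_gradient (U \<alpha>) (G \<alpha>)"
      "\<And>\<alpha> i. \<alpha> \<in> ?A \<Longrightarrow> AE x in lborel. weak_deriv (axis i 1) (?w \<alpha>) x = G \<alpha> x $ i"
      by auto
    let ?N = "\<lambda>\<alpha>. \<Sum>i\<in>UNIV. sqnorm (\<lambda>x. G \<alpha> x $ i)"
    have grad_eq: "(grad_norm (?w \<alpha>))\<^sup>2 = ?N \<alpha>" if \<alpha>: "\<alpha> \<in> ?A" for \<alpha>
    proof -
      have L2: "L2_fun (weak_deriv (axis i 1) (?w \<alpha>))" for i
        using grad[OF \<alpha>, of i] by (simp add: has_weak_deriv_def)
      have sq: "(norm y)\<^sup>2 = (\<Sum>i\<in>UNIV. (y $ i)\<^sup>2)" for y :: "real ^ 'n"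
        unfolding power2_norm_eq_inner inner_vec_sum by (simp add: power2_eq_square)
      have "integral\<^sup>L lebesgue (\<lambda>x. (norm (weak_grad (?w \<alpha>) x))\<^sup>2)
          = integral\<^sup>L lebesgue (\<lambda>x. \<Sum>i\<in>UNIV. (weak_deriv (axis i 1) (?w \<alpha>) x)\<^sup>2)"
        by (simp add: sq weak_grad_def)
      also have "\<dots> = (\<Sum>i\<in>UNIV. integral\<^sup>L lebesgue (\<lambda>x. (weak_deriv (axis i 1) (?w \<alpha>) x)\<^sup>2))"
        using L2 by (intro Bochner_Integration.integral_sum) (auto simp: L2_fun_def)
      also have "\<dots> = ?N \<alpha>"
      proof (rule sum.cong[OF refl])
        fix i
        have "square_integrable (\<lambda>x. G \<alpha> x $ i)" using G(1)[OF \<alpha>] by (simp add: has_L2_gradient_def)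
        from integral_lebesgue_square_representative[OF L2 this G(2)[OF \<alpha>]]
        show "integral\<^sup>L lebesgue (\<lambda>x. (weak_deriv (axis i 1) (?w \<alpha>) x)\<^sup>2) = sqnorm (\<lambda>x. G \<alpha> x $ i)"
          by (simp only: power2_abs)
      qed
      finally show ?thesis by (simp add: grad_norm_def sum_nonneg sqnorm_nonneg)
    qed
    have norm_eq: "(grad_seminorm l v)\<^sup>2 = (\<Sum>\<alpha>\<in>?A. ?N \<alpha>)"
    proof -
      have "(\<Sum>\<alpha>\<in>?A. (grad_norm (?w \<alpha>))\<^sup>2) = (\<Sum>\<alpha>\<in>?A. ?N \<alpha>)"
        by (rule sum.cong[OF refl grad_eq])
      then show ?thesis by (simp add: grad_seminorm_def sum_nonneg sqnorm_nonneg)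
    qed
    have sum_eq: "frac_seminorm_sq l s v = (\<Sum>\<alpha>\<in>?A. kernel_energy s (translation_sqdiff (U \<alpha>)))" for s
      by (rule frac_seminorm_sq_eq_sum) (use U in auto)
    let ?c = "?S / (2 * real CARD('n))"
    have "((\<lambda>\<sigma>. \<Sum>\<alpha>\<in>?A. ennreal (1 - \<sigma>) * kernel_energy \<sigma> (translation_sqdiff (U \<alpha>)))
        \<longlongrightarrow> (\<Sum>\<alpha>\<in>?A. ennreal (?c * ?N \<alpha>))) (at_left 1)"
      by (intro tendsto_sum gagliardo_limit_at_1 G(1))
    moreover have "(\<Sum>\<alpha>\<in>?A. ennreal (?c * ?N \<alpha>)) = ennreal (?c * (grad_seminorm l v)\<^sup>2)"
      unfolding norm_eq sum_distrib_left[of ?c ?N]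
      by (rule sum_ennreal) (intro mult_nonneg_nonneg divide_nonneg_nonneg S sum_nonneg sqnorm_nonneg, auto)
    moreover have "?c = pi powr (real CARD('n) / 2) / (real CARD('n) * Gamma (real CARD('n) / 2))"
      by (simp add: sphere_area_vec)
    ultimately show "((\<lambda>\<sigma>. ennreal (1 - \<sigma>) * frac_seminorm_sq l \<sigma> v) \<longlongrightarrow>
        ennreal (pi powr (real CARD('n) / 2) / (real CARD('n) * Gamma (real CARD('n) / 2))
          * (grad_seminorm l v)\<^sup>2)) (at_left 1)"
      unfolding sum_eq sum_distrib_left by simp
  }
qed

end
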